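(* The operators $T_t=M\circ S_t\circ L:\mathcal{D}\to\mathcal{D}$, $t\ge0$, form a Lipschitz continuous semigroup on $(\mathcal{D},d_{\mathcal{D}})$: one has $T_tT_s=T_{t+s}$ for all $s,t\ge0$, and for all $(u,\rho,\mu),(\bar u,\bar\rho,\bar\mu)\in\mathcal{D}$ and all $t\ge0$, $$d_{\mathcal{D}}\big(T_t(u,\rho,\mu),T_t(\bar u,\bar\rho,\bar\mu)\big)\le e^{\frac12t}\big(\tfrac12t^2+t+1\big)\,d_{\mathcal{D}}\big((u,\rho,\mu),(\bar u,\bar\rho,\bar\mu)\big).$$
   Context: Function spaces. $E_2=\{f\in L^\infty(\mathbb{R}): f'\in L^2(\mathbb{R})\}$ and $E_1=\{f\in E_2:\lim_{x\to-\infty}f(x)=0\}$, both with norm $\|f\|_\infty+\|f'\|_2$ (elements are identified with their continuous representatives). $B=E_2\times E_2\times E_1\times L^2(\mathbb{R})$ with norm $\|(f_1,f_2,f_3,f_4)\|_B=\|f_1\|_{E_2}+\|f_2\|_{E_2}+\|f_3\|_{E_1}+\|f_4\|_2$. $\mathcal{D}$ is the set of triples $(u,\rho,\mu)$ with $u\in E_2$, $\rho\in L^2(\mathbb{R})$, $\mu$ a positive finite Radon measure on $\mathbb{R}$ whose absolutely continuous part is $\mu_{ac}=(u_x^2+\rho^2)\,\mathrm{d}x$. $\mathcal{F}$ is the set of quadruples $X=(y,U,H,r)$ with $(y-\mathrm{id},U,H,r)\in B$ for which there is $c>0$ such that: (i) $y-\mathrm{id},U,H\in W^{1,\infty}(\mathbb{R})$,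 $r\in L^\infty(\mathbb{R})$; (ii) $y_\xi\ge0$, $H_\xi\ge0$, $y_\xi+H_\xi\ge c$ a.e.; (iii) $y_\xi H_\xi=U_\xi^2+r^2$ a.e. $\mathcal{F}_0=\{X\in\mathcal{F}: y+H=\mathrm{id}\}$. For $X,\bar X\in\mathcal{F}$, $X-\bar X$ is the componentwise difference. $L:\mathcal{D}\to\mathcal{F}_0$, $L(u,\rho,\mu)=(y,U,H,r)$ with $y(\xi)=\sup\{x:\mu((-\infty,x))+x<\xi\}$, $H(\xi)=\xi-y(\xi)$, $U=u\circ y$, $r=(\rho\circ y)\,y_\xi$. $M:\mathcal{F}\to\mathcal{D}$, $M(y,U,H,r)=(u,\rho,\mu)$ with $u(x)=U(\xi)$ for any $\xi$ with $y(\xi)=x$, $\rho\,\mathrm{d}x=y_\#(r\,\mathrm{d}\xi)$, $\mu=y_\#(H_\xi\,\mathrm{d}\xi)$, where $y_\#$ denotes push-forward of measures by $y$. $S_t:\mathcal{F}\to\mathcal{F}$ ($t\ge0$) is given by $S_t(y_0,U_0,H_0,r_0)=\big(\frac14(H_0-\frac12H_\infty)t^2+U_0t+y_0,\ \frac12(H_0-\frac12H_\infty)t+U_0,\ H_0,\ r_0\big)$ with $H_\infty=\lim_{\xi\to\infty}H_0(\xi)$ (the solution of $y_t=U$, $U_t=\frac12H-\frac14H_\infty$, $H_t=0$, $r_t=0$). $G$ is the group (under composition) of homeomorphisms $f:\mathbb{R}\to\mathbb{R}$ with $f-\mathrm{id}\in W^{1,\infty}(\mathbb{R})$, $f^{-1}-\mathrm{id}\in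 W^{1,\infty}(\mathbb{R})$ and $f_\xi-1\in L^2(\mathbb{R})$. It acts on $\mathcal{F}$ by $X\bullet f=(y\circ f,U\circ f,H\circ f,(r\circ f)f_\xi)$. For $X,\bar X\in\mathcal{F}$: $J(X,\bar X)=\inf_{f,g\in G}\big(\|X\bullet f-\bar X\|_B+\|X-\bar X\bullet g\|_B\big)$. For $X,\bar X\in\mathcal{F}_0$: $d(X,\bar X)=\inf\sum_{n=1}^NJ(X_{n-1},X_n)$, the infimum over all finite sequences $\{X_n\}_{n=0}^N$ in $\mathcal{F}_0$ with $X_0=X$, $X_N=\bar X$; $d$ is a metric on $\mathcal{F}_0$. The metric $d_{\mathcal{D}}$ on $\mathcal{D}$ is $d_{\mathcal{D}}\big((u,\rho,\mu),(\bar u,\bar\rho,\bar\mu)\big)=d\big(L(u,\rho,\mu),L(\bar u,\bar\rho,\bar\mu)\big)$. *)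

theory Defs
  imports "HOL-Analysis.Analysis" "HOL-Probability.Essential_Supremum"
begin

text \<open>
  Elements of Lebesgue spaces are represented by Borel functions; all notions below that take
  such a function depend only on its class modulo equality almost everywhere.
\<close>

subsection \<open>Lebesgue and Sobolev spaces on the real line\<close>

definition locint :: "(real \<Rightarrow> real) \<Rightarrow> bool" where
  "locint f \<longleftrightarrow> f \<in> borel_measurable borel \<and> (\<forall>a b. set_integrable lborel {a..b} f)"

definition L2 :: "(real \<Rightarrow> real) set" where
  "L2 = {f. f \<in> borel_measurable borel \<and> integrable lborel (\<lambda>x. (f x)\<^sup>2)}"

definition norm2 :: "(real \<Rightarrow> real) \<Rightarrow> real" where
  "norm2 f = sqrt (LINT x|lborel. (f x)\<^sup>2)"

definition Linf :: "(real \<Rightarrow> real) set" where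
  "Linf = {f. f \<in> borel_measurable borel \<and> esssup lborel (\<lambda>x. ereal \<bar>f x\<bar>) < \<infinity>}"

definition norminf :: "(real \<Rightarrow> real) \<Rightarrow> real" where
  "norminf f = real_of_ereal (esssup lborel (\<lambda>x. ereal \<bar>f x\<bar>))"

text \<open>
  Weak derivatives, with compactly supported, continuously differentiable test functions.
\<close>

definition has_weak_deriv :: "(real \<Rightarrow> real) \<Rightarrow> (real \<Rightarrow> real) \<Rightarrow> bool" where
  "has_weak_deriv f g \<longleftrightarrow> locint f \<and> locint g \<and>
     (\<forall>\<phi> \<phi>'. (\<forall>x. (\<phi> has_real_derivative \<phi>' x) (at x)) \<and> continuous_on UNIV \<phi>' \<and>
             bounded {x. \<phi> x \<noteq> 0} \<longrightarrow>
        (LINT x|lborel. f x * \<phi>' x) = - (LINT x|lborel. g x * \<phi> x))"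

definition weakly_diff :: "(real \<Rightarrow> real) \<Rightarrow> bool" where
  "weakly_diff f \<longleftrightarrow> (\<exists>g. has_weak_deriv f g)"

text \<open>A representative of the weak derivative, which is unique almost everywhere.\<close>

definition wderiv :: "(real \<Rightarrow> real) \<Rightarrow> real \<Rightarrow> real" where
  "wderiv f = (SOME g. has_weak_deriv f g)"

definition W1inf :: "(real \<Rightarrow> real) set" where
  "W1inf = {f. f \<in> Linf \<and> weakly_diff f \<and> wderiv f \<in> Linf}"

text \<open>Continuity below selects the continuous representative.\<close>

definition E2 :: "(real \<Rightarrow> real) set" where
  "E2 = {f. continuous_on UNIV f \<and> f \<in> Linf \<and> weakly_diff f \<and> wderiv f \<in> L2}"

definition E1 :: "(real \<Rightarrow> real) set" where
  "E1 = {f \<in> E2. (f \<longlongrightarrow> 0) at_bot}"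

definition normE :: "(real \<Rightarrow> real) \<Rightarrow> real" where
  "normE f = norminf f + norm2 (wderiv f)"

type_synonym quad = "(real \<Rightarrow> real) \<times> (real \<Rightarrow> real) \<times> (real \<Rightarrow> real) \<times> (real \<Rightarrow> real)"

definition spaceB :: "quad set" where
  "spaceB = E2 \<times> E2 \<times> E1 \<times> L2"

fun normB :: "quad \<Rightarrow> real" where
  "normB (f1, f2, f3, f4) = normE f1 + normE f2 + normE f3 + norm2 f4"

fun quad_diff :: "quad \<Rightarrow> quad \<Rightarrow> quad" where
  "quad_diff (f1, f2, f3, f4) (g1, g2, g3, g4) =
     (\<lambda>x. f1 x - g1 x, \<lambda>x. f2 x - g2 x, \<lambda>x. f3 x - g3 x, \<lambda>x. f4 x - g4 x)"


subsection \<open>Eulerian and Lagrangian coordinates\<close>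

text \<open>Lebesgue decomposition: \<open>\<alpha>\<close> is the absolutely continuous part of \<open>\<mu>\<close>.\<close>

definition is_ac_part :: "real measure \<Rightarrow> real measure \<Rightarrow> bool" where
  "is_ac_part \<mu> \<alpha> \<longleftrightarrow> sets \<alpha> = sets borel \<and> absolutely_continuous lborel \<alpha> \<and>
     (\<exists>\<nu>. sets \<nu> = sets borel \<and> (\<exists>N \<in> null_sets lborel. emeasure \<nu> (UNIV - N) = 0) \<and>
          (\<forall>A \<in> sets borel. emeasure \<mu> A = emeasure \<alpha> A + emeasure \<nu> A))"

type_synonym triple = "(real \<Rightarrow> real) \<times> (real \<Rightarrow> real) \<times> real measure"

text \<open>Every finite Borel measure on the real line is a Radon measure.\<close>

definition Eul :: "triple set" where
  "Eul = {(u, \<rho>, \<mu>). u \<in> E2 \<and> \<rho> \<in> L2 \<and> sets \<mu> = sets borel \<and> finite_measure \<mu> \<and>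
     is_ac_part \<mu> (density lborel (\<lambda>x. ennreal ((wderiv u x)\<^sup>2 + (\<rho> x)\<^sup>2)))}"

text \<open>Equality of elements of \<^const>\<open>Eul\<close>: the second component is a class in \<open>L\<^sup>2\<close>.\<close>

fun eul_eq :: "triple \<Rightarrow> triple \<Rightarrow> bool" (infix "\<approx>\<^sub>D" 50) where
  "((u, \<rho>, \<mu>) \<approx>\<^sub>D (u', \<rho>', \<mu>')) \<longleftrightarrow> u = u' \<and> (AE x in lborel. \<rho> x = \<rho>' x) \<and> \<mu> = \<mu>'"

definition Lag :: "quad set" where
  "Lag = {(y, U, H, r). (\<lambda>\<xi>. y \<xi> - \<xi>, U, H, r) \<in> spaceB \<and>
     (\<exists>c>0. (\<lambda>\<xi>. y \<xi> - \<xi>) \<in> W1inf \<and> U \<in> W1inf \<and> H \<in> W1inf \<and> r \<in> Linf \<and>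
        (AE \<xi> in lborel. wderiv y \<xi> \<ge> 0 \<and> wderiv H \<xi> \<ge> 0 \<and> wderiv y \<xi> + wderiv H \<xi> \<ge> c) \<and>
        (AE \<xi> in lborel. wderiv y \<xi> * wderiv H \<xi> = (wderiv U \<xi>)\<^sup>2 + (r \<xi>)\<^sup>2))}"

definition Lag0 :: "quad set" where
  "Lag0 = {(y, U, H, r). (y, U, H, r) \<in> Lag \<and> (\<forall>\<xi>. y \<xi> + H \<xi> = \<xi>)}"

fun mapL :: "triple \<Rightarrow> quad" where
  "mapL (u, \<rho>, \<mu>) =
     (let y = (\<lambda>\<xi>. Sup {x. measure \<mu> {..<x} + x < \<xi>})
      in (y, u \<circ> y, \<lambda>\<xi>. \<xi> - y \<xi>, \<lambda>\<xi>. \<rho> (y \<xi>) * wderiv y \<xi>))"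

text \<open>
  The identity \<open>\<rho> dx = y\<^sub># (r d\<xi>)\<close> between signed Radon measures, which need not be finite and are
  therefore compared on bounded Borel sets. (The preimage under \<open>y\<close> of a bounded set is bounded
  when \<open>y - id\<close> is.)
\<close>

definition is_push_density ::
    "(real \<Rightarrow> real) \<Rightarrow> (real \<Rightarrow> real) \<Rightarrow> (real \<Rightarrow> real) \<Rightarrow> bool" where
  "is_push_density y r \<rho> \<longleftrightarrow> locint \<rho> \<and>
     (\<forall>A \<in> sets borel. bounded A \<longrightarrow>
        (LINT x:A|lborel. \<rho> x) = (LINT \<xi>:(y -` A)|lborel. r \<xi>))"

fun mapM :: "quad \<Rightarrow> triple" where
  "mapM (y, U, H, r) =
     (\<lambda>x. U (SOME \<xi>. y \<xi> = x),
      SOME \<rho>. is_push_density y r \<rho>,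
      distr (density lborel (\<lambda>\<xi>. ennreal (wderiv H \<xi>))) borel y)"

fun flowS :: "real \<Rightarrow> quad \<Rightarrow> quad" where
  "flowS t (y, U, H, r) =
     (let Hinf = Lim at_top H
      in (\<lambda>\<xi>. 1/4 * (H \<xi> - 1/2 * Hinf) * t\<^sup>2 + U \<xi> * t + y \<xi>,
          \<lambda>\<xi>. 1/2 * (H \<xi> - 1/2 * Hinf) * t + U \<xi>,
          H, r))"

definition opT :: "real \<Rightarrow> triple \<Rightarrow> triple" where
  "opT t Z = mapM (flowS t (mapL Z))"


subsection \<open>Relabeling and the metric\<close>

definition relabG :: "(real \<Rightarrow> real) set" where
  "relabG = {f. homeomorphism UNIV UNIV f (inv f) \<and> (\<lambda>\<xi>. f \<xi> - \<xi>) \<in> W1inf \<and>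
     (\<lambda>\<xi>. inv f \<xi> - \<xi>) \<in> W1inf \<and> (\<lambda>\<xi>. wderiv f \<xi> - 1) \<in> L2}"

fun relabel :: "quad \<Rightarrow> (real \<Rightarrow> real) \<Rightarrow> quad" (infixl "\<bullet>\<^sub>G" 75) where
  "(y, U, H, r) \<bullet>\<^sub>G f = (y \<circ> f, U \<circ> f, H \<circ> f, \<lambda>\<xi>. r (f \<xi>) * wderiv f \<xi>)"

definition distJ :: "quad \<Rightarrow> quad \<Rightarrow> real" where
  "distJ X Y = (INF (f, g) \<in> relabG \<times> relabG.
     normB (quad_diff (X \<bullet>\<^sub>G f) Y) + normB (quad_diff X (Y \<bullet>\<^sub>G g)))"

definition distLag :: "quad \<Rightarrow> quad \<Rightarrow> real" where
  "distLag X Y = Inf {(\<Sum>n=1..N. distJ (Z (n - 1)) (Z n)) | (N::nat) Z.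
     Z 0 = X \<and> Z N = Y \<and> (\<forall>n\<le>N. Z n \<in> Lag0)}"

definition distEul :: "triple \<Rightarrow> triple \<Rightarrow> real" where
  "distEul Z Z' = distLag (mapL Z) (mapL Z')"

end

theory Submission
  imports Defs
begin

text \<open>
  For continuous functions, having a weak derivative means being a primitive of a locally integrable
  function, so everything reduces to densities and push-forwards of measures, and no pointwise
  differentiation is needed. If \<open>y\<close> is a nondecreasing primitive of \<open>y'\<close> and \<open>y - id\<close> is bounded,
  then \<open>y\<close> pushes \<open>y' d\<xi>\<close> forward to Lebesgue measure. Moreover \<open>y\<close> is injective off the preimage of the
  countable set of its values at rational points, and \<open>y' = 0\<close> almost everywhere on that preimage;
  hence densities can be transported in both directions between the Lagrangian and the Eulerian line.

  The composition \<open>L \<circ> M\<close> is the relabelling by the inverse of \<open>q = y + H\<close>, whereas \<open>M\<close> is invariant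
  under relabelling and \<open>S\<^sub>t\<close> commutes with it; this gives the semigroup property. For the Lipschitz
  estimate, \<open>S\<^sub>t\<close> is linear and expands the norm of \<open>B\<close> by at most
  \<open>1 + t + t\<^sup>2/2\<close>, while for \<open>X \<in> F\<^sub>0\<close> the function \<open>q\<close> belonging to \<open>S\<^sub>t X\<close> has slope at least
  \<open>exp (-t)\<close>, so that composing with its inverse expands \<open>L\<^sup>2\<close> norms by at most \<open>exp (t/2)\<close>.
\<close>

subsection \<open>Primitives and weak derivatives\<close>

text \<open>The obstacle is that \<open>y\<close> may be constant on intervals. A null set of the
  Eulerian line can then have a preimage of positive measure, and statements that hold almost
  everywhere can be pulled back only to the points with \<open>y' \<noteq> 0\<close>. The relation
  \<open>y' H' = U'\<^sup>2 + r\<^sup>2\<close> compensates for this: \<open>U'\<close> and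
  \<open>r\<close> vanish where \<open>y'\<close> does, so all that survives there is
  \<open>H'\<close>, and its push-forward is the singular part of the measure. The metric lives on
  \<open>Lag0\<close>, which the flow leaves, so evolved states are projected back, each by its own
  relabelling. The Lipschitz constant stays uniform because a relabelling \<open>f\<close> of the
  initial states is answered by \<open>p \<circ> f \<circ> q^{-1}\<close>, where \<open>p\<close>
  and \<open>q\<close> are the sums \<open>y + H\<close> of the two evolved states: only the slope
  of \<open>q\<close> is paid for. Its bound rests on \<open>y' + H' = 1\<close> at time 0 and on
  \<open>U'\<^sup>2 \<le> y' H'\<close>. \<open>M\<close> chooses preimages and densities
  arbitrarily. Choices made from equal predicates are equal, so the semigroup law is proved as an
  equality and not merely up to null sets.\<close>

definition prim :: "(real \<Rightarrow> real) \<Rightarrow> (real \<Rightarrow> real) \<Rightarrow> bool" where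
  "prim f g \<longleftrightarrow> locint g \<and> (\<forall>a b. a \<le> b \<longrightarrow> f b - f a = (LINT x:{a..b}|lborel. g x))"

lemma locintD:
  assumes "locint g"
  shows "g \<in> borel_measurable borel" "set_integrable lborel {a..b} g"
  using assms by (auto simp: locint_def)

lemma locint_bound:
  assumes "locint h" "g \<in> borel_measurable borel" "AE x in lborel. \<bar>g x\<bar> \<le> \<bar>h x\<bar>"
  shows "locint g"
  unfolding locint_def
proof (intro conjI allI)
  fix a b
  show "set_integrable lborel {a..b} g"
    by (rule set_integrable_bound[OF locintD(2)[OF assms(1)]])
      (use assms in \<open>auto simp: set_borel_measurable_def\<close>)
qed fact

lemma locint_const: "locint (\<lambda>x. c)"
  by (auto simp: locint_def set_integrable_def emeasure_lborel_Icc_eq)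

lemma locint_add: "locint f \<Longrightarrow> locint g \<Longrightarrow> locint (\<lambda>x. f x + g x)"
  by (auto simp: locint_def set_integral_add)

lemma locint_cmult: "locint f \<Longrightarrow> locint (\<lambda>x. c * f x)"
  by (auto simp: locint_def)

lemma locint_diff: "locint f \<Longrightarrow> locint g \<Longrightarrow> locint (\<lambda>x. f x - g x)"
  by (auto simp: locint_def set_integral_diff)

lemma locint_bounded:
  assumes "g \<in> borel_measurable borel" "AE x in lborel. \<bar>g x\<bar> \<le> K"
  shows "locint g"
  by (rule locint_bound[OF locint_const[of K] assms(1)]) (use assms(2) in auto)

lemma locint_L2:
  assumes "g \<in> L2"
  shows "locint g"
  unfolding locint_def
proof (intro conjI allI)
  show [measurable]: "g \<in> borel_measurable borel" using assms by (simp add: L2_def)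
  fix a b
  have "set_integrable lborel {a..b} (\<lambda>x. 1 + (g x)\<^sup>2)"
    using assms locintD(2)[OF locint_const[of 1]]
    by (intro set_integral_add)
      (auto simp: L2_def set_integrable_def intro!: integrable_mult_indicator[where 'b=real, unfolded real_scaleR_def])
  moreover have "\<bar>g x\<bar> \<le> \<bar>1 + (g x)\<^sup>2\<bar>" for x
    using zero_le_power2[of "\<bar>g x\<bar> - 1"] zero_le_power2[of "g x"]
    by (simp add: power2_diff)
  ultimately show "set_integrable lborel {a..b} g"
    by (intro set_integrable_bound[where f="\<lambda>x. 1 + (g x)\<^sup>2" and g=g]) (auto simp: set_borel_measurable_def)
qed

lemma primD:
  assumes "prim f g"
  shows "locint g" "g \<in> borel_measurable borel" "set_integrable lborel {a..b} g"
    "a \<le> b \<Longrightarrow> f b - f a = (LINT x:{a..b}|lborel. g x)"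
  using assms by (auto simp: prim_def locint_def)

lemma set_lint_cong_AE:
  assumes "AE x in lborel. g x = g' x" "g \<in> borel_measurable borel" "g' \<in> borel_measurable borel"
    "A \<in> sets borel"
  shows "(LINT x:A|lborel. g x) = (LINT x:A|lborel. (g' x :: real))"
  using assms by (intro set_lebesgue_integral_cong_AE) auto

lemma locint_cong_AE:
  assumes "locint g" "AE x in lborel. g x = g' x" "g' \<in> borel_measurable borel"
  shows "locint g'"
  by (rule locint_bound[OF assms(1,3)]) (use assms(2) in auto)

lemma prim_cong_AE:
  assumes "prim f g" "AE x in lborel. g x = g' x" "g' \<in> borel_measurable borel"
  shows "prim f g'"
  unfolding prim_def
proof (intro conjI allI impI)
  show "locint g'" using assms locint_cong_AE primD by blast
  fix a b :: real assume "a \<le> b"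
  then show "f b - f a = (LINT x:{a..b}|lborel. g' x)"
    using primD(4)[OF assms(1)] set_lint_cong_AE[OF assms(2) primD(2)[OF assms(1)] assms(3), of "{a..b}"]
    by simp
qed

lemma prim_const: "prim (\<lambda>x. c) (\<lambda>x. 0)"
  by (auto simp: prim_def locint_const)

lemma prim_id: "prim (\<lambda>x. x) (\<lambda>x. 1)"
  by (auto simp: prim_def locint_const set_integral_const)

lemma prim_add: "prim f f' \<Longrightarrow> prim g g' \<Longrightarrow> prim (\<lambda>x. f x + g x) (\<lambda>x. f' x + g' x)"
  by (auto simp: prim_def locint_add locintD set_integral_add) (smt (verit))

lemma prim_cmult: "prim f f' \<Longrightarrow> prim (\<lambda>x. c * f x) (\<lambda>x. c * f' x)"
  by (auto simp: prim_def locint_cmult simp flip: right_diff_distrib)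

lemma prim_diff: "prim f f' \<Longrightarrow> prim g g' \<Longrightarrow> prim (\<lambda>x. f x - g x) (\<lambda>x. f' x - g' x)"
  using prim_add[of f f' "\<lambda>x. (-1) * g x" "\<lambda>x. (-1) * g' x"] prim_cmult[of g g' "-1"] by simp

lemma lborel_Ioc_Icc: 
  fixes g :: "real \<Rightarrow> real"
  assumes [measurable]: "g \<in> borel_measurable borel"
  shows "(LINT x:{a<..b}|lborel. g x) = (LINT x:{a..b}|lborel. g x)"
proof (rule set_integral_cong_set)
  show "AE x in lborel. (x \<in> {a..b}) = (x \<in> {a<..b})"
    using AE_lborel_singleton[of a] by eventually_elim auto
qed (auto simp: set_borel_measurable_def)

lemma prim_nn_integral:
  assumes "prim f g" "\<And>x. 0 \<le> g x" "a \<le> b"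
  shows "emeasure (density lborel (\<lambda>x. ennreal (g x))) {a..b} = ennreal (f b - f a)"
proof -
  have [measurable]: "g \<in> borel_measurable borel" using assms primD by blast
  have "emeasure (density lborel (\<lambda>x. ennreal (g x))) {a..b} = (\<integral>\<^sup>+x. ennreal (indicator {a..b} x * g x) \<partial>lborel)"
    by (subst emeasure_density) (auto intro!: nn_integral_cong simp: indicator_def)
  also have "\<dots> = ennreal (LINT x|lborel. indicator {a..b} x * g x)"
    by (rule nn_integral_eq_integral)
      (use primD(3)[OF assms(1)] assms in \<open>auto simp: set_integrable_def\<close>)
  also have "(LINT x|lborel. indicator {a..b} x * g x) = f b - f a"
    using primD(4)[OF assms(1,3)] by (simp add: set_lebesgue_integral_def)
  finally show ?thesis .
qed

section \<open>Measures and densities determined by their values on intervals\<close>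

lemma emeasure_density_Ioc_Icc:
  assumes [measurable]: "k \<in> borel_measurable borel"
  shows "emeasure (density lborel k) {a<..b} = emeasure (density lborel k) {a..b::real}"
proof -
  have "AE x in lborel. k x * indicator {a<..b} x = k x * indicator {a..b} x"
    using AE_lborel_singleton[of a] by eventually_elim (auto simp: indicator_def)
  then show ?thesis by (simp add: emeasure_density cong: nn_integral_cong_AE)
qed

lemma measure_eqI_Ioc:
  assumes "sets M = sets borel" "sets N = sets borel"
    and eq: "\<And>a b. a \<le> b \<Longrightarrow> emeasure M {a<..b} = emeasure N {a<..b}"
    and fin: "\<And>a b. emeasure M {a<..b::real} \<noteq> \<infinity>"
  shows "M = N"
proof (rule measure_eqI_generator_eq)
  let ?E = "range (\<lambda>(a, b). {a<..b::real})"
  show "Int_stable ?E"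
    by (auto simp: Int_stable_def Int_greaterThanAtMost)
  show "?E \<subseteq> Pow UNIV" "sets M = sigma_sets UNIV ?E" "sets N = sigma_sets UNIV ?E"
    by (simp_all add: borel_sigma_sets_Ioc assms)
  let ?A = "\<lambda>n::nat. {- real n <.. real n}"
  show "range ?A \<subseteq> ?E" by auto
  show "(\<Union>i. ?A i) = UNIV"
  proof safe
    fix x :: real
    obtain n where "\<bar>x\<bar> < real n" using reals_Archimedean2 by blast
    then show "x \<in> (\<Union>i. ?A i)" by (auto intro!: exI[of _ n])
  qed auto
  show "emeasure M (?A i) \<noteq> \<infinity>" for i by (rule fin)
  fix X assume "X \<in> ?E"
  then obtain a b where X: "X = {a<..b}" by auto
  show "emeasure M X = emeasure N X"
    by (cases "a \<le> b") (auto simp: X eq)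
qed

text \<open>Reduces to uniqueness of densities: the positive and the negative part of the difference
  are densities of two locally finite measures that agree on half-open intervals, hence are equal. A
  function whose positive and negative parts coincide is zero.\<close>

lemma locint_eq_AE:
  assumes "locint g" "locint g'"
    and eq: "\<And>a b. a \<le> b \<Longrightarrow> (LINT x:{a..b}|lborel. g x) = (LINT x:{a..b}|lborel. g' x)"
  shows "AE x in lborel. g x = g' x"
proof -
  define h where "h x = g x - g' x" for x
  have h: "locint h" unfolding h_def using assms locint_diff by blast
  have [measurable]: "h \<in> borel_measurable borel" using h locintD by blast
  have h0: "(LINT x:{a..b}|lborel. h x) = 0" if "a \<le> b" for a b
    unfolding h_def using eq[OF that] assms by (simp add: set_integral_diff locintD)
  have 1: "locint (\<lambda>x. max 0 (h x))" "locint (\<lambda>x. max 0 (- h x))"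
    by (rule locint_bound[OF h]; auto)+
  have fin: "emeasure (density lborel (\<lambda>x. ennreal (max 0 (k x)))) {a<..b}
      = ennreal (LINT x:{a..b}|lborel. max 0 (k x))" if k: "locint (\<lambda>x. max 0 (k x))" for k a b
  proof -
    have [measurable]: "(\<lambda>x. max 0 (k x)) \<in> borel_measurable borel" using k locintD by blast
    have "emeasure (density lborel (\<lambda>x. ennreal (max 0 (k x)))) {a<..b} =
       (\<integral>\<^sup>+x. ennreal (indicator {a..b} x * max 0 (k x)) \<partial>lborel)"
      by (subst emeasure_density_Ioc_Icc, measurable, subst emeasure_density) 
         (auto intro!: nn_integral_cong simp: indicator_def)
    also have "\<dots> = ennreal (LINT x|lborel. indicator {a..b} x * max 0 (k x))"
      by (rule nn_integral_eq_integral)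
       (use locintD(2)[OF k] in \<open>auto simp: set_integrable_def\<close>)
    finally show ?thesis by (simp add: set_lebesgue_integral_def)
  qed
  have "density lborel (\<lambda>x. ennreal (max 0 (h x))) = density lborel (\<lambda>x. ennreal (max 0 (- h x)))"
  proof (rule measure_eqI_Ioc)
    fix a b :: real assume "a \<le> b"
    have "(LINT x:{a..b}|lborel. h x) = (LINT x:{a..b}|lborel. max 0 (h x) - max 0 (- h x))"
      by (intro arg_cong[where f="set_lebesgue_integral lborel {a..b}"] ext) auto
    also have "\<dots> = (LINT x:{a..b}|lborel. max 0 (h x)) - (LINT x:{a..b}|lborel. max 0 (- h x))"
      using 1 by (intro set_integral_diff locintD)
    finally show "emeasure (density lborel (\<lambda>x. ennreal (max 0 (h x)))) {a<..b} =
       emeasure (density lborel (\<lambda>x. ennreal (max 0 (- h x)))) {a<..b}"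
      using h0[OF \<open>a \<le> b\<close>] by (simp add: fin 1 fin[of "\<lambda>x. - h x", OF 1(2)])
  qed (use fin[OF 1(1)] in auto)
  then have "AE x in lborel. ennreal (max 0 (h x)) = ennreal (max 0 (- h x))"
    by (intro sigma_finite_measure.density_unique[OF sigma_finite_lborel]) auto
  then show ?thesis
    by eventually_elim (auto simp: h_def max_def split: if_splits)
qed

lemma prim_unique:
  assumes "prim f g" "prim f g'"
  shows "AE x in lborel. g x = g' x"
  using assms by (intro locint_eq_AE) (auto simp: prim_def)

lemma prim_continuous:
  assumes "prim f g"
  shows "continuous_on UNIV f"
proof -
  have "isCont f x" for x
  proof -
    have "continuous_on {x-1..x+1} (\<lambda>t. f (x-1) + integral {x-1..t} g)"
      by (intro continuous_intros indefinite_integral_continuous_1)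
        (use primD(3)[OF assms] set_borel_integral_eq_integral(1) in blast)
    moreover have "f t = f (x-1) + integral {x-1..t} g" if "t \<in> {x-1..x+1}" for t
      using that primD(4)[OF assms, of "x-1" t] set_borel_integral_eq_integral(2)[OF primD(3)[OF assms]]
      by simp
    ultimately have "continuous_on {x-1..x+1} f"
      using continuous_on_eq by (metis (no_types, lifting))
    then show "isCont f x"
      by (rule continuous_on_interior) auto
  qed
  then show ?thesis by (simp add: continuous_on_eq_continuous_at)
qed

section \<open>Monotone Lipschitz functions as primitives\<close>

lemma sum_of_measures:
  fixes M1 M2 :: "'a measure"
  assumes "sets M1 = sets M" "sets M2 = sets M"
  obtains S where "sets S = sets M"
    "\<And>A. A \<in> sets M \<Longrightarrow> emeasure S A = emeasure M1 A + emeasure M2 A"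
proof -
  define S where "S = measure_of (space M) (sets M) (\<lambda>A. emeasure M1 A + emeasure M2 A)"
  have sets: "sets S = sets M" by (simp add: S_def)
  have em: "emeasure S A = emeasure M1 A + emeasure M2 A" if "A \<in> sets M" for A
    unfolding S_def
  proof (rule emeasure_measure_of_sigma[OF _ _ _ that])
    show "countably_additive (sets M) (\<lambda>A. emeasure M1 A + emeasure M2 A)"
    proof (rule countably_additiveI)
      fix A :: "nat \<Rightarrow> 'a set" assume A: "range A \<subseteq> sets M" "disjoint_family A"
      then show "(\<Sum>i. emeasure M1 (A i) + emeasure M2 (A i)) 
          = emeasure M1 (\<Union> (range A)) + emeasure M2 (\<Union> (range A))"
        using suminf_emeasure[of A M1] suminf_emeasure[of A M2] assms
        by (simp add: suminf_add[symmetric])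
    qed
  qed (auto simp: positive_def sets.sigma_algebra_axioms)
  from that sets em show ?thesis by blast
qed

text \<open>The Stieltjes measures of \<open>f\<close> and of \<open>K * x - f x\<close> add up to
  \<open>K\<close> times Lebesgue measure, so each is absolutely continuous and the derivative is a
  Radon-Nikodym density. This supplies the derivatives of the map \<open>y\<close> of
  \<open>L\<close> and of the relabellings in \<open>relabG\<close>.\<close>

lemma lipschitz_mono_prim:
  fixes f :: "real \<Rightarrow> real"
  assumes "\<And>a b. a \<le> b \<Longrightarrow> f a \<le> f b" "\<And>a b. a \<le> b \<Longrightarrow> f b - f a \<le> K * (b - a)" 
  obtains g where "prim f g" "\<And>x. 0 \<le> g x" "\<And>x. g x \<le> K"
proof -
  have "0 \<le> f 1 - f 0" "f 1 - f 0 \<le> K" using assms(1)[of 0 1] assms(2)[of 0 1] by auto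
  then have K: "0 \<le> K" by linarith
  define f2 where "f2 x = K * x - f x" for x
  have mono2: "a \<le> b \<Longrightarrow> f2 a \<le> f2 b" for a b using assms(2)[of a b] by (simp add: f2_def algebra_simps)
  have lip: "\<bar>f b - f a\<bar> \<le> K * \<bar>b - a\<bar>" for a b
    using assms(1)[of a b] assms(2)[of a b] assms(1)[of b a] assms(2)[of b a] 
    by (cases "a \<le> b") (auto simp: abs_if)
  then have "K-lipschitz_on UNIV f" 
    using K by (auto simp: lipschitz_on_def dist_real_def abs_minus_commute)
  then have cont: "continuous_on UNIV f" by (rule lipschitz_on_continuous_on)
  then have cont2: "continuous_on UNIV f2" unfolding f2_def by (intro continuous_intros) auto
  have rc: "continuous (at_right a) f" "continuous (at_right a) f2" for a
    using cont cont2 by (auto intro: continuous_within_subset simp: continuous_on_eq_continuous_within)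
  define M1 where "M1 = interval_measure f"
  define M2 where "M2 = interval_measure f2"
  have s: "sets M1 = sets borel" "sets M2 = sets borel" by (simp_all add: M1_def M2_def)
  have I1: "emeasure M1 {a<..b} = ennreal (f b - f a)" if "a \<le> b" for a b
    unfolding M1_def using assms(1) rc that by (intro emeasure_interval_measure_Ioc) auto
  have I2: "emeasure M2 {a<..b} = ennreal (f2 b - f2 a)" if "a \<le> b" for a b
    unfolding M2_def using mono2 rc that by (intro emeasure_interval_measure_Ioc) auto
  obtain S where S: "sets S = sets borel"
    "\<And>A. A \<in> sets borel \<Longrightarrow> emeasure S A = emeasure M1 A + emeasure M2 A"
    using sum_of_measures[OF s] by blast
  have SK: "density lborel (\<lambda>x. ennreal K) = S"
  proof (rule measure_eqI_Ioc)
    fix a b :: real assume ab: "a \<le> b"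
    have "emeasure S {a<..b} = ennreal (f b - f a) + ennreal (f2 b - f2 a)"
      by (subst S(2)) (simp_all add: I1 I2 ab)
    also have "\<dots> = ennreal (K * (b - a))"
      using assms(1)[OF ab] mono2[OF ab] by (subst ennreal_plus[symmetric]) (auto simp: f2_def algebra_simps)
    finally show "emeasure (density lborel (\<lambda>x. ennreal K)) {a<..b} = emeasure S {a<..b}"
      using K ab by (simp add: emeasure_density nn_integral_cmult_indicator ennreal_mult)
  next
    show "emeasure (density lborel (\<lambda>x. ennreal K)) {a<..b} \<noteq> \<infinity>" for a b :: real
      by (cases "a \<le> b") (auto simp: emeasure_density_const ennreal_mult_eq_top_iff)
  qed (simp_all add: S)
  have ac: "absolutely_continuous lborel M1" "absolutely_continuous lborel M2"
  proof -
    have "emeasure S A = 0" if "A \<in> null_sets lborel" for A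
      using that unfolding SK[symmetric] by (auto simp: emeasure_density_const null_sets_def)
    then have "emeasure M1 A = 0 \<and> emeasure M2 A = 0" if "A \<in> null_sets lborel" for A
      using that S(2)[of A] by auto
    then show "absolutely_continuous lborel M1" "absolutely_continuous lborel M2"
      unfolding absolutely_continuous_def by (auto simp: s null_sets_def)
  qed
  obtain k1 where k1[measurable]: "k1 \<in> borel_measurable lborel" "density lborel k1 = M1"
    using sigma_finite_measure.Radon_Nikodym[OF sigma_finite_lborel ac(1)] s by auto
  obtain k2 where k2[measurable]: "k2 \<in> borel_measurable lborel" "density lborel k2 = M2"
    using sigma_finite_measure.Radon_Nikodym[OF sigma_finite_lborel ac(2)] s by auto
  have "density lborel (\<lambda>x. k1 x + k2 x) = density lborel (\<lambda>x. ennreal K)"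
  proof (rule measure_eqI)
    fix A assume "A \<in> sets (density lborel (\<lambda>x. k1 x + k2 x))"
    then have A[measurable]: "A \<in> sets borel" by simp
    have "emeasure (density lborel (\<lambda>x. k1 x + k2 x)) A = emeasure (density lborel k1) A + emeasure (density lborel k2) A"
      by (simp add: emeasure_density distrib_right nn_integral_add)
    then show "emeasure (density lborel (\<lambda>x. k1 x + k2 x)) A = emeasure (density lborel (\<lambda>x. ennreal K)) A"
      by (simp add: SK S(2) k1 k2)
  qed auto
  then have "AE x in lborel. k1 x + k2 x = ennreal K"
    by (intro sigma_finite_measure.density_unique[OF sigma_finite_lborel]) auto
  then have le: "AE x in lborel. k1 x \<le> ennreal K"
    by eventually_elim (metis add.commute le_iff_add)
  \<comment> \<open>The density is at most \<open>K\<close> only almost everywhere; truncating it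
    gives a finite real function within the bounds at every point.\<close>
  define g where "g x = enn2real (min (k1 x) (ennreal K))" for x
  have g0: "0 \<le> g x" for x by (simp add: g_def)
  have gK: "g x \<le> K" for x unfolding g_def
    using K by (metis enn2real_ennreal enn2real_mono ennreal_less_top min.cobounded2)
  have [measurable]: "g \<in> borel_measurable borel" unfolding g_def by measurable
  have eq: "AE x in lborel. ennreal (g x) = k1 x"
    using le
  proof eventually_elim
    case (elim x)
    then have "k1 x < top" using le_less_trans by (simp add: order_le_less_trans)
    then show ?case using elim by (simp add: g_def min_def)
  qed
  have "prim f g"
    unfolding prim_def
  proof (intro conjI allI impI)
    show "locint g" by (rule locint_bounded[of _ K]) (auto simp: g0 gK)
    fix a b :: real assume ab: "a \<le> b"
    have "(LINT x:{a..b}|lborel. g x) = (LINT x:{a<..b}|lborel. g x)"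
      by (simp add: lborel_Ioc_Icc)
    also have "\<dots> = enn2real (\<integral>\<^sup>+x. ennreal (indicator {a<..b} x * g x) \<partial>lborel)"
      unfolding set_lebesgue_integral_def
      by (subst integral_eq_nn_integral) (auto simp: g0)
    also have "(\<integral>\<^sup>+x. ennreal (indicator {a<..b} x * g x) \<partial>lborel) = (\<integral>\<^sup>+x. k1 x * indicator {a<..b} x \<partial>lborel)"
      by (rule nn_integral_cong_AE) (use eq in eventually_elim, auto simp: indicator_def)
    also have "\<dots> = emeasure M1 {a<..b}"
      by (simp add: k1(2)[symmetric] emeasure_density)
    also have "\<dots> = ennreal (f b - f a)" using I1 ab by simp
    finally show "f b - f a = (LINT x:{a..b}|lborel. g x)"
      using assms(1)[OF ab] by simp
  qed
  with g0 gK that show ?thesis by blast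
qed

section \<open>Weak derivatives and primitives\<close>

text \<open>Integration by parts through Fubini: \<open>f x\<close> is written as
  \<open>f (-R)\<close> plus the integral of \<open>g\<close>, and the integration over the pairs
  \<open>s \<le> x\<close> is carried out in the other order. The boundary term drops because
  \<open>\<phi>'\<close> has integral zero.\<close>

lemma prim_weak_deriv:
  assumes fg: "prim f g"
  shows "has_weak_deriv f g"
  unfolding has_weak_deriv_def
proof (intro conjI allI impI)
  have cont: "continuous_on UNIV f" using prim_continuous[OF fg] .
  then have [measurable]: "f \<in> borel_measurable borel" by (rule borel_measurable_continuous_onI)
  show "locint f"
    unfolding locint_def
    using cont by (auto intro!: borel_integrable_atLeastAtMost' continuous_on_subset[of UNIV f])
  show "locint g" using primD fg by blast
  have [measurable]: "g \<in> borel_measurable borel" using primD fg by blast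
  fix \<phi> \<phi>' :: "real \<Rightarrow> real"
  assume "(\<forall>x. (\<phi> has_real_derivative \<phi>' x) (at x)) \<and> continuous_on UNIV \<phi>' \<and> bounded {x. \<phi> x \<noteq> 0}"
  then have d: "(\<phi> has_real_derivative \<phi>' x) (at x)" and c: "continuous_on UNIV \<phi>'"
    and b: "bounded {x. \<phi> x \<noteq> 0}" for x by auto
  have c\<phi>: "continuous_on UNIV \<phi>" using d by (auto intro!: continuous_at_imp_continuous_on DERIV_isCont)
  have [measurable]: "\<phi> \<in> borel_measurable borel" "\<phi>' \<in> borel_measurable borel"
    using c\<phi> c by (auto intro: borel_measurable_continuous_onI)
  obtain b where b: "b > 0" "\<And>x. \<phi> x \<noteq> 0 \<Longrightarrow> \<bar>x\<bar> \<le> b"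
    using b by (auto simp: bounded_pos)
  \<comment> \<open>The added 1 puts both endpoints strictly outside the support of
    \<open>\<phi>\<close>, so that \<open>\<phi>\<close> is zero there.\<close>
  define R where "R = b + 1"
  have R: "\<phi> x = 0" if "\<bar>x\<bar> > b" for x using b(2)[of x] that by auto
  have R0: "\<phi>' x = 0" if "\<bar>x\<bar> > b" for x
  proof -
    have "((\<lambda>x. 0) has_real_derivative \<phi>' x) (at x)"
    proof (rule has_field_derivative_transform_within_open[OF d])
      show "open {x. \<bar>x\<bar> > b}" by (intro open_Collect_less continuous_intros)
    qed (use R that in auto)
    from DERIV_unique[OF this DERIV_const] show ?thesis .
  qed
  have Rpos: "R > 0" using b by (simp add: R_def)
  define A where "A x = indicator {-R..R} x * \<phi>' x" for x
  define B where "B x = indicator {-R..R} x * g x" for x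
  have [measurable]: "A \<in> borel_measurable borel" "B \<in> borel_measurable borel"
    unfolding A_def B_def by measurable
  have iA: "integrable lborel A"
    using borel_integrable_atLeastAtMost'[OF continuous_on_subset[OF c subset_UNIV, of "{-R..R}"]]
    unfolding set_integrable_def A_def by simp
  have iB: "integrable lborel B"
    using primD(3)[OF fg, of "-R" R] unfolding set_integrable_def B_def by simp
  have FTC: "(LINT x|lborel. A x * indicator {s..} x) = - \<phi> s" if s: "s \<in> {-R..R}" for s
  proof -
    have "(LINT x|lborel. A x * indicator {s..} x) = (LINT x|lborel. indicator {s..R} x *\<^sub>R \<phi>' x)"
      using s by (intro Bochner_Integration.integral_cong) (auto simp: A_def indicator_def)
    also have "\<dots> = \<phi> R - \<phi> s"
      using s d c
      by (intro integral_FTC_Icc) 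
         (auto simp: has_real_derivative_iff_has_vector_derivative[symmetric] intro: has_field_derivative_at_within continuous_on_subset)
    also have "\<phi> R = 0" by (rule R) (use b in \<open>auto simp: R_def\<close>)
    finally show ?thesis by simp
  qed
  have A0: "(LINT x|lborel. A x) = 0"
  proof -
    have "(LINT x|lborel. A x) = (LINT x|lborel. A x * indicator {-R..} x)"
      by (intro Bochner_Integration.integral_cong) (auto simp: A_def indicator_def)
    also have "\<dots> = - \<phi> (-R)" using Rpos by (intro FTC) auto
    also have "\<phi> (-R) = 0" by (rule R) (use b in \<open>auto simp: R_def\<close>)
    finally show ?thesis by simp
  qed
  let ?F = "\<lambda>x s. A x * B s * indicator {s..} x"
  have intF: "integrable (lborel \<Otimes>\<^sub>M lborel) (case_prod ?F)"
  proof (rule Bochner_Integration.integrable_bound)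
    show "integrable (lborel \<Otimes>\<^sub>M lborel) (\<lambda>(x, s). A x * B s)"
    proof (rule lborel_pair.Fubini_integrable)
      have "integrable lborel (\<lambda>x. \<bar>A x\<bar> * (LINT y|lborel. \<bar>B y\<bar>))"
        using iA by (intro integrable_mult_left) auto
      then show "integrable lborel (\<lambda>x. LINT y|lborel. norm (case (x, y) of (x, s) \<Rightarrow> A x * B s))"
        by (simp add: abs_mult)
      show "AE x in lborel. integrable lborel (\<lambda>y. case (x, y) of (x, s) \<Rightarrow> A x * B s)"
        using iB by simp
    qed measurable
    have "(\<lambda>p. A (fst p) * B (snd p) * (if snd p \<le> fst p then 1 else 0)) \<in> borel_measurable (lborel \<Otimes>\<^sub>M lborel)"
      by measurable
    moreover have "(\<lambda>p. A (fst p) * B (snd p) * (if snd p \<le> fst p then 1 else 0)) = case_prod ?F"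
      by (auto simp: fun_eq_iff indicator_def)
    ultimately show "case_prod ?F \<in> borel_measurable (lborel \<Otimes>\<^sub>M lborel)" by simp
  qed (auto simp: indicator_def)
  have "(LINT x|lborel. f x * \<phi>' x) = (LINT x|lborel. A x * f (-R) + (LINT s|lborel. ?F x s))"
  proof (rule Bochner_Integration.integral_cong[OF refl])
    fix x
    show "f x * \<phi>' x = A x * f (-R) + (LINT s|lborel. ?F x s)"
    proof (cases "x \<in> {-R..R}")
      case True
      have "(LINT s|lborel. ?F x s) = (LINT s|lborel. A x * (indicator {-R..x} s *\<^sub>R g s))"
        using True by (intro Bochner_Integration.integral_cong) (auto simp: A_def B_def indicator_def)
      also have "\<dots> = A x * (f x - f (-R))"
        using primD(4)[OF fg, of "-R" x] True by (simp add: set_lebesgue_integral_def)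
      finally show ?thesis using True by (simp add: A_def algebra_simps)
    next
      case False
      then have "\<phi>' x = 0" by (intro R0) (auto simp: R_def)
      then show ?thesis using False by (simp add: A_def)
    qed
  qed
  also have "\<dots> = (LINT x|lborel. A x * f (-R)) + (LINT x|lborel. (LINT s|lborel. ?F x s))"
    using iA lborel_pair.integrable_fst[OF intF] by (intro Bochner_Integration.integral_add) auto
  also have "(LINT x|lborel. A x * f (-R)) = 0" using A0 by simp
  also have "(LINT x|lborel. (LINT s|lborel. ?F x s)) = (LINT s|lborel. (LINT x|lborel. ?F x s))"
    using lborel_pair.Fubini_integral[OF intF] by simp
  also have "\<dots> = (LINT s|lborel. - (g s * \<phi> s))"
  proof (rule Bochner_Integration.integral_cong[OF refl])
    fix s
    have "(LINT x|lborel. ?F x s) = (LINT x|lborel. B s * (A x * indicator {s..} x))"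
      by (intro Bochner_Integration.integral_cong) auto
    also have "\<dots> = B s * (LINT x|lborel. A x * indicator {s..} x)" by simp
    finally have *: "(LINT x|lborel. ?F x s) = B s * (LINT x|lborel. A x * indicator {s..} x)" .
    show "(LINT x|lborel. ?F x s) = - (g s * \<phi> s)"
    proof (cases "s \<in> {-R..R}")
      case True
      then show ?thesis unfolding * FTC[OF True] by (simp add: B_def)
    next
      case False
      then have "\<phi> s = 0" by (intro R) (auto simp: R_def)
      then show ?thesis unfolding * using False by (simp add: B_def)
    qed
  qed
  finally show "(LINT x|lborel. f x * \<phi>' x) = - (LINT x|lborel. g x * \<phi> x)"
    by simp
qed

lemma pos_part_square_deriv:
  "((\<lambda>t::real. (max 0 t)\<^sup>2) has_real_derivative 2 * max 0 t) (at t)"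
proof -
  consider "t > 0" | "t < 0" | "t = 0" by linarith
  then show ?thesis
  proof cases
    case 1
    have "((\<lambda>t::real. t\<^sup>2) has_real_derivative 2 * max 0 t) (at t)"
      using 1 by (auto intro!: derivative_eq_intros)
    then show ?thesis
      by (rule has_field_derivative_transform_within_open[of _ _ _ "{0<..}"]) (use 1 in auto)
  next
    case 2
    have "((\<lambda>t::real. 0) has_real_derivative 2 * max 0 t) (at t)"
      using 2 by (auto intro!: derivative_eq_intros)
    then show ?thesis
      by (rule has_field_derivative_transform_within_open[of _ _ _ "{..<0}"]) (use 2 in auto)
  next
    case 3
    have "((\<lambda>h. ((max 0 (0 + h))\<^sup>2 - (max 0 0)\<^sup>2) / h) \<longlongrightarrow> (0::real)) (at 0)"
    proof (rule Lim_null_comparison)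
      show "\<forall>\<^sub>F h in at 0. norm (((max 0 (0 + h))\<^sup>2 - (max 0 0)\<^sup>2) / h) \<le> \<bar>h::real\<bar>"
        by (intro always_eventually allI) (auto simp: max_def power2_eq_square)
      show "((\<lambda>h::real. \<bar>h\<bar>) \<longlongrightarrow> 0) (at 0)" by (intro tendsto_eq_intros) auto
    qed
    then show ?thesis using 3 by (simp add: DERIV_def)
  qed
qed

text \<open>\<open>s'\<close> is the tent function on [0, 2] of height 1 and area 1, written as a
  second difference of positive parts, and \<open>s\<close> is its integral. One continuous
  derivative is what the test functions in \<open>has_weak_deriv\<close> have.\<close>

lemma smooth_step:
  obtains s s' :: "real \<Rightarrow> real" where
    "\<And>t. (s has_real_derivative s' t) (at t)" "continuous_on UNIV s'"
    "\<And>t. t \<le> 0 \<Longrightarrow> s t = 0" "\<And>t. t \<ge> 2 \<Longrightarrow> s t = 1" "\<And>t. 0 \<le> s t \<and> s t \<le> 1"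
    "\<And>t. t \<notin> {0..2} \<Longrightarrow> s' t = 0"
proof -
  define s where "s t = (1/2) * ((max 0 t)\<^sup>2 - 2 * (max 0 (t - 1))\<^sup>2 + (max 0 (t - 2))\<^sup>2)" for t :: real
  define s' where "s' t = max 0 t - 2 * max 0 (t - 1) + max 0 (t - 2)" for t :: real
  have sh: "((\<lambda>t. (max 0 (t - c))\<^sup>2) has_real_derivative 2 * max 0 (t - c)) (at t)" for c t :: real
    using DERIV_shift[of "\<lambda>t. (max 0 t)\<^sup>2" "2 * max 0 (t - c)" t "- c"] pos_part_square_deriv[of "t - c"]
    by simp
  have d: "(s has_real_derivative s' t) (at t)" for t
    unfolding s_def[abs_def] s'_def
    by (rule derivative_eq_intros sh pos_part_square_deriv refl)+ (simp add: algebra_simps)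
  have c: "continuous_on UNIV s'" unfolding s'_def[abs_def] by (intro continuous_intros)
  have lo: "s t = 0" if "t \<le> 0" for t using that by (simp add: s_def)
  have hi: "s t = 1" if "t \<ge> 2" for t
    using that by (simp add: s_def power2_eq_square algebra_simps)
  have s'0: "0 \<le> s' t" for t by (auto simp: s'_def max_def)
  have mono: "s a \<le> s b" if "a \<le> b" for a b
    using that by (rule DERIV_nonneg_imp_nondecreasing) (use d s'0 in blast)
  have r: "0 \<le> s t \<and> s t \<le> 1" for t
    using mono[of "min t 0" t] mono[of t "max t 2"] lo[of "min t 0"] hi[of "max t 2"] by simp
  have z: "s' t = 0" if "t \<notin> {0..2}" for t using that by (auto simp: s'_def max_def)
  show ?thesis using that[OF d c lo hi r z] by blast
qed

text \<open>The test functions step up just after \<open>a\<close> and down just after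
  \<open>b\<close>, at scale \<open>1 / N n\<close>. Their derivatives are differences of two
  averaging kernels to the right of \<open>a\<close> and of \<open>b\<close>, which recover
  \<open>f a\<close> and \<open>f b\<close> by continuity, while the test functions themselves tend
  to the indicator of the interval.\<close>

lemma weak_deriv_prim:
  assumes wd: "has_weak_deriv f g" and cont: "continuous_on UNIV f"
  shows "prim f g"
proof -
  have lf: "locint f" and lg: "locint g" using wd by (auto simp: has_weak_deriv_def)
  have [measurable]: "g \<in> borel_measurable borel" "f \<in> borel_measurable borel"
    using lg lf by (auto simp: locint_def)
  obtain s s' where s: "\<And>t. (s has_real_derivative s' t) (at t)" "continuous_on UNIV s'"
    "\<And>t. t \<le> 0 \<Longrightarrow> s t = 0" "\<And>t. t \<ge> 2 \<Longrightarrow> s t = 1" "\<And>t. 0 \<le> s t \<and> s t \<le> 1"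
    "\<And>t. t \<notin> {0..2} \<Longrightarrow> s' t = 0"
    using smooth_step by blast
  have [measurable]: "s' \<in> borel_measurable borel" "s \<in> borel_measurable borel"
    using s(1,2) by (auto intro!: borel_measurable_continuous_onI DERIV_isCont continuous_at_imp_continuous_on)
  define N where "N n = real (Suc n)" for n
  have N: "N n > 0" "N n \<ge> 1" for n by (auto simp: N_def)
  have Ninf: "filterlim N at_top sequentially"
    unfolding N_def by (rule filterlim_compose[OF filterlim_real_sequentially filterlim_Suc])
  have int_s': "integrable lborel s'" and lint_s': "(LINT x|lborel. s' x) = 1"
  proof -
    have *: "s' = (\<lambda>x. indicator {0..2} x *\<^sub>R s' x)" using s(6) by (auto simp: fun_eq_iff indicator_def)
    have "has_bochner_integral lborel (\<lambda>x. indicator {0..2} x *\<^sub>R s' x) (s 2 - s 0)"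
      using s(1,2) by (intro has_bochner_integral_FTC_Icc)
        (auto simp: has_real_derivative_iff_has_vector_derivative[symmetric] intro: has_field_derivative_at_within continuous_on_subset)
    then have "has_bochner_integral lborel s' 1" using * s(3)[of 0] s(4)[of 2] by simp
    then show "integrable lborel s'" "(LINT x|lborel. s' x) = 1"
      by (auto simp: has_bochner_integral_iff)
  qed
  \<comment> \<open>An average of \<open>f\<close> over \<open>[a, a + 2 / N n]\<close> with total
    weight 1.\<close>
  define I where "I a n = (LINT x|lborel. f x * (N n * s' (N n * (x - a))))" for a n
  have int_I: "integrable lborel (\<lambda>x. f x * (N n * s' (N n * (x - a))))" for a n
  proof -
    have "set_integrable lborel {a..a+2} (\<lambda>x. f x * (N n * s' (N n * (x - a))))"
      using cont s(2) by (intro borel_integrable_atLeastAtMost' continuous_intros)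
         (auto intro: continuous_on_subset continuous_on_compose2[of UNIV s'] intro!: continuous_intros)
    moreover have "indicator {a..a+2} x * (f x * (N n * s' (N n * (x - a)))) = f x * (N n * s' (N n * (x - a)))" for x
    proof (cases "x \<in> {a..a+2}")
      case False
      then consider "x - a < 0" | "x - a > 2" by fastforce
      then have "N n * (x - a) \<notin> {0..2}"
      proof cases
        case 1
        then show ?thesis using N(1)[of n] mult_pos_neg[of "N n" "x - a"] by auto
      next
        case 2
        then have "x - a \<le> N n * (x - a)" using mult_right_mono[of 1 "N n" "x - a"] N(2)[of n] by simp
        with 2 have "2 < N n * (x - a)" by (rule less_le_trans)
        then show ?thesis by auto
      qed
      then show ?thesis using s(6) False by simp
    qed simp
    ultimately show ?thesis by (simp add: set_integrable_def)
  qed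
  have I_lim: "(\<lambda>n. I a n) \<longlonglongrightarrow> f a" for a
  proof -
    have "I a n = (LINT t|lborel. f (a + t / N n) * s' t)" for n
      unfolding I_def using N(1)[of n]
      by (subst lborel_integral_real_affine[where t=a and c="1 / N n"]) (auto simp flip: integral_mult_right_zero)
    moreover have "(\<lambda>n. (LINT t|lborel. f (a + t / N n) * s' t)) \<longlonglongrightarrow> (LINT t|lborel. f a * s' t)"
    proof -
      have "bounded (f ` {a..a+2})"
        using cont by (intro compact_imp_bounded compact_continuous_image) (auto intro: continuous_on_subset)
      then obtain K where "\<forall>y\<in>f ` {a..a+2}. norm y \<le> K"
        unfolding bounded_iff by blast
      then have K: "\<And>x. x \<in> {a..a+2} \<Longrightarrow> \<bar>f x\<bar> \<le> K" by auto
      show ?thesis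
      proof (rule integral_dominated_convergence)
        show "integrable lborel (\<lambda>t. K * \<bar>s' t\<bar>)" using int_s' by auto
        show "AE t in lborel. (\<lambda>n. f (a + t / N n) * s' t) \<longlonglongrightarrow> f a * s' t"
        proof (intro AE_I2 tendsto_intros)
          fix t
          have "(\<lambda>n. a + t / N n) \<longlonglongrightarrow> a + 0"
            by (intro tendsto_intros tendsto_divide_0[OF tendsto_const] filterlim_at_top_imp_at_infinity Ninf)
          then show "(\<lambda>n. f (a + t / N n)) \<longlonglongrightarrow> f a"
            using cont by (auto intro: continuous_on_tendsto_compose[of UNIV f])
        qed
        show "AE t in lborel. norm (f (a + t / N n) * s' t) \<le> K * \<bar>s' t\<bar>" for n
        proof (intro AE_I2)
          fix t show "norm (f (a + t / N n) * s' t) \<le> K * \<bar>s' t\<bar>"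
          proof (cases "t \<in> {0..2}")
            case True
            then have "t / N n \<le> 2" using N[of n] by (auto simp: field_simps)
            then have "a + t / N n \<in> {a..a+2}" using True N[of n] by auto
            then show ?thesis using K by (auto simp: abs_mult mult_right_mono)
          qed (simp add: s(6))
        qed
      qed measurable
    qed
    ultimately show ?thesis by (simp add: lint_s')
  qed
  show ?thesis
    unfolding prim_def
  proof (intro conjI allI impI lg)
    fix a b :: real assume ab: "a \<le> b"
    define \<phi> where "\<phi> n x = s (N n * (x - a)) - s (N n * (x - b))" for n x
    define \<phi>' where "\<phi>' n x = N n * s' (N n * (x - a)) - N n * s' (N n * (x - b))" for n x
    have [measurable]: "\<phi> n \<in> borel_measurable borel" for n unfolding \<phi>_def by measurable
    have supp: "\<phi> n x = 0" if x: "x \<notin> {a..b+2}" for n x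
    proof -
      consider "x < a" | "x > b + 2" using x by fastforce
      then show ?thesis
      proof cases
        case 1
        then have "N n * (x - a) \<le> 0" "N n * (x - b) \<le> 0" using N[of n] ab by (auto simp: mult_le_0_iff)
        then show ?thesis by (simp add: \<phi>_def s(3))
      next
        case 2
        then have "N n * (x - a) \<ge> 2" "N n * (x - b) \<ge> 2" 
          using mult_mono[of 1 "N n" 2 "x - b"] mult_mono[of 1 "N n" 2 "x - a"] N[of n] ab by auto
        then show ?thesis by (simp add: \<phi>_def s(4))
      qed
    qed
    have eq: "(LINT x|lborel. f x * \<phi>' n x) = - (LINT x|lborel. g x * \<phi> n x)" for n
    proof -
      have 1: "(\<phi> n has_real_derivative \<phi>' n x) (at x)" for x
      proof -
        have "((\<lambda>x. s (N n * (x - c))) has_real_derivative s' (N n * (x - c)) * N n) (at x)" for c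
          by (rule DERIV_chain2[OF s(1)]) (auto intro!: derivative_eq_intros)
        from DERIV_diff[OF this[of a] this[of b]] show ?thesis
          unfolding \<phi>_def[abs_def] \<phi>'_def by (simp add: mult.commute)
      qed
      have 2: "continuous_on UNIV (\<phi>' n)"
        unfolding \<phi>'_def
        by (intro continuous_intros continuous_on_compose2[OF s(2)]) auto
      have 3: "bounded {x. \<phi> n x \<noteq> 0}"
        by (rule bounded_subset[OF bounded_closed_interval[of a "b + 2"]]) (use supp in blast)
      show ?thesis using wd 1 2 3 unfolding has_weak_deriv_def by blast
    qed
    have "(LINT x|lborel. f x * \<phi>' n x) = I a n - I b n" for n
      unfolding I_def \<phi>'_def using int_I
      by (subst Bochner_Integration.integral_diff[symmetric]) (auto simp: algebra_simps)
    then have "(\<lambda>n. - (LINT x|lborel. g x * \<phi> n x)) \<longlonglongrightarrow> f a - f b"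
      using tendsto_diff[OF I_lim[of a] I_lim[of b]] by (simp add: eq)
    moreover have "(\<lambda>n. (LINT x|lborel. g x * \<phi> n x)) \<longlonglongrightarrow> (LINT x|lborel. g x * indicator {a..b} x)"
    proof (rule integral_dominated_convergence)
      show "integrable lborel (\<lambda>x. \<bar>indicator {a..b+2} x *\<^sub>R g x\<bar>)"
        using locintD(2)[OF lg] unfolding set_integrable_def by (rule integrable_abs)
      \<comment> \<open>At \<open>x = a\<close> every test function has the value 0 while the
        indicator has the value 1, so this point is excluded.\<close>
      show "AE x in lborel. (\<lambda>n. g x * \<phi> n x) \<longlonglongrightarrow> g x * indicator {a..b} x"
        using AE_lborel_singleton[of a]
      proof eventually_elim
        case (elim x)
        have up: "\<forall>\<^sub>F n in sequentially. s (N n * c) = 1" if "c > 0" for c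
        proof -
          have "filterlim (\<lambda>n. c * N n) at_top sequentially"
            using that by (intro filterlim_tendsto_pos_mult_at_top[OF tendsto_const _ Ninf]) auto
          then have "\<forall>\<^sub>F n in sequentially. N n * c \<ge> 2" by (simp add: filterlim_at_top mult.commute)
          then show ?thesis by eventually_elim (rule s(4))
        qed
        have dn: "s (N n * c) = 0" if "c \<le> 0" for c n
          using that N[of n] by (intro s(3)) (auto simp: mult_le_0_iff)
        have "\<forall>\<^sub>F n in sequentially. \<phi> n x = indicator {a..b} x"
        proof -
          consider "x < a" | "a < x" "x \<le> b" | "b < x" using elim by fastforce
          then show ?thesis
          proof cases
            case 1 then show ?thesis using ab by (auto simp: \<phi>_def dn)
          next
            case 2
            have "\<forall>\<^sub>F n in sequentially. s (N n * (x - a)) = 1" using 2 by (intro up) auto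
            then show ?thesis by eventually_elim (use 2 in \<open>auto simp: \<phi>_def dn\<close>)
          next
            case 3
            have "\<forall>\<^sub>F n in sequentially. s (N n * (x - a)) = 1" "\<forall>\<^sub>F n in sequentially. s (N n * (x - b)) = 1"
              using 3 ab by (auto intro!: up)
            then show ?thesis by eventually_elim (use 3 in \<open>auto simp: \<phi>_def\<close>)
          qed
        qed
        then have "(\<lambda>n. \<phi> n x) \<longlonglongrightarrow> indicator {a..b} x" by (rule tendsto_eventually)
        then show ?case by (intro tendsto_intros)
      qed
      show "AE x in lborel. norm (g x * \<phi> n x) \<le> \<bar>indicator {a..b+2} x *\<^sub>R g x\<bar>" for n
      proof (rule AE_I2)
        fix x
        have "\<bar>\<phi> n x\<bar> \<le> 1" using s(5)[of "N n * (x - a)"] s(5)[of "N n * (x - b)"] by (auto simp: \<phi>_def abs_le_iff)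
        then show "norm (g x * \<phi> n x) \<le> \<bar>indicator {a..b+2} x *\<^sub>R g x\<bar>"
          using supp[of x n] by (auto simp: indicator_def abs_mult mult_left_le)
      qed
    qed measurable
    ultimately have "f a - f b = - (LINT x|lborel. g x * indicator {a..b} x)"
      using LIMSEQ_unique tendsto_minus by blast
    then show "f b - f a = (LINT x:{a..b}|lborel. g x)"
      by (simp add: set_lebesgue_integral_def mult.commute)
  qed
qed

text \<open>Makes the choice in \<open>wderiv\<close> harmless: any explicit density of a primitive
  stands for \<open>wderiv f\<close> almost everywhere.\<close>

lemma prim_wderiv:
  assumes "prim f g"
  shows "weakly_diff f" "prim f (wderiv f)" "AE x in lborel. wderiv f x = g x"
proof -
  show "weakly_diff f" using prim_weak_deriv[OF assms] by (auto simp: weakly_diff_def)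
  have "has_weak_deriv f (wderiv f)"
    unfolding wderiv_def by (rule someI[of "has_weak_deriv f" g]) (rule prim_weak_deriv[OF assms])
  then show *: "prim f (wderiv f)" using prim_continuous[OF assms] by (rule weak_deriv_prim)
  show "AE x in lborel. wderiv f x = g x" using prim_unique[OF * assms] .
qed

lemma weakly_diff_prim:
  assumes "weakly_diff f" "continuous_on UNIV f"
  shows "prim f (wderiv f)"
proof -
  have "has_weak_deriv f (wderiv f)"
    using assms(1) unfolding weakly_diff_def wderiv_def by (rule someI_ex)
  then show ?thesis using assms(2) by (rule weak_deriv_prim)
qed

lemma measure_eqI_Ico:
  assumes "sets M = sets borel" "sets N = sets borel"
    and eq: "\<And>a b. a \<le> b \<Longrightarrow> emeasure M {a..<b} = emeasure N {a..<b}"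
    and fin: "\<And>a b. emeasure M {a..<b::real} \<noteq> \<infinity>"
  shows "M = N"
proof (rule measure_eqI_generator_eq)
  let ?E = "range (\<lambda>(a, b). {a..<b::real})"
  show "Int_stable ?E"
    by (auto simp: Int_stable_def Int_atLeastLessThan)
  show "?E \<subseteq> Pow UNIV" "sets M = sigma_sets UNIV ?E" "sets N = sigma_sets UNIV ?E"
    by (simp_all add: borel_eq_atLeastLessThan assms)
  let ?A = "\<lambda>n::nat. {- real n ..< real n}"
  show "range ?A \<subseteq> ?E" by auto
  show "(\<Union>i. ?A i) = UNIV"
  proof safe
    fix x :: real
    obtain n where "\<bar>x\<bar> < real n" using reals_Archimedean2 by blast
    then show "x \<in> (\<Union>i. ?A i)" by (auto intro!: exI[of _ n])
  qed auto
  show "emeasure M (?A i) \<noteq> \<infinity>" for i by (rule fin)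
  fix X assume "X \<in> ?E"
  then obtain a b where X: "X = {a..<b}" by auto
  show "emeasure M X = emeasure N X"
    by (cases "a \<le> b") (auto simp: X eq)
qed

lemma emeasure_density_Ico_Icc:
  assumes [measurable]: "k \<in> borel_measurable borel"
  shows "emeasure (density lborel k) {a..<b} = emeasure (density lborel k) {a..b::real}"
proof -
  have "AE x in lborel. k x * indicator {a..<b} x = k x * indicator {a..b} x"
    using AE_lborel_singleton[of b] by eventually_elim (auto simp: indicator_def)
  then show ?thesis by (simp add: emeasure_density cong: nn_integral_cong_AE)
qed

subsection \<open>Monotone changes of variables\<close>

text \<open>Monotonicity is not strict, since \<open>y\<close> is constant on an interval wherever
  energy is concentrated in a point. Bounded distance from the identity makes \<open>y\<close>
  onto.\<close>

locale incr =
  fixes y y' :: "real \<Rightarrow> real"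
  assumes prim: "prim y y'" and nonneg: "\<And>\<xi>. 0 \<le> y' \<xi>" and bdd: "\<exists>C. \<forall>\<xi>. \<bar>y \<xi> - \<xi>\<bar> \<le> C"
begin

lemma cont: "continuous_on UNIV y"
  using prim_continuous[OF prim] .

lemma meas[measurable]: "y \<in> borel_measurable borel" "y' \<in> borel_measurable borel"
  using cont primD(2)[OF prim] by (auto intro: borel_measurable_continuous_onI)

lemma mono: "a \<le> b \<Longrightarrow> y a \<le> y b"
proof -
  assume ab: "a \<le> b"
  have "0 \<le> (LINT x:{a..b}|lborel. y' x)"
    unfolding set_lebesgue_integral_def using nonneg by (intro integral_nonneg_AE) auto
  then show ?thesis using primD(4)[OF prim ab] by simp
qed

lemma surj: obtains \<xi> where "y \<xi> = x"
proof -
  obtain C where C: "\<And>\<xi>. \<bar>y \<xi> - \<xi>\<bar> \<le> C" using bdd by blast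
  have "\<exists>\<xi>. x - C \<le> \<xi> \<and> \<xi> \<le> x + C \<and> y \<xi> = x"
    using C[of "x - C"] C[of "x + C"] by (intro IVT') (auto simp: abs_le_iff intro: continuous_on_subset[OF cont])
  then show ?thesis using that by blast
qed

lemma at_top: "filterlim y at_top at_top"
proof -
  obtain C where C: "\<And>\<xi>. \<bar>y \<xi> - \<xi>\<bar> \<le> C" using bdd by blast
  have 2: "\<xi> - C \<le> y \<xi>" for \<xi> using C[of \<xi>] by (auto simp: abs_le_iff)
  show "filterlim y at_top at_top"
    unfolding filterlim_at_top
  proof
    fix Z show "\<forall>\<^sub>F x in at_top. Z \<le> y x"
      by (rule eventually_at_top_linorderI[of "Z + C"]) (smt (verit) 2)
  qed
qed

text \<open>The left end of a level set, a generalised inverse of \<^term>\<open>y\<close>.\<close>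

definition linv :: "real \<Rightarrow> real" where "linv x = Inf {\<xi>. x \<le> y \<xi>}"

text \<open>The set \<open>{\<xi>. x \<le> y \<xi>}\<close> is closed and bounded below, so its
  infimum is attained. The equivalence is a Galois connection; it is the reason for working with
  intervals closed on the left below.\<close>

lemma linv: "linv x \<le> \<xi> \<longleftrightarrow> x \<le> y \<xi>" "y (linv x) = x"
proof -
  obtain \<xi>0 where \<xi>0: "y \<xi>0 = x" using surj by blast
  obtain C where C: "\<And>\<xi>. \<bar>y \<xi> - \<xi>\<bar> \<le> C" using bdd by blast
  have lb: "x - C \<le> \<xi>" if "x \<le> y \<xi>" for \<xi> using C[of \<xi>] that by (auto simp: abs_le_iff)
  have bb: "bdd_below {\<xi>. x \<le> y \<xi>}" using lb by (auto intro!: bdd_belowI)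
  have ne: "{\<xi>. x \<le> y \<xi>} \<noteq> {}" using \<xi>0 by auto
  have cl: "closed {\<xi>. x \<le> y \<xi>}" using cont by (intro closed_Collect_le) auto
  have in1: "x \<le> y (linv x)" using closed_contains_Inf[OF ne bb cl] unfolding linv_def by simp
  have low: "linv x \<le> \<xi>" if "x \<le> y \<xi>" for \<xi> unfolding linv_def using that bb by (intro cInf_lower) auto
  show "linv x \<le> \<xi> \<longleftrightarrow> x \<le> y \<xi>" using low in1 mono[of "linv x" \<xi>] by auto
  show "y (linv x) = x" using in1 mono[OF low[of \<xi>0]] \<xi>0 by simp
qed

lemma linv_less: "\<xi> < linv x \<longleftrightarrow> y \<xi> < x"
  using linv(1)[of x \<xi>] by linarith

lemma linv_meas[measurable]: "linv \<in> borel_measurable borel"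
  by (rule borel_measurable_mono) (auto simp: Fun.mono_def linv)

text \<open>The preimage of \<open>[a, b)\<close> is \<open>[linv a, linv b)\<close>, whose mass
  telescopes to \<open>y (linv b) - y (linv a) = b - a\<close>.\<close>

lemma pushforward: "distr (density lborel (\<lambda>\<xi>. ennreal (y' \<xi>))) borel y = lborel"
proof (rule measure_eqI_Ico)
  fix a b :: real
  have *: "emeasure (distr (density lborel (\<lambda>\<xi>. ennreal (y' \<xi>))) borel y) {a..<b} = ennreal (b - a)" if "a \<le> b"
  proof -
    have "y -` {a..<b} = {linv a..<linv b}"
      using linv(1) linv_less by auto
    then have "emeasure (distr (density lborel (\<lambda>\<xi>. ennreal (y' \<xi>))) borel y) {a..<b} 
       = emeasure (density lborel (\<lambda>\<xi>. ennreal (y' \<xi>))) {linv a..linv b}"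
      by (simp add: emeasure_distr emeasure_density_Ico_Icc)
    also have "\<dots> = ennreal (y (linv b) - y (linv a))"
      using that by (intro prim_nn_integral[OF prim nonneg]) (simp add: linv)
    finally show ?thesis by (simp add: linv)
  qed
  then show "emeasure (distr (density lborel (\<lambda>\<xi>. ennreal (y' \<xi>))) borel y) {a..<b} \<noteq> \<infinity>"
    by (cases "a \<le> b") auto
  show "emeasure (distr (density lborel (\<lambda>\<xi>. ennreal (y' \<xi>))) borel y) {a..<b} = emeasure lborel {a..<b}" if "a \<le> b"
    using * that by simp
qed auto

section \<open>Change of variables and null sets\<close>

lemma nn_integral_subst:
  assumes [measurable]: "f \<in> borel_measurable borel"
  shows "(\<integral>\<^sup>+\<xi>. f (y \<xi>) * ennreal (y' \<xi>) \<partial>lborel) = (\<integral>\<^sup>+x. f x \<partial>lborel)"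
proof -
  have "(\<integral>\<^sup>+x. f x \<partial>lborel) = (\<integral>\<^sup>+x. f x \<partial>distr (density lborel (\<lambda>\<xi>. ennreal (y' \<xi>))) borel y)"
    by (simp add: pushforward)
  also have "\<dots> = (\<integral>\<^sup>+\<xi>. f (y \<xi>) * ennreal (y' \<xi>) \<partial>lborel)"
    by (simp add: nn_integral_distr nn_integral_density mult.commute)
  finally show ?thesis by simp
qed

lemma integrable_subst:
  fixes f :: "real \<Rightarrow> real"
  assumes [measurable]: "f \<in> borel_measurable borel"
  shows "integrable lborel (\<lambda>\<xi>. f (y \<xi>) * y' \<xi>) \<longleftrightarrow> integrable lborel f"
proof -
  have "integrable lborel f \<longleftrightarrow> integrable (distr (density lborel (\<lambda>\<xi>. ennreal (y' \<xi>))) borel y) f"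
    by (simp add: pushforward)
  also have "\<dots> \<longleftrightarrow> integrable lborel (\<lambda>\<xi>. f (y \<xi>) * y' \<xi>)"
    by (simp add: integrable_distr_eq integrable_density nonneg mult.commute)
  finally show ?thesis by simp
qed

lemma integral_subst:
  fixes f :: "real \<Rightarrow> real"
  assumes [measurable]: "f \<in> borel_measurable borel"
  shows "(LINT \<xi>|lborel. f (y \<xi>) * y' \<xi>) = (LINT x|lborel. f x)"
proof -
  have "(LINT x|lborel. f x) = (LINT x|distr (density lborel (\<lambda>\<xi>. ennreal (y' \<xi>))) borel y. f x)"
    by (simp add: pushforward)
  also have "\<dots> = (LINT \<xi>|lborel. f (y \<xi>) * y' \<xi>)"
    by (simp add: integral_distr integral_density nonneg mult.commute)
  finally show ?thesis by simp
qed

lemma set_integrable_subst: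
  fixes f :: "real \<Rightarrow> real"
  assumes [measurable]: "f \<in> borel_measurable borel" "A \<in> sets borel"
  shows "set_integrable lborel (y -` A) (\<lambda>\<xi>. f (y \<xi>) * y' \<xi>) \<longleftrightarrow> set_integrable lborel A f"
  using integrable_subst[of "\<lambda>x. indicator A x * f x"]
  by (simp add: set_integrable_def indicator_vimage[symmetric] mult.assoc o_def indicator_def)

lemma set_integral_subst:
  fixes f :: "real \<Rightarrow> real"
  assumes [measurable]: "f \<in> borel_measurable borel" "A \<in> sets borel"
  shows "(LINT \<xi>:(y -` A)|lborel. f (y \<xi>) * y' \<xi>) = (LINT x:A|lborel. f x)"
  using integral_subst[of "\<lambda>x. indicator A x * f x"]
  by (simp add: set_lebesgue_integral_def mult.assoc indicator_def)

text \<open>The preimage of a null set may have positive Lebesgue measure, but it is null for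
  \<open>y' d\<xi>\<close>; hence the restriction to points with
  \<open>y' \<noteq> 0\<close>.\<close>

lemma AE_subst:
  assumes "AE x in lborel. P x"
  shows "AE \<xi> in lborel. y' \<xi> \<noteq> 0 \<longrightarrow> P (y \<xi>)"
proof -
  obtain N where N: "N \<in> null_sets lborel" "{x. \<not> P x} \<subseteq> N"
    using assms by (auto simp: eventually_ae_filter)
  then have [measurable]: "N \<in> sets borel" by auto
  have "(\<integral>\<^sup>+\<xi>. indicator N (y \<xi>) * ennreal (y' \<xi>) \<partial>lborel) = 0"
    using N(1) by (subst nn_integral_subst) (auto simp: null_sets_def)
  then have "AE \<xi> in lborel. indicator N (y \<xi>) * ennreal (y' \<xi>) = 0"
    by (subst (asm) nn_integral_0_iff_AE) auto
  then show ?thesis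
    by eventually_elim (use N(2) nonneg in \<open>auto simp: indicator_def ennreal_eq_0_iff order_antisym split: if_splits\<close>)
qed

lemma AE_subst_iff:
  assumes [measurable]: "{x. P x} \<in> sets borel"
  shows "(AE \<xi> in lborel. y' \<xi> \<noteq> 0 \<longrightarrow> P (y \<xi>)) \<longleftrightarrow> (AE x in lborel. P x)"
proof
  assume *: "AE \<xi> in lborel. y' \<xi> \<noteq> 0 \<longrightarrow> P (y \<xi>)"
  have [measurable]: "{x. \<not> P x} \<in> sets borel"
    using sets.compl_sets[OF assms] by (simp add: Compl_eq_Diff_UNIV[symmetric] Collect_neg_eq)
  have "(\<integral>\<^sup>+x. indicator {x. \<not> P x} x \<partial>lborel) = (\<integral>\<^sup>+\<xi>. indicator {x. \<not> P x} (y \<xi>) * ennreal (y' \<xi>) \<partial>lborel)"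
    by (subst nn_integral_subst) auto
  also have "\<dots> = (\<integral>\<^sup>+\<xi>. 0 \<partial>(lborel :: real measure))"
    by (rule nn_integral_cong_AE) (use * in \<open>eventually_elim, auto simp: indicator_def\<close>)
  finally have "emeasure lborel {x. \<not> P x} = 0" by simp
  then show "AE x in lborel. P x"
    by (intro AE_I[of _ _ "{x. \<not> P x}"]) auto
qed (rule AE_subst)

text \<open>Chain rule by substitution. The preimage of \<open>[y a, y b]\<close> exceeds
  \<open>[a, b]\<close> only by parts of the level sets of \<open>y a\<close> and
  \<open>y b\<close>, and there \<open>y'\<close> vanishes almost everywhere.\<close>

lemma prim_comp:
  assumes u: "prim u u'"
  shows "prim (\<lambda>\<xi>. u (y \<xi>)) (\<lambda>\<xi>. u' (y \<xi>) * y' \<xi>)"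
proof -
  have [measurable]: "u' \<in> borel_measurable borel" using primD[OF u] by blast
  have int: "set_integrable lborel (y -` {y a..y b}) (\<lambda>\<xi>. u' (y \<xi>) * y' \<xi>)" for a b
    by (subst set_integrable_subst) (use primD[OF u] in auto)
  show ?thesis
    unfolding prim_def locint_def
  proof (intro conjI allI impI)
    fix a b show "set_integrable lborel {a..b} (\<lambda>\<xi>. u' (y \<xi>) * y' \<xi>)"
      by (rule set_integrable_subset[OF int[of a b]]) (auto simp: mono)
  next
    fix a b :: real assume ab: "a \<le> b"
    have "AE x in lborel. x \<noteq> y a \<and> x \<noteq> y b"
      using AE_lborel_singleton[of "y a"] AE_lborel_singleton[of "y b"] by eventually_elim auto
    from AE_subst[OF this]
    have AE: "AE \<xi> in lborel. indicator {a..b} \<xi> *\<^sub>R (u' (y \<xi>) * y' \<xi>) = indicator (y -` {y a..y b}) \<xi> *\<^sub>R (u' (y \<xi>) * y' \<xi>)"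
    proof eventually_elim
      case (elim \<xi>)
      show ?case
      proof (cases "y' \<xi> = 0")
        case False
        then have "\<xi> \<in> {a..b} \<longleftrightarrow> y \<xi> \<in> {y a..y b}"
          using elim mono[of \<xi> a] mono[of a \<xi>] mono[of \<xi> b] mono[of b \<xi>] by force
        then show ?thesis by (simp add: indicator_def)
      qed simp
    qed
    have "u (y b) - u (y a) = (LINT x:{y a..y b}|lborel. u' x)" using primD(4)[OF u mono[OF ab]] .
    also have "\<dots> = (LINT \<xi>:(y -` {y a..y b})|lborel. u' (y \<xi>) * y' \<xi>)"
      by (subst set_integral_subst) auto
    also have "\<dots> = (LINT \<xi>:{a..b}|lborel. u' (y \<xi>) * y' \<xi>)"
      unfolding set_lebesgue_integral_def
      by (rule integral_cong_AE[symmetric]) (use AE in auto)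
    finally show "u (y b) - u (y a) = (LINT \<xi>:{a..b}|lborel. u' (y \<xi>) * y' \<xi>)" .
  qed measurable
qed

section \<open>Flat values, and transport of densities to the image line\<close>

lemma flat_null: "y ` \<rat> \<in> null_sets lborel"
  by (intro countable_imp_null_set_lborel countable_image countable_rat)

lemma flat_meas[measurable]: "y ` \<rat> \<in> sets borel"
  using flat_null by auto

lemma AE_flat: "AE \<xi> in lborel. y \<xi> \<in> y ` \<rat> \<longrightarrow> y' \<xi> = 0"
  using AE_subst[OF AE_not_in[OF flat_null]] by eventually_elim auto

text \<open>A level set with two points contains an interval, hence a rational point.\<close>

lemma inj_off_flat:
  assumes "y \<xi> \<notin> y ` \<rat>" "y \<eta> = y \<xi>"
  shows "\<eta> = \<xi>"
proof (rule ccontr)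
  assume "\<eta> \<noteq> \<xi>"
  then obtain q where "q \<in> \<rat>" "min \<eta> \<xi> < q" "q < max \<eta> \<xi>"
    using Rats_dense_in_real[of "min \<eta> \<xi>" "max \<eta> \<xi>"] by fastforce
  moreover from this have "y q = y \<xi>"
    using mono[of "min \<eta> \<xi>" q] mono[of q "max \<eta> \<xi>"] assms(2) by (auto simp: min_def max_def split: if_splits)
  ultimately show False using assms(1) by (metis imageI)
qed

lemma linv_off_flat: "y \<xi> \<notin> y ` \<rat> \<Longrightarrow> linv (y \<xi>) = \<xi>"
  by (rule inj_off_flat) (auto simp: linv)

text \<open>The quotient \<open>h / y'\<close> is read along the section \<open>linv\<close>. Where
  \<open>linv (y \<xi>)\<close> differs from \<open>\<xi>\<close>, the value \<open>y \<xi>\<close>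
  is flat, so \<open>y'\<close> and with it \<open>h\<close> vanish almost everywhere.\<close>

lemma ex_push_density:
  assumes [measurable]: "h \<in> borel_measurable borel" and z: "AE \<xi> in lborel. y' \<xi> = 0 \<longrightarrow> h \<xi> = 0"
  obtains k where "k \<in> borel_measurable borel" "AE \<xi> in lborel. k (y \<xi>) * y' \<xi> = (h \<xi> :: real)"
proof
  let ?k = "\<lambda>x. h (linv x) / y' (linv x)"
  show "?k \<in> borel_measurable borel" by measurable
  show "AE \<xi> in lborel. ?k (y \<xi>) * y' \<xi> = h \<xi>"
    using z AE_flat
  proof eventually_elim
    case (elim \<xi>)
    then show ?case using linv_off_flat[of \<xi>] by (cases "y \<xi> \<in> y ` \<rat>") auto
  qed
qed

text \<open>A Sard-type statement.\<close>

lemma critical_values_null: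
  obtains Z where "Z \<in> null_sets lborel" "\<And>\<xi>. y' \<xi> = 0 \<Longrightarrow> y \<xi> \<in> Z"
proof
  \<comment> \<open>At a value that is not flat the level set is the single point
    \<open>linv x\<close>, so testing \<open>y'\<close> at \<open>linv x\<close> detects every
    critical value there.\<close>
  let ?Z = "y ` \<rat> \<union> {x. y' (linv x) = 0}"
  have "AE \<xi> in lborel. y' \<xi> \<noteq> 0 \<longrightarrow> y' (linv (y \<xi>)) \<noteq> 0"
    using AE_flat
  proof eventually_elim
    case (elim \<xi>)
    then show ?case using linv_off_flat[of \<xi>] by auto
  qed
  then have "AE x in lborel. y' (linv x) \<noteq> 0"
    by (rule AE_subst_iff[THEN iffD1, rotated]) measurable
  then have "{x. y' (linv x) = 0} \<in> null_sets lborel"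
    by (subst AE_iff_null_sets) auto
  then show "?Z \<in> null_sets lborel" using flat_null by (rule null_sets.Un[rotated])
  show "y \<xi> \<in> ?Z" if "y' \<xi> = 0" for \<xi>
    using that linv_off_flat[of \<xi>] by (cases "y \<xi> \<in> y ` \<rat>") simp_all
qed

end

subsection \<open>Lebesgue and Sobolev norms\<close>

lemma esssup_abs_nonneg: "0 \<le> esssup lborel (\<lambda>x::real. ereal \<bar>f x\<bar>)"
proof (cases "(\<lambda>x. ereal \<bar>f x\<bar>) \<in> borel_measurable lborel")
  case True
  have "(0::ereal) = esssup lborel (\<lambda>x::real. 0)" by (subst esssup_const) auto
  also have "\<dots> \<le> esssup lborel (\<lambda>x. ereal \<bar>f x\<bar>)" using True by (intro esssup_mono) auto
  finally show ?thesis .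
qed (simp add: esssup_non_measurable)

lemma norminf_nonneg: "0 \<le> norminf f"
  by (simp add: norminf_def real_of_ereal_pos esssup_abs_nonneg)

lemma LinfI:
  assumes [measurable]: "f \<in> borel_measurable borel" and "AE x in lborel. \<bar>f x\<bar> \<le> K"
  shows "f \<in> Linf" "norminf f \<le> K"
proof -
  let ?e = "esssup lborel (\<lambda>x. ereal \<bar>f x\<bar>)"
  have le: "?e \<le> ereal K" using assms(2) by (intro esssup_I) auto
  then show "f \<in> Linf" by (auto simp: Linf_def)
  show "norminf f \<le> K" using le esssup_abs_nonneg[of f] by (cases ?e) (auto simp: norminf_def)
qed

lemma LinfD:
  assumes "f \<in> Linf"
  shows "f \<in> borel_measurable borel" "AE x in lborel. \<bar>f x\<bar> \<le> norminf f"
proof -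
  show [measurable]: "f \<in> borel_measurable borel" using assms by (simp add: Linf_def)
  let ?e = "esssup lborel (\<lambda>x. ereal \<bar>f x\<bar>)"
  have e: "?e = ereal (norminf f)"
    using assms esssup_abs_nonneg[of f] by (cases ?e) (auto simp: norminf_def Linf_def)
  show "AE x in lborel. \<bar>f x\<bar> \<le> norminf f"
    using esssup_AE[of "\<lambda>x. ereal \<bar>f x\<bar>" lborel] unfolding e by eventually_elim simp
qed

lemma continuous_AE_bound:
  fixes f :: "real \<Rightarrow> real"
  assumes "continuous_on UNIV f" "AE x in lborel. \<bar>f x\<bar> \<le> K"
  shows "\<bar>f x\<bar> \<le> K"
proof -
  have "x \<in> {x. \<bar>f x\<bar> \<le> K}"
  proof (rule mem_closed_if_AE_lebesgue)
    show "closed {x. \<bar>f x\<bar> \<le> K}" using assms(1) by (intro closed_Collect_le continuous_intros)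
    show "AE x in lebesgue. x \<in> {x. \<bar>f x\<bar> \<le> K}"
      using assms(2) by (intro AE_completion) auto
  qed
  then show ?thesis by simp
qed

lemma norminf_upper:
  assumes "continuous_on UNIV f" "f \<in> Linf"
  shows "\<bar>f x\<bar> \<le> norminf f"
  using continuous_AE_bound[OF assms(1) LinfD(2)[OF assms(2)]] .

lemma L2_cong_AE:
  assumes "g \<in> L2" "AE x in lborel. g x = g' x" "g' \<in> borel_measurable borel"
  shows "g' \<in> L2" "norm2 g' = norm2 g"
proof -
  have [measurable]: "g \<in> borel_measurable borel" "g' \<in> borel_measurable borel" 
    using assms by (auto simp: L2_def)
  have AE: "AE x in lborel. (g x)\<^sup>2 = (g' x)\<^sup>2" using assms(2) by eventually_elim simp
  then have "integrable lborel (\<lambda>x. (g x)\<^sup>2) \<longleftrightarrow> integrable lborel (\<lambda>x. (g' x)\<^sup>2)"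
    by (intro integrable_cong_AE) auto
  then show "g' \<in> L2" using assms by (auto simp: L2_def)
  show "norm2 g' = norm2 g"
    unfolding norm2_def using AE by (intro arg_cong[where f=sqrt] integral_cong_AE) auto
qed

lemma L2_bound:
  assumes "g' \<in> borel_measurable borel" "integrable lborel h" "AE x in lborel. (g' x)\<^sup>2 \<le> h x"
  shows "g' \<in> L2"
proof -
  have "integrable lborel (\<lambda>x. (g' x)\<^sup>2)"
    by (rule Bochner_Integration.integrable_bound[OF assms(2)]) (use assms in \<open>auto elim!: eventually_mono\<close>)
  then show ?thesis using assms(1) by (simp add: L2_def)
qed

lemma L2_cmult: "f \<in> L2 \<Longrightarrow> (\<lambda>x. c * f x) \<in> L2"
  by (auto simp: L2_def power_mult_distrib)

lemma norm2_cmult: "norm2 (\<lambda>x. c * f x) = \<bar>c\<bar> * norm2 f"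
  by (simp add: norm2_def power_mult_distrib real_sqrt_mult)

lemma norm2_nonneg: "0 \<le> norm2 f"
  by (simp add: norm2_def)

lemma norm2_square: "(norm2 f)\<^sup>2 = (LINT x|lborel. (f x)\<^sup>2)"
  by (simp add: norm2_def)

lemma L2_add:
  assumes "f \<in> L2" "g \<in> L2"
  shows "(\<lambda>x. f x + g x) \<in> L2"
proof (rule L2_bound)
  show "integrable lborel (\<lambda>x. 2 * (f x)\<^sup>2 + 2 * (g x)\<^sup>2)" using assms by (auto simp: L2_def)
  have "(f x + g x)\<^sup>2 \<le> 2 * (f x)\<^sup>2 + 2 * (g x)\<^sup>2" for x
    using zero_le_power2[of "f x - g x"] by (simp add: power2_sum power2_diff)
  then show "AE x in lborel. (f x + g x)\<^sup>2 \<le> 2 * (f x)\<^sup>2 + 2 * (g x)\<^sup>2" by simp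
qed (use assms in \<open>auto simp: L2_def\<close>)

lemma L2_diff: "f \<in> L2 \<Longrightarrow> g \<in> L2 \<Longrightarrow> (\<lambda>x. f x - g x) \<in> L2"
  using L2_add[OF _ L2_cmult[of g "-1"]] by simp

text \<open>With \<open>a\<close> and \<open>b\<close> the two norms, Young's inequality gives
  \<open>(f + g)\<^sup>2 \<le> (1 + b/a) f\<^sup>2 + (1 + a/b) g\<^sup>2\<close>, and these weights
  make the integral of the right side exactly \<open>(a + b)\<^sup>2\<close>. If a norm is zero, its
  function vanishes almost everywhere.\<close>

lemma norm2_triangle:
  assumes f: "f \<in> L2" and g: "g \<in> L2"
  shows "norm2 (\<lambda>x. f x + g x) \<le> norm2 f + norm2 g"
proof -
  have [measurable]: "f \<in> borel_measurable borel" "g \<in> borel_measurable borel" using f g by (auto simp: L2_def)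
  have int: "integrable lborel (\<lambda>x. (f x)\<^sup>2)" "integrable lborel (\<lambda>x. (g x)\<^sup>2)"
    using f g by (auto simp: L2_def)
  have zero: "AE x in lborel. h x = 0" if "h \<in> L2" "norm2 h = 0" for h
  proof -
    have "(LINT x|lborel. (h x)\<^sup>2) = 0" using that(2) norm2_square[of h] by simp
    then have "AE x in lborel. (h x)\<^sup>2 = 0" 
      using that(1) by (subst (asm) integral_nonneg_eq_0_iff_AE) (auto simp: L2_def)
    then show ?thesis by eventually_elim simp
  qed
  consider "norm2 f = 0" | "norm2 g = 0" | "norm2 f > 0" "norm2 g > 0"
    using norm2_nonneg[of f] norm2_nonneg[of g] by linarith
  then show ?thesis
  proof cases
    case 1
    have "norm2 (\<lambda>x. f x + g x) = norm2 g"
      by (rule L2_cong_AE(2)[OF g]) (use zero[OF f 1] in auto)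
    then show ?thesis using 1 by simp
  next
    case 2
    have "norm2 (\<lambda>x. f x + g x) = norm2 f"
      by (rule L2_cong_AE(2)[OF f]) (use zero[OF g 2] in auto)
    then show ?thesis using 2 by simp
  next
    case 3
    define a b where "a = norm2 f" and "b = norm2 g"
    have ab: "a > 0" "b > 0" using 3 by (simp_all add: a_def b_def)
    have "(norm2 (\<lambda>x. f x + g x))\<^sup>2 = (LINT x|lborel. (f x + g x)\<^sup>2)" by (rule norm2_square)
    also have "\<dots> \<le> (LINT x|lborel. (1 + b / a) * (f x)\<^sup>2 + (1 + a / b) * (g x)\<^sup>2)"
    proof (rule integral_mono)
      show "integrable lborel (\<lambda>x. (f x + g x)\<^sup>2)" using L2_add[OF f g] by (simp add: L2_def)
      show "integrable lborel (\<lambda>x. (1 + b / a) * (f x)\<^sup>2 + (1 + a / b) * (g x)\<^sup>2)" using int by auto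
      fix x
      have "0 \<le> (b * f x - a * g x)\<^sup>2 / (a * b)" using ab by simp
      also have "\<dots> = (b / a) * (f x)\<^sup>2 + (a / b) * (g x)\<^sup>2 - 2 * f x * g x"
        using ab by (simp add: power2_eq_square field_simps)
      finally show "(f x + g x)\<^sup>2 \<le> (1 + b / a) * (f x)\<^sup>2 + (1 + a / b) * (g x)\<^sup>2"
        by (simp add: power2_sum algebra_simps)
    qed
    also have "\<dots> = (1 + b / a) * a\<^sup>2 + (1 + a / b) * b\<^sup>2"
      using int by (simp add: a_def b_def norm2_square)
    also have "\<dots> = (a + b)\<^sup>2" using ab by (simp add: power2_eq_square field_simps)
    finally show ?thesis
      using ab norm2_nonneg power2_le_imp_le unfolding a_def b_def by (meson add_nonneg_nonneg)
  qed
qed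

section \<open>Sobolev functions as bounded primitives\<close>

lemma E2I:
  assumes "prim f f'" "\<And>x. \<bar>f x\<bar> \<le> K" "f' \<in> L2"
  shows "f \<in> E2"
proof -
  have c: "continuous_on UNIV f" using prim_continuous[OF assms(1)] .
  then have m: "f \<in> borel_measurable borel" by (rule borel_measurable_continuous_onI)
  have "AE x in lborel. f' x = wderiv f x" using prim_wderiv(3)[OF assms(1)] by eventually_elim simp
  then have "wderiv f \<in> L2"
    using L2_cong_AE(1)[OF assms(3)] primD(2)[OF prim_wderiv(2)[OF assms(1)]] by blast
  then show ?thesis using c prim_wderiv(1)[OF assms(1)] LinfI(1)[OF m, of K] assms(2) by (auto simp: E2_def)
qed

lemma E2D:
  assumes "f \<in> E2"
  shows "prim f (wderiv f)" "wderiv f \<in> L2" "\<bar>f x\<bar> \<le> norminf f" "continuous_on UNIV f"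
  using assms weakly_diff_prim norminf_upper by (auto simp: E2_def)

lemma normE_prim:
  assumes "prim f f'"
  shows "normE f = norminf f + norm2 f'"
proof -
  have [measurable]: "f' \<in> borel_measurable borel" "wderiv f \<in> borel_measurable borel"
    using primD(2)[OF assms] primD(2)[OF prim_wderiv(2)[OF assms]] by auto
  have "AE x in lborel. (wderiv f x)\<^sup>2 = (f' x)\<^sup>2" using prim_wderiv(3)[OF assms] by eventually_elim simp
  then have "norm2 (wderiv f) = norm2 f'"
    unfolding norm2_def by (intro arg_cong[where f=sqrt] integral_cong_AE) auto
  then show ?thesis by (simp add: normE_def)
qed

lemma W1infI:
  assumes "prim f f'" "\<And>x. \<bar>f x\<bar> \<le> K" "AE x in lborel. \<bar>f' x\<bar> \<le> K'"
  shows "f \<in> W1inf"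
proof -
  have m: "f \<in> borel_measurable borel" 
    using prim_continuous[OF assms(1)] by (rule borel_measurable_continuous_onI)
  have "AE x in lborel. \<bar>wderiv f x\<bar> \<le> K'" 
    using prim_wderiv(3)[OF assms(1)] assms(3) by eventually_elim simp
  then have "wderiv f \<in> Linf" using primD(2)[OF prim_wderiv(2)[OF assms(1)]] by (intro LinfI)
  then show ?thesis using prim_wderiv(1)[OF assms(1)] LinfI(1)[OF m, of K] assms(2) by (auto simp: W1inf_def)
qed

lemma W1infD:
  assumes "f \<in> W1inf" "continuous_on UNIV f"
  shows "prim f (wderiv f)" "\<bar>f x\<bar> \<le> norminf f" "AE x in lborel. \<bar>wderiv f x\<bar> \<le> norminf (wderiv f)"
  using assms weakly_diff_prim norminf_upper LinfD(2) by (auto simp: W1inf_def)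

lemma prim_lipschitz:
  assumes f: "prim f f'" and K: "AE x in lborel. \<bar>f' x\<bar> \<le> K" and ab: "a \<le> b"
  shows "\<bar>f b - f a\<bar> \<le> K * (b - a)"
proof -
  have "\<bar>f b - f a\<bar> = \<bar>LINT x:{a..b}|lborel. f' x\<bar>" using primD(4)[OF f ab] by simp
  also have "\<dots> \<le> (LINT x|lborel. norm (indicator {a..b} x *\<^sub>R f' x))"
    unfolding set_lebesgue_integral_def using integral_norm_bound[of lborel "\<lambda>x. indicator {a..b} x *\<^sub>R f' x"] by simp
  also have "\<dots> \<le> (LINT x|lborel. indicator {a..b} x *\<^sub>R K)"
  proof (rule integral_mono_AE)
    show "integrable lborel (\<lambda>x. norm (indicator {a..b} x *\<^sub>R f' x))"
      using primD(3)[OF f] unfolding set_integrable_def by (rule integrable_norm)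
    show "integrable lborel (\<lambda>x. indicator {a..b} x *\<^sub>R K)"
      using locintD(2)[OF locint_const] unfolding set_integrable_def .
    show "AE x in lborel. norm (indicator {a..b} x *\<^sub>R f' x) \<le> indicator {a..b} x *\<^sub>R K"
      using K by eventually_elim (auto simp: indicator_def)
  qed
  also have "\<dots> = K * (b - a)" using ab by simp
  finally show ?thesis .
qed

lemma prim_bounded_integrable:
  assumes H: "prim H H'" and nn: "\<And>x. 0 \<le> H' x" and K: "\<And>x. \<bar>H x\<bar> \<le> K"
  shows "integrable lborel H'"
proof -
  have [measurable]: "H' \<in> borel_measurable borel" using primD(2)[OF H] .
  let ?M = "density lborel (\<lambda>x. ennreal (H' x))"
  have "(\<integral>\<^sup>+x. ennreal (H' x) \<partial>lborel) = emeasure ?M (\<Union>n. {- real n..real n})"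
  proof -
    have "(\<Union>n. {- real n..real n}) = UNIV"
    proof safe
      fix x :: real
      obtain n where "\<bar>x\<bar> < real n" using reals_Archimedean2 by blast
      then show "x \<in> (\<Union>n. {- real n..real n})" by (auto intro!: exI[of _ n])
    qed auto
    then show ?thesis by (simp add: emeasure_density)
  qed
  also have "\<dots> = (SUP n. emeasure ?M {- real n..real n})"
    by (rule SUP_emeasure_incseq[symmetric]) (auto simp: incseq_def)
  also have "\<dots> \<le> ennreal (2 * K)"
  proof (rule SUP_least)
    fix n
    have "emeasure ?M {- real n..real n} = ennreal (H (real n) - H (- real n))"
      by (rule prim_nn_integral[OF H nn]) auto
    also have "\<dots> \<le> ennreal (2 * K)" 
      using K[of "real n"] K[of "- real n"] by (intro ennreal_leI) (auto simp: abs_le_iff)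
    finally show "emeasure ?M {- real n..real n} \<le> ennreal (2 * K)" .
  qed
  finally have "(\<integral>\<^sup>+x. ennreal (H' x) \<partial>lborel) < \<infinity>" using le_less_trans by fastforce
  then show ?thesis using nn by (intro integrableI_nonneg) auto
qed

text \<open>Identifies a primitive that vanishes at minus infinity with the distribution function of
  its density. The measures of the two coordinate systems are compared through such
  half-lines.\<close>

lemma prim_emeasure_lessThan:
  assumes H: "prim H H'" and nn: "\<And>x. 0 \<le> H' x" and lim: "(H \<longlongrightarrow> 0) at_bot"
  shows "emeasure (density lborel (\<lambda>x. ennreal (H' x))) {..<x} = ennreal (H x)"
proof -
  have [measurable]: "H' \<in> borel_measurable borel" using primD(2)[OF H] .
  let ?M = "density lborel (\<lambda>x. ennreal (H' x))"
  have "(\<lambda>n. emeasure ?M {x - real n..<x}) \<longlonglongrightarrow> emeasure ?M (\<Union>n. {x - real n..<x})"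
    by (rule Lim_emeasure_incseq) (auto simp: incseq_def)
  also have "(\<Union>n. {x - real n..<x}) = {..<x}"
  proof safe
    fix z assume "z < x"
    moreover obtain n where "x - z < real n" using reals_Archimedean2 by blast
    ultimately show "z \<in> (\<Union>n. {x - real n..<x})" by (auto intro!: exI[of _ n])
  qed auto
  also have "(\<lambda>n. emeasure ?M {x - real n..<x}) = (\<lambda>n. ennreal (H x - H (x - real n)))"
    by (auto simp: emeasure_density_Ico_Icc intro!: prim_nn_integral[OF H nn])
  finally have 1: "(\<lambda>n. ennreal (H x - H (x - real n))) \<longlonglongrightarrow> emeasure ?M {..<x}" .
  have "filterlim (\<lambda>n. x - real n) at_bot sequentially"
    unfolding filterlim_at_bot eventually_sequentially
  proof
    fix Z
    have "x - real n \<le> Z" if "n \<ge> nat \<lceil>x - Z\<rceil>" for n using that by linarith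
    then show "\<exists>N. \<forall>n\<ge>N. x - real n \<le> Z" by blast
  qed
  then have "(\<lambda>n. H (x - real n)) \<longlonglongrightarrow> 0" using lim by (rule filterlim_compose[rotated])
  then have "(\<lambda>n. ennreal (H x - H (x - real n))) \<longlonglongrightarrow> ennreal (H x - 0)"
    by (intro tendsto_intros) 
  then show ?thesis using 1 LIMSEQ_unique by auto
qed

subsection \<open>Relabelling functions\<close>

context incr
begin

text \<open>Of the two factors \<open>y'\<close> in the square, one is consumed by the change of
  variables and the other is bounded by \<open>K\<close>: hence the square root. With
  \<open>K = exp t\<close> this is the source of \<open>exp (t/2)\<close>.\<close>

lemma L2_comp:
  assumes h: "h \<in> L2" and K: "\<And>\<xi>. y' \<xi> \<le> K"
  shows "(\<lambda>\<xi>. h (y \<xi>) * y' \<xi>) \<in> L2" "norm2 (\<lambda>\<xi>. h (y \<xi>) * y' \<xi>) \<le> sqrt K * norm2 h"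
proof -
  have [measurable]: "h \<in> borel_measurable borel" using h by (simp add: L2_def)
  have i: "integrable lborel (\<lambda>\<xi>. (h (y \<xi>))\<^sup>2 * y' \<xi>)"
    using integrable_subst[of "\<lambda>x. (h x)\<^sup>2"] h by (simp add: L2_def)
  have le: "(h (y \<xi>) * y' \<xi>)\<^sup>2 \<le> K * ((h (y \<xi>))\<^sup>2 * y' \<xi>)" for \<xi>
    using mult_right_mono[OF K[of \<xi>], of "(h (y \<xi>))\<^sup>2 * y' \<xi>"] nonneg[of \<xi>]
    by (simp add: power2_eq_square mult_ac)
  show 1: "(\<lambda>\<xi>. h (y \<xi>) * y' \<xi>) \<in> L2"
    by (rule L2_bound[of _ "\<lambda>\<xi>. K * ((h (y \<xi>))\<^sup>2 * y' \<xi>)"]) (use i le in auto)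
  have "(LINT \<xi>|lborel. (h (y \<xi>) * y' \<xi>)\<^sup>2) \<le> (LINT \<xi>|lborel. K * ((h (y \<xi>))\<^sup>2 * y' \<xi>))"
    using 1 i le by (intro integral_mono) (auto simp: L2_def)
  also have "\<dots> = K * (LINT x|lborel. (h x)\<^sup>2)"
    using integral_subst[of "\<lambda>x. (h x)\<^sup>2"] by simp
  finally show "norm2 (\<lambda>\<xi>. h (y \<xi>) * y' \<xi>) \<le> sqrt K * norm2 h"
    by (simp add: norm2_def real_sqrt_mult[symmetric])
qed

end

text \<open>The group \<open>G\<close> seen through an explicit derivative with bounds at every
  point; \<open>in_relabG\<close> and \<open>relabG_D\<close> pass between the two
  descriptions.\<close>

locale relab = incr +
  assumes lower: "\<exists>c>0. \<forall>\<xi>. c \<le> y' \<xi>" and upper: "\<exists>K. \<forall>\<xi>. y' \<xi> \<le> K"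
    and L2: "(\<lambda>\<xi>. y' \<xi> - 1) \<in> L2"
begin

lemma expand:
  assumes "\<And>\<xi>. c \<le> y' \<xi>" "a \<le> b"
  shows "c * (b - a) \<le> y b - y a"
proof -
  have p: "prim (\<lambda>x. y x - c * x) (\<lambda>x. y' x - c * 1)"
    by (intro prim_diff prim prim_cmult prim_id)
  have "0 \<le> (LINT x:{a..b}|lborel. y' x - c * 1)"
    unfolding set_lebesgue_integral_def using assms by (intro integral_nonneg_AE) auto
  then show ?thesis using primD(4)[OF p assms(2)] by (simp add: algebra_simps)
qed

lemma pos: "0 < y' \<xi>"
  using lower less_le_trans by blast

lemma strict: "a < b \<Longrightarrow> y a < y b"
proof -
  assume ab: "a < b"
  obtain c where c: "c > 0" "\<And>\<xi>. c \<le> y' \<xi>" using lower by blast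
  have "0 < c * (b - a)" using c(1) ab by simp
  also have "\<dots> \<le> y b - y a" using expand[OF c(2)] ab by simp
  finally show "y a < y b" by simp
qed

lemma le_iff: "y a \<le> y b \<longleftrightarrow> a \<le> b"
  using mono[of a b] strict[of b a] by linarith

lemma inj: "y a = y b \<longleftrightarrow> a = b"
  using le_iff[of a b] le_iff[of b a] by auto

lemma linv_y[simp]: "linv (y \<xi>) = \<xi>"
  using linv(2)[of "y \<xi>"] inj by simp

lemma y_linv[simp]: "y (linv x) = x"
  by (rule linv)

lemma inv_eq: "inv y = linv"
  by (rule inv_unique_comp) (auto simp: fun_eq_iff)

text \<open>Inverse function rule by substitution: the length of \<open>[linv a, linv b]\<close> is
  the integral of \<open>(1 / y') * y'\<close> over the preimage of \<open>[a, b]\<close>.\<close>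

lemma linv_prim: "prim linv (\<lambda>x. 1 / y' (linv x))"
proof -
  have b: "AE x in lborel. \<bar>1 / y' (linv x)\<bar> \<le> 1 / c" if "c > 0" "\<And>\<xi>. c \<le> y' \<xi>" for c
    using that pos by (auto intro!: divide_left_mono simp: less_imp_le)
  show ?thesis
    unfolding prim_def
  proof (intro conjI allI impI)
    obtain c where "c > 0" "\<And>\<xi>. c \<le> y' \<xi>" using lower by blast
    then show "locint (\<lambda>x. 1 / y' (linv x))"
      using b by (intro locint_bounded[of _ "1 / c"]) auto
    fix a b :: real assume ab: "a \<le> b"
    have "linv b - linv a = (LINT x:{linv a..linv b}|lborel. 1)"
      using primD(4)[OF prim_id, of "linv a" "linv b"] ab linv by simp
    also have "{linv a..linv b} = y -` {a..b}"
      using linv(1)[of a] le_iff[of _ "linv b"] by auto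
    also have "(LINT x:y -` {a..b}|lborel. 1) = (LINT \<xi>:y -` {a..b}|lborel. 1 / y' (linv (y \<xi>)) * y' \<xi>)"
      using pos by (simp add: less_imp_neq[symmetric])
    also have "\<dots> = (LINT x:{a..b}|lborel. 1 / y' (linv x))"
      by (rule set_integral_subst) measurable
    finally show "linv b - linv a = (LINT x:{a..b}|lborel. 1 / y' (linv x))" .
  qed
qed

lemma relab_linv: "relab linv (\<lambda>x. 1 / y' (linv x))"
proof
  show "prim linv (\<lambda>x. 1 / y' (linv x))" by (rule linv_prim)
  show "0 \<le> 1 / y' (linv \<xi>)" for \<xi> using pos less_imp_le by auto
  obtain C where C: "\<And>\<xi>. \<bar>y \<xi> - \<xi>\<bar> \<le> C" using bdd by blast
  have "\<bar>linv x - x\<bar> \<le> C" for x using C[of "linv x"] by (simp add: abs_minus_commute)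
  then show "\<exists>C. \<forall>\<xi>. \<bar>linv \<xi> - \<xi>\<bar> \<le> C" by blast
  obtain c where c: "c > 0" "\<And>\<xi>. c \<le> y' \<xi>" using lower by blast
  have "1 / y' (linv x) \<le> 1 / c" for x
    using c pos by (intro divide_left_mono) auto
  then show "\<exists>K. \<forall>\<xi>. 1 / y' (linv \<xi>) \<le> K" by blast
  obtain K where K: "\<And>\<xi>. y' \<xi> \<le> K" using upper by blast
  then have Kpos: "K > 0" using pos less_le_trans by blast
  have "1 / K \<le> 1 / y' (linv x)" for x
    using K pos Kpos by (intro divide_left_mono) auto
  then show "\<exists>c>0. \<forall>\<xi>. c \<le> 1 / y' (linv \<xi>)" using Kpos by (intro exI[of _ "1 / K"]) auto
  \<comment> \<open>Substituting \<open>x = y \<xi>\<close> turns the square integral of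
    \<open>1 / y' (linv x) - 1\<close> into that of \<open>(y' - 1)\<^sup>2 / y'\<close>, which the
    lower bound on \<open>y'\<close> controls.\<close>
  have eq: "(1 / y' \<xi> - 1)\<^sup>2 * y' \<xi> = (y' \<xi> - 1)\<^sup>2 / y' \<xi>" for \<xi>
    using pos[of \<xi>] by (simp add: power2_eq_square field_simps)
  have "(y' \<xi> - 1)\<^sup>2 / y' \<xi> \<le> (y' \<xi> - 1)\<^sup>2 / c" for \<xi>
    using c pos[of \<xi>] by (intro divide_left_mono) auto
  moreover have "integrable lborel (\<lambda>\<xi>. (y' \<xi> - 1)\<^sup>2 / c)" using L2 by (auto simp: L2_def)
  ultimately have "integrable lborel (\<lambda>\<xi>. (y' \<xi> - 1)\<^sup>2 / y' \<xi>)"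
    using c pos by (elim Bochner_Integration.integrable_bound) (auto simp: less_imp_le)
  then have "integrable lborel (\<lambda>\<xi>. (1 / y' (linv (y \<xi>)) - 1)\<^sup>2 * y' \<xi>)" by (simp add: eq)
  then have "integrable lborel (\<lambda>x. (1 / y' (linv x) - 1)\<^sup>2)"
    by (subst (asm) integrable_subst[of "\<lambda>x. (1 / y' (linv x) - 1)\<^sup>2"]) auto
  then show "(\<lambda>\<xi>. 1 / y' (linv \<xi>) - 1) \<in> L2" by (simp add: L2_def)
qed

lemma relab_comp:
  assumes "relab h h'"
  shows "relab (\<lambda>\<xi>. h (y \<xi>)) (\<lambda>\<xi>. h' (y \<xi>) * y' \<xi>)"
proof -
  interpret h: relab h h' by fact
  obtain c1 c2 where c: "c1 > 0" "\<And>\<xi>. c1 \<le> y' \<xi>" "c2 > 0" "\<And>\<xi>. c2 \<le> h' \<xi>" using lower h.lower by blast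
  obtain K1 K2 where K: "\<And>\<xi>. y' \<xi> \<le> K1" "\<And>\<xi>. h' \<xi> \<le> K2" using upper h.upper by blast
  show ?thesis
  proof
    show "prim (\<lambda>\<xi>. h (y \<xi>)) (\<lambda>\<xi>. h' (y \<xi>) * y' \<xi>)" by (rule prim_comp[OF h.prim])
    show "0 \<le> h' (y \<xi>) * y' \<xi>" for \<xi> using nonneg h.nonneg by simp
    obtain C1 C2 where C: "\<And>\<xi>. \<bar>y \<xi> - \<xi>\<bar> \<le> C1" "\<And>\<xi>. \<bar>h \<xi> - \<xi>\<bar> \<le> C2" using bdd h.bdd by blast
    have "\<bar>h (y \<xi>) - \<xi>\<bar> \<le> C1 + C2" for \<xi> using C(1)[of \<xi>] C(2)[of "y \<xi>"] by linarith
    then show "\<exists>C. \<forall>\<xi>. \<bar>h (y \<xi>) - \<xi>\<bar> \<le> C" by blast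
    have "c2 * c1 \<le> h' (y \<xi>) * y' \<xi>" for \<xi> using c h.nonneg by (intro mult_mono) auto
    then show "\<exists>c>0. \<forall>\<xi>. c \<le> h' (y \<xi>) * y' \<xi>" using c by (intro exI[of _ "c2 * c1"]) auto
    have "0 \<le> K2" using h.nonneg K(2) order_trans by blast
    then have "h' (y \<xi>) * y' \<xi> \<le> K2 * K1" for \<xi> using K nonneg by (intro mult_mono) auto
    then show "\<exists>K. \<forall>\<xi>. h' (y \<xi>) * y' \<xi> \<le> K" by blast
    have "(\<lambda>\<xi>. (h' (y \<xi>) - 1) * y' \<xi> + (y' \<xi> - 1)) \<in> L2"
      by (intro L2_add L2 L2_comp(1)[OF h.L2 K(1)])
    then show "(\<lambda>\<xi>. h' (y \<xi>) * y' \<xi> - 1) \<in> L2" by (simp add: algebra_simps)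
  qed
qed

lemma in_relabG: "y \<in> relabG"
proof -
  interpret i: relab linv "\<lambda>x. 1 / y' (linv x)" by (rule relab_linv)
  have W: "(\<lambda>\<xi>. h \<xi> - \<xi>) \<in> W1inf" if "relab h h'" for h h'
  proof -
    interpret h: relab h h' by fact
    obtain K where K: "\<And>\<xi>. h' \<xi> \<le> K" using h.upper by blast
    obtain C where C: "\<And>\<xi>. \<bar>h \<xi> - \<xi>\<bar> \<le> C" using h.bdd by blast
    have "\<bar>h' \<xi> - 1\<bar> \<le> K + 1" for \<xi> using K[of \<xi>] h.nonneg[of \<xi>] by auto
    then show ?thesis using C by (intro W1infI[OF prim_diff[OF h.prim prim_id]]) auto
  qed
  have "range y = UNIV" "range linv = UNIV"
    using y_linv linv_y by (metis surj_def)+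
  then have "homeomorphism UNIV UNIV y (inv y)"
    unfolding inv_eq homeomorphism_def using cont i.cont by simp
  moreover have "(\<lambda>\<xi>. wderiv y \<xi> - 1) \<in> L2"
    by (rule L2_cong_AE(1)[OF L2])
      (use prim_wderiv(3)[OF prim] primD(2)[OF prim_wderiv(2)[OF prim]] in \<open>auto elim!: eventually_mono\<close>)
  ultimately show ?thesis
    using W[OF relab_axioms] W[OF relab_linv] by (simp add: relabG_def inv_eq)
qed

end

lemma relab_id: "relab (\<lambda>x. x) (\<lambda>x. 1)"
  by unfold_locales (auto simp: prim_id L2_def intro!: exI[of _ "1::real"])

text \<open>Continuity and injectivity leave only monotone maps, and a decreasing one cannot stay
  within bounded distance of the identity. The Lipschitz constant of the inverse bounds the slope of
  \<open>f\<close> from below; subtracting the corresponding linear function before taking the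
  density gives a derivative that is bounded below everywhere.\<close>

lemma relabG_D:
  assumes "f \<in> relabG"
  obtains f' where "relab f f'"
proof -
  have hom: "homeomorphism UNIV UNIV f (inv f)" and W: "(\<lambda>\<xi>. f \<xi> - \<xi>) \<in> W1inf" "(\<lambda>\<xi>. inv f \<xi> - \<xi>) \<in> W1inf"
    and L2: "(\<lambda>\<xi>. wderiv f \<xi> - 1) \<in> L2" using assms by (auto simp: relabG_def)
  have c: "continuous_on UNIV f" "continuous_on UNIV (inv f)" and inv: "\<And>x. inv f (f x) = x" 
    using hom by (auto simp: homeomorphism_def)
  have lip: "\<exists>C. (\<forall>\<xi>. \<bar>h \<xi> - \<xi>\<bar> \<le> C)" "\<exists>K>0. \<forall>a b. a \<le> b \<longrightarrow> \<bar>h b - h a\<bar> \<le> K * (b - a)"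
    if h: "continuous_on UNIV h" "(\<lambda>\<xi>. h \<xi> - \<xi>) \<in> W1inf" for h
  proof -
    have c: "continuous_on UNIV (\<lambda>\<xi>. h \<xi> - \<xi>)" using h by (intro continuous_intros)
    note w = W1infD[OF h(2) c]
    show "\<exists>C. (\<forall>\<xi>. \<bar>h \<xi> - \<xi>\<bar> \<le> C)" using w(2) by blast
    define K where "K = \<bar>norminf (wderiv (\<lambda>\<xi>. h \<xi> - \<xi>))\<bar> + 1"
    have "\<bar>h b - h a\<bar> \<le> K * (b - a)" if "a \<le> b" for a b
    proof -
      have 1: "\<bar>(h b - b) - (h a - a)\<bar> \<le> norminf (wderiv (\<lambda>\<xi>. h \<xi> - \<xi>)) * (b - a)"
        by (rule prim_lipschitz[OF w(1) w(3) that])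
      also have "\<dots> \<le> (K - 1) * (b - a)" using that by (intro mult_right_mono) (auto simp: K_def)
      finally show ?thesis using that by (simp add: algebra_simps abs_le_iff)
    qed
    moreover have "K > 0" by (simp add: K_def)
    ultimately show "\<exists>K>0. \<forall>a b. a \<le> b \<longrightarrow> \<bar>h b - h a\<bar> \<le> K * (b - a)" by blast
  qed
  obtain C where C: "\<And>\<xi>. \<bar>f \<xi> - \<xi>\<bar> \<le> C" using lip(1)[OF c(1) W(1)] by blast
  obtain K where K: "K > 0" "\<And>a b. a \<le> b \<Longrightarrow> \<bar>f b - f a\<bar> \<le> K * (b - a)" using lip(2)[OF c(1) W(1)] by blast
  obtain K2 where K2: "K2 > 0" "\<And>a b. a \<le> b \<Longrightarrow> \<bar>inv f b - inv f a\<bar> \<le> K2 * (b - a)" using lip(2)[OF c(2) W(2)] by blast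
  have "inj_on f UNIV" using inv by (metis injI)
  then have "strict_mono_on UNIV f \<or> strict_antimono_on UNIV f"
    using injective_eq_monotone_map[of UNIV f] c(1) by auto
  moreover have "\<not> strict_antimono_on UNIV f"
  proof
    assume a: "strict_antimono_on UNIV f"
    \<comment> \<open>Chosen so that \<open>f x \<ge> x - C > f 0\<close> although
      \<open>x > 0\<close>.\<close>
    define x where "x = \<bar>f 0\<bar> + \<bar>C\<bar> + 1"
    have "f x < f 0" using a by (auto simp: monotone_on_def x_def)
    moreover have "x - f x \<le> C" using C[of x] by (simp add: abs_le_iff)
    moreover have "f 0 \<le> \<bar>f 0\<bar>" "C \<le> \<bar>C\<bar>" by simp_all
    ultimately show False unfolding x_def by linarith
  qed
  ultimately have "strict_mono_on UNIV f" by blast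
  then have mono: "a \<le> b \<Longrightarrow> f a \<le> f b" for a b
    by (auto simp: monotone_on_def le_less)
  define c0 where "c0 = 1 / K2"
  have c0: "c0 > 0" using K2 by (simp add: c0_def)
  have low: "c0 * (b - a) \<le> f b - f a" if "a \<le> b" for a b
    using K2(2)[OF mono[OF that]] that K2(1) by (simp add: inv c0_def field_simps)
  obtain g where g: "prim (\<lambda>x. f x - c0 * x) g" "\<And>x. 0 \<le> g x" "\<And>x. g x \<le> K"
  proof (rule lipschitz_mono_prim[of "\<lambda>x. f x - c0 * x" K])
    fix a b :: real assume "a \<le> b"
    then show "f a - c0 * a \<le> f b - c0 * b" using low[of a b] by (simp add: algebra_simps)
    have "c0 * a \<le> c0 * b" using c0 \<open>a \<le> b\<close> by simp
    then show "f b - c0 * b - (f a - c0 * a) \<le> K * (b - a)" using K(2)[OF \<open>a \<le> b\<close>] by linarith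
  qed blast
  have p: "prim f (\<lambda>x. g x + c0)"
    using prim_add[OF g(1) prim_cmult[OF prim_id, of c0]] by simp
  have "(\<lambda>x. (g x + c0) - 1) \<in> L2"
    by (rule L2_cong_AE(1)[OF L2]) (use prim_wderiv(3)[OF p] primD(2)[OF p] in \<open>auto elim!: eventually_mono\<close>)
  then have "relab f (\<lambda>x. g x + c0)"
    using p g c0 C by unfold_locales (auto intro: exI[of _ C] exI[of _ c0] exI[of _ "K + c0"] add_nonneg_nonneg)
  then show ?thesis by (rule that)
qed

subsection \<open>Lagrangian states and their flow\<close>

lemma prim_clamp:
  assumes "prim f g" "AE x in lborel. a \<le> g x" "AE x in lborel. g x \<le> b"
  shows "prim f (\<lambda>x. max a (min b (g x)))" "AE x in lborel. max a (min b (g x)) = g x"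
proof -
  have m[measurable]: "g \<in> borel_measurable borel" using primD(2)[OF assms(1)] .
  show *: "AE x in lborel. max a (min b (g x)) = g x" using assms(2,3) by eventually_elim auto
  then have "AE x in lborel. g x = max a (min b (g x))" by eventually_elim simp
  then show "prim f (\<lambda>x. max a (min b (g x)))" by (rule prim_cong_AE[OF assms(1)]) measurable
qed

text \<open>The representatives of the derivatives of \<^term>\<open>y\<close> and \<^term>\<open>H\<close> are nonnegative and bounded
  everywhere rather than almost everywhere, so that they can serve as densities of measures.\<close>

locale lag = incr y y' for y y' +
  fixes U U' H H' r :: "real \<Rightarrow> real"
  assumes pU: "prim U U'" and pH: "prim H H'" and H_nonneg: "\<And>\<xi>. 0 \<le> H' \<xi>"
    and upper_y: "\<exists>K. \<forall>\<xi>. y' \<xi> \<le> K" and upper_H: "\<exists>K. \<forall>\<xi>. H' \<xi> \<le> K"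
    and bdd_U: "\<exists>K. \<forall>\<xi>. \<bar>U \<xi>\<bar> \<le> K" and bdd_H: "\<exists>K. \<forall>\<xi>. \<bar>H \<xi>\<bar> \<le> K"
    and H_bot: "(H \<longlongrightarrow> 0) at_bot"
    and r_meas[measurable]: "r \<in> borel_measurable borel"
    and lower: "\<exists>c>0. AE \<xi> in lborel. c \<le> y' \<xi> + H' \<xi>"
    and rel: "AE \<xi> in lborel. y' \<xi> * H' \<xi> = (U' \<xi>)\<^sup>2 + (r \<xi>)\<^sup>2"
    and L2_y: "(\<lambda>\<xi>. y' \<xi> - 1) \<in> L2"
begin

lemma meas2[measurable]: "U' \<in> borel_measurable borel" "H' \<in> borel_measurable borel"
    "U \<in> borel_measurable borel" "H \<in> borel_measurable borel"
  using primD(2)[OF pU] primD(2)[OF pH] prim_continuous[OF pU] prim_continuous[OF pH]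
  by (auto intro: borel_measurable_continuous_onI)

lemma H_integrable: "integrable lborel H'"
  using bdd_H prim_bounded_integrable[OF pH H_nonneg] by blast

text \<open>\<open>y'\<close> is bounded, so \<open>y' H'\<close> is at most a multiple of
  \<open>H'\<close>, which is integrable and bounded. One inequality thus yields both the square
  integrability and the boundedness of \<open>U'\<close> and \<open>r\<close>.\<close>

lemma U_r_bound:
  obtains K where "AE \<xi> in lborel. (U' \<xi>)\<^sup>2 + (r \<xi>)\<^sup>2 \<le> K * H' \<xi>" "\<And>\<xi>. K * H' \<xi> \<le> K\<^sup>2" "K \<ge> 0"
proof -
  obtain K1 K2 where K: "\<And>\<xi>. y' \<xi> \<le> K1" "\<And>\<xi>. H' \<xi> \<le> K2" using upper_y upper_H by blast
  define K where "K = max (max K1 K2) 0"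
  have le: "y' \<xi> \<le> K" "H' \<xi> \<le> K" for \<xi> using K[of \<xi>] by (auto simp: K_def)
  show ?thesis
  proof (rule that[of K])
    show "AE \<xi> in lborel. (U' \<xi>)\<^sup>2 + (r \<xi>)\<^sup>2 \<le> K * H' \<xi>"
      using rel by eventually_elim (use le H_nonneg in \<open>metis mult_right_mono\<close>)
    show "K \<ge> 0" by (simp add: K_def)
    then show "K * H' \<xi> \<le> K\<^sup>2" for \<xi> unfolding power2_eq_square using le by (intro mult_left_mono)
  qed
qed

lemma L2_U: "U' \<in> L2" and L2_r: "r \<in> L2" and L2_H: "H' \<in> L2"
  and Linf_U: "\<exists>K. AE \<xi> in lborel. \<bar>U' \<xi>\<bar> \<le> K" and Linf_r: "\<exists>K. AE \<xi> in lborel. \<bar>r \<xi>\<bar> \<le> K"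
proof -
  obtain K where K: "AE \<xi> in lborel. (U' \<xi>)\<^sup>2 + (r \<xi>)\<^sup>2 \<le> K * H' \<xi>" "\<And>\<xi>. K * H' \<xi> \<le> K\<^sup>2" "K \<ge> 0"
    using U_r_bound by blast
  have i: "integrable lborel (\<lambda>\<xi>. K * H' \<xi>)" using H_integrable by simp
  show "U' \<in> L2"
    by (rule L2_bound[OF _ i]) (use K(1) in \<open>auto elim!: eventually_mono intro: order_trans[rotated]\<close>)
  show "r \<in> L2"
    by (rule L2_bound[OF _ i]) (use K(1) in \<open>auto elim!: eventually_mono intro: order_trans[rotated]\<close>)
  have ab: "\<bar>a\<bar> \<le> K" if "a\<^sup>2 + b\<^sup>2 \<le> K * H' \<xi>" for a b \<xi>
  proof -
    have "a\<^sup>2 \<le> K\<^sup>2" using that K(2)[of \<xi>] zero_le_power2[of b] by linarith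
    then show ?thesis using K(3) abs_le_square_iff[of a K] by simp
  qed
  have "AE \<xi> in lborel. \<bar>U' \<xi>\<bar> \<le> K" using K(1) by eventually_elim (rule ab)
  then show "\<exists>K. AE \<xi> in lborel. \<bar>U' \<xi>\<bar> \<le> K" by blast
  have "AE \<xi> in lborel. \<bar>r \<xi>\<bar> \<le> K" using K(1)
  proof eventually_elim
    case (elim \<xi>) then show ?case using ab[of "r \<xi>" "U' \<xi>" \<xi>] by (simp add: add.commute)
  qed
  then show "\<exists>K. AE \<xi> in lborel. \<bar>r \<xi>\<bar> \<le> K" by blast
  obtain K2 where K2: "\<And>\<xi>. H' \<xi> \<le> K2" using upper_H by blast
  show "H' \<in> L2"
    by (rule L2_bound[of _ "\<lambda>\<xi>. K2 * H' \<xi>"])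
      (use H_integrable K2 H_nonneg in \<open>auto simp: power2_eq_square intro: mult_right_mono\<close>)
qed

lemma H_mono: "a \<le> b \<Longrightarrow> H a \<le> H b"
proof -
  assume ab: "a \<le> b"
  have "0 \<le> (LINT x:{a..b}|lborel. H' x)"
    unfolding set_lebesgue_integral_def using H_nonneg by (intro integral_nonneg_AE) auto
  then show ?thesis using primD(4)[OF pH ab] by simp
qed

lemma H_lim: "(H \<longlongrightarrow> Lim at_top H) at_top"
proof -
  obtain K where K: "\<And>\<xi>. \<bar>H \<xi>\<bar> \<le> K" using bdd_H by blast
  have bd: "bdd_above (range H)" using K by (auto intro!: bdd_aboveI[of _ K] simp: abs_le_iff)
  have "(H \<longlongrightarrow> Sup (range H)) at_top"
  proof (rule increasing_tendsto)
    show "\<forall>\<^sub>F x in at_top. H x \<le> Sup (range H)" using bd by (auto intro!: always_eventually cSup_upper)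
    fix z assume "z < Sup (range H)"
    then obtain x0 where "z < H x0" using less_cSup_iff[of "range H" z] bd by auto
    then show "\<forall>\<^sub>F x in at_top. z < H x"
      by (intro eventually_at_top_linorderI[of x0]) (use H_mono in \<open>blast intro: less_le_trans\<close>)
  qed
  then show ?thesis using tendsto_Lim[of at_top H] by simp
qed

lemma in_spaceB: "(\<lambda>\<xi>. y \<xi> - \<xi>) \<in> E2" "U \<in> E2" "H \<in> E1"
proof -
  show "(\<lambda>\<xi>. y \<xi> - \<xi>) \<in> E2" using bdd E2I[OF prim_diff[OF prim prim_id] _ L2_y] by blast
  show "U \<in> E2" using bdd_U E2I[OF pU _ L2_U] by blast
  show "H \<in> E1" using bdd_H E2I[OF pH _ L2_H] H_bot by (auto simp: E1_def)
qed

lemma in_Lag: "(y, U, H, r) \<in> Lag"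
proof -
  obtain c where c: "c > 0" "AE \<xi> in lborel. c \<le> y' \<xi> + H' \<xi>" using lower by blast
  obtain K1 where K1: "\<And>\<xi>. y' \<xi> \<le> K1" using upper_y by blast
  obtain K2 where K2: "\<And>\<xi>. H' \<xi> \<le> K2" using upper_H by blast
  obtain K3 where K3: "AE \<xi> in lborel. \<bar>U' \<xi>\<bar> \<le> K3" using Linf_U by blast
  obtain K4 where K4: "AE \<xi> in lborel. \<bar>r \<xi>\<bar> \<le> K4" using Linf_r by blast
  have y1: "\<bar>y' \<xi> - 1\<bar> \<le> K1 + 1" for \<xi> using K1[of \<xi>] nonneg[of \<xi>] by auto
  have W: "(\<lambda>\<xi>. y \<xi> - \<xi>) \<in> W1inf" "U \<in> W1inf" "H \<in> W1inf"
    using bdd bdd_U bdd_H y1 K2 H_nonneg K3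
    by (blast intro: W1infI[OF prim_diff[OF prim prim_id], where K'="K1 + 1"] W1infI[OF pU] AE_I2,
        blast intro: W1infI[OF pU], 
        auto intro!: W1infI[OF pH, where K'=K2])
  have "r \<in> Linf" using K4 by (intro LinfI) auto
  moreover have "AE \<xi> in lborel. wderiv y \<xi> \<ge> 0 \<and> wderiv H \<xi> \<ge> 0 \<and> wderiv y \<xi> + wderiv H \<xi> \<ge> c"
    using prim_wderiv(3)[OF prim] prim_wderiv(3)[OF pH] c(2)
    by eventually_elim (use nonneg H_nonneg in auto)
  moreover have "AE \<xi> in lborel. wderiv y \<xi> * wderiv H \<xi> = (wderiv U \<xi>)\<^sup>2 + (r \<xi>)\<^sup>2"
    using prim_wderiv(3)[OF prim] prim_wderiv(3)[OF pH] prim_wderiv(3)[OF pU] rel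
    by eventually_elim simp
  ultimately show ?thesis
    using W in_spaceB L2_r c(1) by (auto simp: Lag_def spaceB_def)
qed

text \<open>The bound \<open>\<kappa>\<close> is kept explicit and made to hold everywhere, because
  it becomes the slope that enters the Lipschitz constant.\<close>

lemma relab_sum:
  assumes "\<kappa> > 0" "AE \<xi> in lborel. \<kappa> \<le> y' \<xi> + H' \<xi>"
  obtains q' where "relab (\<lambda>\<xi>. y \<xi> + H \<xi>) q'" "AE \<xi> in lborel. q' \<xi> = y' \<xi> + H' \<xi>" "\<And>\<xi>. \<kappa> \<le> q' \<xi>"
proof -
  obtain K1 where K1: "\<And>\<xi>. y' \<xi> \<le> K1" using upper_y by blast
  obtain K2 where K2: "\<And>\<xi>. H' \<xi> \<le> K2" using upper_H by blast
  define q' where "q' \<xi> = max \<kappa> (min (K1 + K2) (y' \<xi> + H' \<xi>))" for \<xi>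
  have le: "AE \<xi> in lborel. y' \<xi> + H' \<xi> \<le> K1 + K2" using K1 K2 by (auto intro: add_mono)
  note q = prim_clamp[OF prim_add[OF prim pH] assms(2) le, folded q'_def]
  have b: "\<kappa> \<le> q' \<xi>" "q' \<xi> \<le> max \<kappa> (K1 + K2)" for \<xi> by (auto simp: q'_def)
  obtain C1 C2 where C: "\<And>\<xi>. \<bar>y \<xi> - \<xi>\<bar> \<le> C1" "\<And>\<xi>. \<bar>H \<xi>\<bar> \<le> C2" using bdd bdd_H by blast
  have bd: "\<bar>y \<xi> + H \<xi> - \<xi>\<bar> \<le> C1 + C2" for \<xi> using C[of \<xi>] by linarith
  have "AE \<xi> in lborel. (y' \<xi> - 1) + H' \<xi> = q' \<xi> - 1" using q(2) by eventually_elim simp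
  from L2_cong_AE(1)[OF L2_add[OF L2_y L2_H] this]
  have l2: "(\<lambda>\<xi>. q' \<xi> - 1) \<in> L2" using primD(2)[OF q(1)] by measurable
  have "relab (\<lambda>\<xi>. y \<xi> + H \<xi>) q'"
    using q(1) b bd assms(1) l2 by unfold_locales (auto intro: less_imp_le[OF less_le_trans])
  then show ?thesis using that q(2) b(1) by blast
qed

end

text \<open>Signs and bounds of derivatives that come from \<open>wderiv\<close> or from the flow
  hold only almost everywhere; truncation to the known range produces the pointwise ones that
  \<open>lag\<close> demands.\<close>

lemma lag_clamp:
  assumes py: "prim y v" "AE \<xi> in lborel. 0 \<le> v \<xi>" "\<exists>K. AE \<xi> in lborel. v \<xi> \<le> K" "\<exists>C. \<forall>\<xi>. \<bar>y \<xi> - \<xi>\<bar> \<le> C"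
    and pH: "prim H w" "AE \<xi> in lborel. 0 \<le> w \<xi>" "\<exists>K. AE \<xi> in lborel. w \<xi> \<le> K" "\<exists>C. \<forall>\<xi>. \<bar>H \<xi>\<bar> \<le> C" "(H \<longlongrightarrow> 0) at_bot"
    and pU: "prim U U'" "\<exists>C. \<forall>\<xi>. \<bar>U \<xi>\<bar> \<le> C"
    and r: "r \<in> borel_measurable borel"
    and c: "\<exists>c>0. AE \<xi> in lborel. c \<le> v \<xi> + w \<xi>"
    and rel: "AE \<xi> in lborel. v \<xi> * w \<xi> = (U' \<xi>)\<^sup>2 + (r \<xi>)\<^sup>2"
    and L2: "(\<lambda>\<xi>. v \<xi> - 1) \<in> L2"
  obtains y' H' where "lag y y' U U' H H' r" "AE \<xi> in lborel. y' \<xi> = v \<xi>" "AE \<xi> in lborel. H' \<xi> = w \<xi>"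
proof -
  obtain K1 where K1: "AE \<xi> in lborel. v \<xi> \<le> K1" using py by blast
  obtain K2 where K2: "AE \<xi> in lborel. w \<xi> \<le> K2" using pH by blast
  define y' where "y' \<xi> = max 0 (min K1 (v \<xi>))" for \<xi>
  define H' where "H' \<xi> = max 0 (min K2 (w \<xi>))" for \<xi>
  note y' = prim_clamp[OF py(1,2) K1, folded y'_def]
  note H' = prim_clamp[OF pH(1,2) K2, folded H'_def]
  have b: "0 \<le> y' \<xi>" "y' \<xi> \<le> max 0 K1" "0 \<le> H' \<xi>" "H' \<xi> \<le> max 0 K2" for \<xi> by (auto simp: y'_def H'_def)
  have "AE \<xi> in lborel. v \<xi> - 1 = y' \<xi> - 1" using y'(2) by eventually_elim simp
  from L2_cong_AE(1)[OF L2 this] have l2: "(\<lambda>\<xi>. y' \<xi> - 1) \<in> L2" using primD(2)[OF y'(1)] by measurable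
  obtain c where c: "c > 0" "AE \<xi> in lborel. c \<le> v \<xi> + w \<xi>" using c by blast
  have c': "AE \<xi> in lborel. c \<le> y' \<xi> + H' \<xi>" using y'(2) H'(2) c(2) by eventually_elim simp
  have rel': "AE \<xi> in lborel. y' \<xi> * H' \<xi> = (U' \<xi>)\<^sup>2 + (r \<xi>)\<^sup>2" using y'(2) H'(2) rel by eventually_elim simp
  have "lag y y' U U' H H' r"
    by unfold_locales (use y'(1) H'(1) b l2 c(1) c' rel' py pH pU r in blast)+
  then show ?thesis using that y'(2) H'(2) by blast
qed

lemma Lag_D:
  assumes "(y, U, H, r) \<in> Lag"
  obtains y' U' H' where "lag y y' U U' H H' r"
proof -
  from assms obtain c where E: "(\<lambda>\<xi>. y \<xi> - \<xi>) \<in> E2" "U \<in> E2" "H \<in> E1" "r \<in> L2" and c: "c > 0"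
    and W: "(\<lambda>\<xi>. y \<xi> - \<xi>) \<in> W1inf" "U \<in> W1inf" "H \<in> W1inf" "r \<in> Linf"
    and a: "AE \<xi> in lborel. wderiv y \<xi> \<ge> 0 \<and> wderiv H \<xi> \<ge> 0 \<and> wderiv y \<xi> + wderiv H \<xi> \<ge> c"
    and rel: "AE \<xi> in lborel. wderiv y \<xi> * wderiv H \<xi> = (wderiv U \<xi>)\<^sup>2 + (r \<xi>)\<^sup>2"
    by (auto simp: Lag_def spaceB_def)
  have H2: "H \<in> E2" "(H \<longlongrightarrow> 0) at_bot" using E(3) by (auto simp: E1_def)
  note w = E2D[OF E(1)]
  have py: "prim y (\<lambda>\<xi>. wderiv (\<lambda>\<xi>. y \<xi> - \<xi>) \<xi> + 1)" using prim_add[OF w(1) prim_id] by simp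
  note y = prim_wderiv[OF py]
  have l2: "(\<lambda>\<xi>. wderiv y \<xi> - 1) \<in> L2"
    by (rule L2_cong_AE(1)[OF w(2)]) (use y(3) primD(2)[OF y(2)] in \<open>auto elim!: eventually_mono\<close>)
  have Ky: "AE \<xi> in lborel. wderiv y \<xi> \<le> norminf (wderiv (\<lambda>\<xi>. y \<xi> - \<xi>)) + 1"
    using y(3) W1infD(3)[OF W(1) w(4)] by eventually_elim auto
  have KH: "AE \<xi> in lborel. wderiv H \<xi> \<le> norminf (wderiv H)"
    using W1infD(3)[OF W(3) E2D(4)[OF H2(1)]] by eventually_elim auto
  show ?thesis
  proof (rule lag_clamp[of y "wderiv y" H "wderiv H" U "wderiv U" r])
    show "AE \<xi> in lborel. 0 \<le> wderiv y \<xi>" "AE \<xi> in lborel. 0 \<le> wderiv H \<xi>" 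
      "\<exists>c>0. AE \<xi> in lborel. c \<le> wderiv y \<xi> + wderiv H \<xi>"
      using a c by (auto elim!: eventually_mono)
    show "r \<in> borel_measurable borel" using E(4) by (simp add: L2_def)
  qed (use y(2) Ky KH H2 E2D[OF H2(1)] E2D[OF E(2)] w(3) rel l2 that in blast)+
qed

text \<open>Positivity of a quadratic form in \<open>(sqrt a, sqrt b)\<close>; the condition on its discriminant is
  \<open>t / 2 \<le> exp (t / 2) - exp (- t / 2)\<close>.\<close>

lemma flow_lower_bound:
  fixes a b u t :: real
  assumes "0 \<le> a" "0 \<le> b" "u\<^sup>2 \<le> a * b" "0 \<le> t"
  shows "exp (-t) * (a + b) \<le> a + u * t + b * t\<^sup>2 / 4 + b"
proof -
  define k where "k = exp (-t)"
  have k: "0 < k" "k \<le> 1" using assms(4) by (auto simp: k_def)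
  define A B where "A = 1 - k" and "B = 1 + t\<^sup>2 / 4 - k"
  have A: "0 \<le> A" "0 \<le> B" using k zero_le_power2[of t] unfolding A_def B_def by linarith+
  \<comment> \<open>With \<open>k = exp (-t)\<close> the claim is
    \<open>(1 - k)\<^sup>2 \<ge> k * t\<^sup>2 / 4\<close>; divided by \<open>k\<close> it compares
    \<open>(t/2)\<^sup>2\<close> with
    \<open>exp t + exp (-t) - 2 = (exp (t/2) - exp (-t/2))\<^sup>2\<close>.\<close>
  have AB: "t\<^sup>2 / 4 \<le> A * B"
  proof -
    have "1 + t / 2 \<le> exp (t / 2)" "exp (- (t/2)) \<le> 1" using assms(4) by auto
    then have "t / 2 \<le> exp (t / 2) - exp (- (t/2))" by linarith
    then have "(t / 2)\<^sup>2 \<le> (exp (t / 2) - exp (- (t/2)))\<^sup>2" using assms(4) by (intro power_mono) auto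
    also have "\<dots> = exp (t / 2 + t / 2) + exp (- (t / 2) + - (t / 2)) - 2 * exp (t / 2 + - (t / 2))"
      unfolding exp_add by (simp add: power2_eq_square algebra_simps)
    also have "\<dots> = exp t + k - 2" by (simp add: k_def)
    finally have "(t / 2)\<^sup>2 * k \<le> (exp t + k - 2) * k" using k by (intro mult_right_mono) auto
    also have "\<dots> = 1 + k\<^sup>2 - 2 * k" by (simp add: k_def power2_eq_square algebra_simps mult_exp_exp)
    finally show ?thesis unfolding A_def B_def by (simp add: power2_eq_square algebra_simps diff_divide_distrib)
  qed
  have "(u * t)\<^sup>2 \<le> (A * a + B * b)\<^sup>2"
  proof -
    have "(u * t)\<^sup>2 = u\<^sup>2 * t\<^sup>2" by (simp add: power_mult_distrib)
    also have "\<dots> \<le> (a * b) * (4 * (A * B))" using assms AB by (intro mult_mono) auto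
    also have "\<dots> \<le> (A * a + B * b)\<^sup>2"
      using zero_le_power2[of "A * a - B * b"] by (simp add: power2_eq_square algebra_simps)
    finally show ?thesis .
  qed
  then have "\<bar>u * t\<bar> \<le> \<bar>A * a + B * b\<bar>" using abs_le_square_iff by blast
  then have "- (u * t) \<le> A * a + B * b" using A assms by (simp add: abs_le_iff)
  then show ?thesis by (simp add: A_def B_def k_def[symmetric] algebra_simps)
qed

section \<open>The flow of a Lagrangian state\<close>

context lag
begin

definition y_flow :: "real \<Rightarrow> real \<Rightarrow> real" where
  "y_flow t \<xi> = 1/4 * (H \<xi> - 1/2 * Lim at_top H) * t\<^sup>2 + U \<xi> * t + y \<xi>"

definition U_flow :: "real \<Rightarrow> real \<Rightarrow> real" where
  "U_flow t \<xi> = 1/2 * (H \<xi> - 1/2 * Lim at_top H) * t + U \<xi>"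

lemma flowS_eq: "flowS t (y, U, H, r) = (y_flow t, U_flow t, H, r)"
  by (simp add: Let_def y_flow_def[abs_def] U_flow_def[abs_def])

lemma U_le: "AE \<xi> in lborel. (U' \<xi>)\<^sup>2 \<le> y' \<xi> * H' \<xi>"
  using rel by eventually_elim simp

text \<open>The energy relation persists because both sides gain the same terms
  \<open>t\<^sup>2/4 * H'\<^sup>2 + t * U' * H'\<close>. It also gives the sign of the new
  \<open>y'\<close>: where \<open>H'\<close> is positive, divide the relation by it; where
  \<open>H'\<close> is zero, so is \<open>U'\<close>, and \<open>y'\<close> is unchanged.
  \<open>Ht'\<close> is another representative of the derivative of the unchanged
  \<open>H\<close>.\<close>

lemma flow_lag:
  assumes t: "t \<ge> 0"
  obtains yt' Ut' Ht' where "lag (y_flow t) yt' (U_flow t) Ut' H Ht' r"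
    "AE \<xi> in lborel. exp (-t) * (y' \<xi> + H' \<xi>) \<le> yt' \<xi> + Ht' \<xi>"
proof -
  define L where "L = Lim at_top H"
  let ?v = "\<lambda>\<xi>. t\<^sup>2/4 * H' \<xi> + t * U' \<xi> + y' \<xi>"
  let ?w = "\<lambda>\<xi>. t/2 * H' \<xi> + U' \<xi>"
  have pv: "prim (y_flow t) ?v"
  proof -
    have "prim (\<lambda>\<xi>. t\<^sup>2/4 * (H \<xi> - 1/2 * L) + t * U \<xi> + y \<xi>) (\<lambda>\<xi>. t\<^sup>2/4 * (H' \<xi> - 0) + t * U' \<xi> + y' \<xi>)"
      by (intro prim_add prim_cmult prim_diff prim_const pH pU prim)
    then show ?thesis by (simp add: y_flow_def[abs_def] L_def[symmetric] mult_ac)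
  qed
  have pw: "prim (U_flow t) ?w"
  proof -
    have "prim (\<lambda>\<xi>. t/2 * (H \<xi> - 1/2 * L) + U \<xi>) (\<lambda>\<xi>. t/2 * (H' \<xi> - 0) + U' \<xi>)"
      by (intro prim_add prim_cmult prim_diff prim_const pH pU prim)
    then show ?thesis by (simp add: U_flow_def[abs_def] L_def[symmetric] mult_ac)
  qed
  obtain C1 where C1: "\<And>\<xi>. \<bar>y \<xi> - \<xi>\<bar> \<le> C1" using bdd by blast
  obtain C2 where C2: "\<And>\<xi>. \<bar>U \<xi>\<bar> \<le> C2" using bdd_U by blast
  obtain C3 where C3: "\<And>\<xi>. \<bar>H \<xi>\<bar> \<le> C3" using bdd_H by blast
  have HL: "\<bar>H \<xi> - 1/2 * L\<bar> \<le> C3 + \<bar>L\<bar>" for \<xi> using C3[of \<xi>] by linarith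
  have b_y: "\<bar>y_flow t \<xi> - \<xi>\<bar> \<le> t\<^sup>2/4 * (C3 + \<bar>L\<bar>) + t * C2 + C1" for \<xi>
  proof -
    have "\<bar>y_flow t \<xi> - \<xi>\<bar> \<le> \<bar>t\<^sup>2/4 * (H \<xi> - 1/2 * L)\<bar> + \<bar>t * U \<xi>\<bar> + \<bar>y \<xi> - \<xi>\<bar>"
      unfolding y_flow_def L_def[symmetric] by (simp add: mult_ac)
    also have "\<dots> \<le> t\<^sup>2/4 * (C3 + \<bar>L\<bar>) + t * C2 + C1"
      unfolding abs_mult using HL C1 C2 t by (intro add_mono mult_mono) auto
    finally show ?thesis .
  qed
  have bU: "\<bar>U_flow t \<xi>\<bar> \<le> t/2 * (C3 + \<bar>L\<bar>) + C2" for \<xi>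
  proof -
    have "\<bar>U_flow t \<xi>\<bar> \<le> \<bar>t/2 * (H \<xi> - 1/2 * L)\<bar> + \<bar>U \<xi>\<bar>"
      using abs_triangle_ineq[of "t/2 * (H \<xi> - 1/2 * L)" "U \<xi>"]
      unfolding U_flow_def L_def[symmetric] by (simp add: mult_ac)
    also have "\<dots> \<le> t/2 * (C3 + \<bar>L\<bar>) + C2"
      unfolding abs_mult using HL C2 t by (intro add_mono mult_mono) auto
    finally show ?thesis .
  qed
  have low: "AE \<xi> in lborel. exp (-t) * (y' \<xi> + H' \<xi>) \<le> ?v \<xi> + H' \<xi>"
    using U_le
  proof eventually_elim
    case (elim \<xi>)
    then show ?case using flow_lower_bound[OF nonneg H_nonneg elim t] by (simp add: mult_ac add_ac)
  qed
  have rel': "AE \<xi> in lborel. ?v \<xi> * H' \<xi> = (?w \<xi>)\<^sup>2 + (r \<xi>)\<^sup>2"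
    using rel by eventually_elim (simp add: power2_eq_square algebra_simps)
  have v0: "AE \<xi> in lborel. 0 \<le> ?v \<xi>"
    using U_le rel'
  proof eventually_elim
    case (elim \<xi>)
    show ?case
    proof (cases "H' \<xi> = 0")
      case True
      then show ?thesis using elim(1) nonneg[of \<xi>] by simp
    next
      case False
      then have "H' \<xi> > 0" using H_nonneg[of \<xi>] by simp
      moreover have "0 \<le> ?v \<xi> * H' \<xi>" unfolding elim(2) by simp
      ultimately show ?thesis using zero_le_mult_iff[of "?v \<xi>" "H' \<xi>"] by auto
    qed
  qed
  obtain K1 where K1: "\<And>\<xi>. y' \<xi> \<le> K1" using upper_y by blast
  obtain K2 where K2: "\<And>\<xi>. H' \<xi> \<le> K2" using upper_H by blast
  obtain K3 where K3: "AE \<xi> in lborel. \<bar>U' \<xi>\<bar> \<le> K3" using Linf_U by blast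
  have vK: "AE \<xi> in lborel. ?v \<xi> \<le> t\<^sup>2/4 * K2 + t * K3 + K1"
    using K3 by eventually_elim (use K1 K2 t in \<open>auto intro!: add_mono mult_left_mono simp: abs_le_iff\<close>)
  obtain c where c: "c > 0" "AE \<xi> in lborel. c \<le> y' \<xi> + H' \<xi>" using lower by blast
  have c': "AE \<xi> in lborel. exp (-t) * c \<le> ?v \<xi> + H' \<xi>"
    using low c(2)
  proof eventually_elim
    case (elim \<xi>)
    have "exp (-t) * c \<le> exp (-t) * (y' \<xi> + H' \<xi>)" using elim(2) by (intro mult_left_mono) auto
    then show ?case using elim(1) by linarith
  qed
  have c'': "\<exists>c>0. AE \<xi> in lborel. c \<le> ?v \<xi> + H' \<xi>"
    using c' c(1) by (intro exI[of _ "exp (-t) * c"]) auto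
  have "(\<lambda>\<xi>. t\<^sup>2/4 * H' \<xi> + t * U' \<xi> + (y' \<xi> - 1)) \<in> L2"
    by (intro L2_add L2_cmult L2_H L2_U L2_y)
  then have l2: "(\<lambda>\<xi>. ?v \<xi> - 1) \<in> L2" by (simp add: algebra_simps)
  obtain yt' Ht' where *: "lag (y_flow t) yt' (U_flow t) ?w H Ht' r" 
    "AE \<xi> in lborel. yt' \<xi> = ?v \<xi>" "AE \<xi> in lborel. Ht' \<xi> = H' \<xi>"
  proof (rule lag_clamp[of "y_flow t" ?v H H' "U_flow t" ?w r])
    show "AE \<xi> in lborel. 0 \<le> H' \<xi>" "\<exists>K. AE \<xi> in lborel. H' \<xi> \<le> K" using H_nonneg K2 by auto
  qed (use pv v0 vK b_y pH bdd_H H_bot pw bU c'' rel' l2 r_meas in blast)+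
  have "AE \<xi> in lborel. exp (-t) * (y' \<xi> + H' \<xi>) \<le> yt' \<xi> + Ht' \<xi>"
    using low *(2,3) by eventually_elim simp
  then show ?thesis using that *(1) by blast
qed

end

subsection \<open>From Eulerian to Lagrangian coordinates\<close>

text \<open>\<open>F\<close> is left-continuous with slope at least 1 and jumps at the atoms of
  \<open>\<mu>\<close>; \<open>y\<close> is its generalised inverse, hence 1-Lipschitz and constant
  across the jumps.\<close>

locale cumulative =
  fixes \<mu> :: "real measure"
  assumes sets_\<mu>: "sets \<mu> = sets borel" and fin: "finite_measure \<mu>"
begin

sublocale finite_measure \<mu> by (rule fin)

lemma space_\<mu>: "space \<mu> = UNIV"
  using sets_eq_imp_space_eq[OF sets_\<mu>] by simp

lemma meas_\<mu>[measurable_cong]: "sets \<mu> = sets borel" by (rule sets_\<mu>)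

definition F :: "real \<Rightarrow> real" where "F x = measure \<mu> {..<x} + x"

definition y :: "real \<Rightarrow> real" where "y \<xi> = Sup {x. measure \<mu> {..<x} + x < \<xi>}"

definition M :: real where "M = measure \<mu> UNIV"

lemma m_bounds: "0 \<le> measure \<mu> {..<x}" "measure \<mu> {..<x} \<le> M"
  unfolding M_def by (auto intro!: finite_measure_mono simp: sets_\<mu>)

lemma F_mono: "a \<le> b \<Longrightarrow> b - a \<le> F b - F a"
  unfolding F_def using finite_measure_mono[of "{..<a}" "{..<b}"] by (auto simp: sets_\<mu>)

lemma F_less_iff: "F a < F b \<longleftrightarrow> a < b"
  using F_mono[of a b] F_mono[of b a] by (cases "a < b") auto

lemma F_bounds: "x \<le> F x" "F x \<le> x + M"
  using m_bounds[of x] by (auto simp: F_def)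

lemma y_eq: "y \<xi> = Sup {x. F x < \<xi>}"
  by (simp add: y_def F_def)

lemma y_upper: "F x < \<xi> \<Longrightarrow> x \<le> y \<xi>"
  unfolding y_eq using F_bounds(1)
  by (intro cSup_upper) (auto intro!: bdd_aboveI[of _ \<xi>] intro: less_imp_le le_less_trans)

lemma y_least:
  assumes "\<And>x. F x < \<xi> \<Longrightarrow> x \<le> z"
  shows "y \<xi> \<le> z"
proof -
  have "F (\<xi> - M - 1) < \<xi>" using F_bounds(2)[of "\<xi> - M - 1"] by simp
  then have "{x. F x < \<xi>} \<noteq> {}" by blast
  then show ?thesis unfolding y_eq using assms by (intro cSup_least) auto
qed

lemma y_bounds: "\<xi> - M \<le> y \<xi>" "y \<xi> \<le> \<xi>"
proof -
  show "y \<xi> \<le> \<xi>" using F_bounds(1) by (intro y_least) (meson le_less_trans less_imp_le)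
  show "\<xi> - M \<le> y \<xi>"
  proof (rule dense_le)
    fix x assume "x < \<xi> - M"
    then show "x \<le> y \<xi>" using F_bounds(2)[of x] by (intro y_upper) simp
  qed
qed

lemma y_mono: "a \<le> b \<Longrightarrow> y a \<le> y b"
  by (rule y_least) (auto intro: y_upper)

lemma y_lipschitz: "a \<le> b \<Longrightarrow> y b - y a \<le> b - a"
proof -
  assume ab: "a \<le> b"
  have "y b \<le> y a + (b - a)"
  proof (rule y_least)
    fix x assume "F x < b"
    then have "F (x - (b - a)) < a" using F_mono[of "x - (b - a)" x] ab by simp
    then show "x \<le> y a + (b - a)" using y_upper by fastforce
  qed
  then show ?thesis by simp
qed

lemma F_left_cont:
  assumes "\<xi> < F x"
  obtains z where "z < x" "\<xi> < F z"
proof -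
  let ?x = "\<lambda>n. x - 1 / real (Suc n)"
  have "(\<lambda>n. measure \<mu> {..<?x n}) \<longlonglongrightarrow> measure \<mu> (\<Union>n. {..<?x n})"
  proof (rule finite_Lim_measure_incseq)
    show "incseq (\<lambda>n. {..<?x n})"
    proof (rule incseq_SucI)
      fix n
      have "1 / real (Suc (Suc n)) \<le> 1 / real (Suc n)" by (intro divide_left_mono) auto
      then show "{..<?x n} \<subseteq> {..<?x (Suc n)}" by (auto simp del: of_nat_Suc)
    qed
  qed (auto simp: sets_\<mu>)
  also have "(\<Union>n. {..<?x n}) = {..<x}"
  proof safe
    fix z n assume "z < ?x n"
    moreover have "0 < 1 / real (Suc n)" by simp
    ultimately show "z < x" by linarith
  next
    fix z assume "z < x"
    then obtain n where "1 / real (Suc n) < x - z" using nat_approx_posE[of "x - z"] by auto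
    then show "z \<in> (\<Union>n. {..<?x n})" by (intro UN_I[of n]) auto
  qed
  finally have "(\<lambda>n. F (?x n)) \<longlonglongrightarrow> measure \<mu> {..<x} + (x - 0)"
    unfolding F_def by (intro tendsto_add tendsto_diff tendsto_const LIMSEQ_inverse_real_of_nat[unfolded inverse_eq_divide])
  then have "\<forall>\<^sub>F n in sequentially. \<xi> < F (?x n)"
    using assms by (intro order_tendstoD(1)) (auto simp: F_def)
  then obtain n where "\<xi> < F (?x n)" using eventually_sequentially by auto
  then show ?thesis using that[of "?x n"] by simp
qed

text \<open>The direction from \<open>F\<close> to \<open>y\<close> is where left-continuity enters,
  that is, the evaluation of \<open>\<mu>\<close> on open half-lines. As a result \<open>y\<close>
  pulls open half-lines back to open half-lines.\<close>

lemma y_less_iff: "y \<xi> < x \<longleftrightarrow> \<xi> < F x"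
proof
  assume "y \<xi> < x"
  then obtain z where z: "y \<xi> < z" "z < x" using dense by blast
  then have "\<xi> \<le> F z" using y_upper[of z \<xi>] by linarith
  then show "\<xi> < F x" using F_less_iff[of z x] z by linarith
next
  assume "\<xi> < F x"
  then obtain z where z: "z < x" "\<xi> < F z" using F_left_cont by blast
  have "y \<xi> \<le> z"
    by (rule y_least) (use z(2) F_less_iff in \<open>meson less_imp_le less_trans\<close>)
  then show "y \<xi> < x" using z by simp
qed

lemma y_F: "y (F x) = x"
proof (rule antisym)
  show "y (F x) \<le> x"
  proof (rule dense_ge)
    fix z assume "x < z"
    then show "y (F x) \<le> z" using y_less_iff[of "F x" z] F_less_iff[of x z] by simp
  qed
  show "x \<le> y (F x)" using y_less_iff[of "F x" x] by simp
qed

lemma H_bot: "((\<lambda>\<xi>. \<xi> - y \<xi>) \<longlongrightarrow> 0) at_bot"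
proof (rule tendstoI)
  fix e :: real assume e: "0 < e"
  have "(\<lambda>n. measure \<mu> {..<- real n}) \<longlonglongrightarrow> measure \<mu> (\<Inter>n. {..<- real n})"
    by (rule finite_Lim_measure_decseq) (auto simp: sets_\<mu> decseq_def)
  also have "(\<Inter>n. {..<- real n}) = {}"
  proof safe
    fix x assume "x \<in> (\<Inter>n. {..<- real n})"
    moreover obtain n where "- x < real n" using reals_Archimedean2 by blast
    ultimately show "x \<in> {}" by (auto dest!: spec[of _ n])
  qed
  finally have "\<forall>\<^sub>F n in sequentially. measure \<mu> {..<- real n} < e / 2"
    using e by (intro order_tendstoD(2)) auto
  then obtain n where n: "measure \<mu> {..<- real n} < e / 2" using eventually_sequentially by auto
  show "\<forall>\<^sub>F \<xi> in at_bot. dist (\<xi> - y \<xi>) 0 < e"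
    unfolding eventually_at_bot_linorder
  proof (intro exI allI impI)
    \<comment> \<open>Since \<open>y \<xi> \<le> \<xi>\<close>, this threshold puts
      \<open>y \<xi> + e / 2\<close> to the left of \<open>- real n\<close>, where less than
      \<open>e / 2\<close> of the mass lies; the shift costs the other half.\<close>
    fix \<xi> assume \<xi>: "\<xi> \<le> - real n - e / 2"
    let ?x = "y \<xi> + e / 2"
    have "y \<xi> < ?x" using e by simp
    then have "\<xi> < measure \<mu> {..<?x} + ?x" using y_less_iff F_def by metis
    moreover have "measure \<mu> {..<?x} \<le> measure \<mu> {..<- real n}"
      using \<xi> y_bounds(2)[of \<xi>] by (intro finite_measure_mono) (auto simp: sets_\<mu>)
    ultimately show "dist (\<xi> - y \<xi>) 0 < e"
      using n y_bounds(2)[of \<xi>] by (simp add: dist_real_def)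
  qed
qed

lemma H_bounds: "0 \<le> \<xi> - y \<xi>" "\<xi> - y \<xi> \<le> M"
  using y_bounds[of \<xi>] by auto

text \<open>It suffices to look at half-lines: \<open>y \<xi> < x\<close> means
  \<open>\<xi> < F x\<close>, and the mass to the left of \<open>F x\<close> is the value of
  \<open>\<xi> - y \<xi>\<close> at \<open>F x\<close>, which is \<open>F x - x\<close>.\<close>

lemma pushforward_H:
  assumes y': "prim y y'" "\<And>\<xi>. y' \<xi> \<le> 1"
  shows "distr (density lborel (\<lambda>\<xi>. ennreal (1 - y' \<xi>))) borel y = \<mu>"
proof -
  have [measurable]: "y \<in> borel_measurable borel" "y' \<in> borel_measurable borel"
    using prim_continuous[OF y'(1)] primD(2)[OF y'(1)] by (auto intro: borel_measurable_continuous_onI)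
  let ?D = "distr (density lborel (\<lambda>\<xi>. ennreal (1 - y' \<xi>))) borel y"
  have lt: "emeasure ?D {..<x} = emeasure \<mu> {..<x}" for x
  proof -
    have "y -` {..<x} = {..<F x}" using y_less_iff by auto
    then have "emeasure ?D {..<x} = emeasure (density lborel (\<lambda>\<xi>. ennreal (1 - y' \<xi>))) {..<F x}"
      by (simp add: emeasure_distr)
    also have "\<dots> = ennreal (F x - y (F x))"
      using y'(2) by (intro prim_emeasure_lessThan[OF prim_diff[OF prim_id y'(1)]] H_bot) auto
    also have "\<dots> = emeasure \<mu> {..<x}"
      unfolding y_F by (simp add: F_def emeasure_eq_measure)
    finally show ?thesis .
  qed
  show ?thesis
  proof (rule measure_eqI_Ico)
    fix a b :: real assume ab: "a \<le> b"
    have eq: "{a..<b} = {..<b} - {..<a}" by auto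
    have "emeasure ?D {a..<b} = emeasure ?D {..<b} - emeasure ?D {..<a}"
      unfolding eq by (rule emeasure_Diff) (use ab lt[of a] in \<open>auto simp: less_top[symmetric]\<close>)
    also have "\<dots> = emeasure \<mu> {..<b} - emeasure \<mu> {..<a}" by (simp only: lt)
    also have "\<dots> = emeasure \<mu> {a..<b}"
      unfolding eq by (rule emeasure_Diff[symmetric]) (use ab in \<open>auto simp: sets_\<mu>\<close>)
    finally show "emeasure ?D {a..<b} = emeasure \<mu> {a..<b}" .
  next
    fix a b :: real
    have "emeasure ?D {a..<b} \<le> emeasure ?D {..<b}" by (rule emeasure_mono) auto
    then show "emeasure ?D {a..<b} \<noteq> \<infinity>" using lt[of b] by (auto simp: top_unique)
  qed (auto simp: sets_\<mu>)
qed

text \<open>Off the preimage of a null set containing the values at which \<^term>\<open>y\<close> is flat and the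
  singular part of \<^term>\<open>\<mu>\<close>, intervals are preimages of intervals, so the push-forward
  identity can be localised to a relation between densities.\<close>

lemma density_relation:
  assumes y': "prim y y'" "\<And>\<xi>. 0 \<le> y' \<xi>" "\<And>\<xi>. y' \<xi> \<le> 1"
    and \<alpha>[measurable]: "\<alpha> \<in> borel_measurable borel" and \<alpha>0: "\<And>x. 0 \<le> \<alpha> x"
    and ac: "is_ac_part \<mu> (density lborel (\<lambda>x. ennreal (\<alpha> x)))"
  shows "AE \<xi> in lborel. y' \<xi> * (1 - y' \<xi>) = \<alpha> (y \<xi>) * (y' \<xi>)\<^sup>2"
proof -
  have "\<bar>y \<xi> - \<xi>\<bar> \<le> M" for \<xi> using y_bounds[of \<xi>] by auto
  then interpret incr y y' using y' by unfold_locales auto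
  obtain \<nu> N where \<nu>: "sets \<nu> = sets borel" "N \<in> null_sets lborel" "emeasure \<nu> (UNIV - N) = 0"
     "\<And>A. A \<in> sets borel \<Longrightarrow> emeasure \<mu> A = emeasure (density lborel (\<lambda>x. ennreal (\<alpha> x))) A + emeasure \<nu> A"
    using ac unfolding is_ac_part_def by blast
  define N' where "N' = N \<union> y ` \<rat>"
  have N': "N' \<in> null_sets lborel" unfolding N'_def using \<nu>(2) flat_null by (rule null_sets.Un)
  then have [measurable]: "N' \<in> sets borel" by auto
  let ?f1 = "\<lambda>\<xi>. ennreal (1 - y' \<xi>) * indicator (- N') (y \<xi>)"
  let ?f2 = "\<lambda>\<xi>. ennreal (\<alpha> (y \<xi>) * y' \<xi>) * indicator (- N') (y \<xi>)"
  have Icc: "\<xi> \<in> {a..b} \<longleftrightarrow> y \<xi> \<in> {y a..y b}" if "y \<xi> \<in> - N'" for \<xi> a b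
  proof -
    have "y \<xi> \<notin> y ` \<rat>" using that by (simp add: N'_def)
    note inj = inj_off_flat[OF this]
    have "a \<le> \<xi> \<longleftrightarrow> y a \<le> y \<xi>"
      using mono[of a \<xi>] mono[of \<xi> a] inj[of a] by fastforce
    moreover have "\<xi> \<le> b \<longleftrightarrow> y \<xi> \<le> y b"
      using mono[of b \<xi>] mono[of \<xi> b] inj[of b] by fastforce
    ultimately show ?thesis by simp
  qed
  have e1: "emeasure (density lborel ?f1) {a..b} = emeasure \<mu> ({y a..y b} - N')" for a b
  proof -
    have "?f1 \<xi> * indicator {a..b} \<xi> = ennreal (1 - y' \<xi>) * indicator (y -` ({y a..y b} - N')) \<xi>" for \<xi>
      using Icc[of \<xi> a b] by (cases "y \<xi> \<in> N'") (simp_all add: indicator_def)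
    then have "emeasure (density lborel ?f1) {a..b} = (\<integral>\<^sup>+\<xi>. ennreal (1 - y' \<xi>) * indicator (y -` ({y a..y b} - N')) \<xi> \<partial>lborel)"
      by (simp add: emeasure_density)
    also have "\<dots> = emeasure (distr (density lborel (\<lambda>\<xi>. ennreal (1 - y' \<xi>))) borel y) ({y a..y b} - N')"
      using measurable_sets_borel[OF meas(1), of "{y a..y b} - N'"] by (simp add: emeasure_distr emeasure_density)
    finally show ?thesis by (simp add: pushforward_H[OF y'(1,3)])
  qed
  have e2: "emeasure (density lborel ?f2) {a..b} = emeasure \<mu> ({y a..y b} - N')" for a b
  proof -
    have "?f2 \<xi> * indicator {a..b} \<xi> = (ennreal (\<alpha> (y \<xi>)) * indicator ({y a..y b} - N') (y \<xi>)) * ennreal (y' \<xi>)" for \<xi>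
      using Icc[of \<xi> a b] \<alpha>0 nonneg by (cases "y \<xi> \<in> N'") (simp_all add: indicator_def ennreal_mult)
    then have "emeasure (density lborel ?f2) {a..b}
        = (\<integral>\<^sup>+\<xi>. (ennreal (\<alpha> (y \<xi>)) * indicator ({y a..y b} - N') (y \<xi>)) * ennreal (y' \<xi>) \<partial>lborel)"
      by (simp add: emeasure_density)
    also have "\<dots> = emeasure (density lborel (\<lambda>x. ennreal (\<alpha> x))) ({y a..y b} - N')"
      by (subst nn_integral_subst) (auto simp: emeasure_density)
    also have "\<dots> = emeasure \<mu> ({y a..y b} - N')"
    proof -
      have "emeasure \<nu> ({y a..y b} - N') \<le> emeasure \<nu> (UNIV - N)"
      proof (rule emeasure_mono)
        have [measurable]: "N \<in> sets borel" using null_setsD2[OF \<nu>(2)] by simp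
        show "UNIV - N \<in> sets \<nu>" unfolding \<nu>(1) by measurable
      qed (simp add: N'_def Diff_mono)
      then have z: "emeasure \<nu> ({y a..y b} - N') = 0" using \<nu>(3) by simp
      have "{y a..y b} - N' \<in> sets borel" by measurable
      from \<nu>(4)[OF this] show ?thesis unfolding z by simp
    qed
    finally show ?thesis .
  qed
  have "density lborel ?f1 = density lborel ?f2"
    by (rule measure_eqI_Ioc) (auto simp: emeasure_density_Ioc_Icc e1 e2)
  then have "AE \<xi> in lborel. ?f1 \<xi> = ?f2 \<xi>"
    by (intro sigma_finite_measure.density_unique[OF sigma_finite_lborel]) auto
  then show ?thesis
    using AE_subst[OF AE_not_in[OF N']]
  proof eventually_elim
    case (elim \<xi>)
    show ?case
    proof (cases "y' \<xi> = 0")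
      case False
      then have "y \<xi> \<notin> N'" using elim by simp
      then have "ennreal (1 - y' \<xi>) = ennreal (\<alpha> (y \<xi>) * y' \<xi>)" using elim by simp
      then have "1 - y' \<xi> = \<alpha> (y \<xi>) * y' \<xi>"
        using y'(3)[of \<xi>] \<alpha>0 nonneg by (subst (asm) ennreal_inj) auto
      then show ?thesis by (simp add: power2_eq_square)
    qed simp
  qed
qed

end

text \<open>Here \<open>H' = 1 - y'\<close> lies between 0 and 1, so \<open>(y' - 1)\<^sup>2\<close>
  is dominated by \<open>H'\<close>, which is integrable because \<open>H\<close> is bounded by the
  total mass. The energy relation comes from \<open>density_relation\<close>.\<close>

lemma mapL_lag:
  assumes Z: "(u, \<rho>, \<mu>) \<in> Eul"
  obtains y y' U' where "mapL (u, \<rho>, \<mu>) = (y, \<lambda>\<xi>. u (y \<xi>), \<lambda>\<xi>. \<xi> - y \<xi>, \<lambda>\<xi>. \<rho> (y \<xi>) * wderiv y \<xi>)"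
    "lag y y' (\<lambda>\<xi>. u (y \<xi>)) U' (\<lambda>\<xi>. \<xi> - y \<xi>) (\<lambda>\<xi>. 1 - y' \<xi>) (\<lambda>\<xi>. \<rho> (y \<xi>) * wderiv y \<xi>)"
    "distr (density lborel (\<lambda>\<xi>. ennreal (1 - y' \<xi>))) borel y = \<mu>"
    "y = cumulative.y \<mu>"
proof -
  have u: "u \<in> E2" and \<rho>: "\<rho> \<in> L2" and \<mu>: "sets \<mu> = sets borel" "finite_measure \<mu>"
    and ac: "is_ac_part \<mu> (density lborel (\<lambda>x. ennreal ((wderiv u x)\<^sup>2 + (\<rho> x)\<^sup>2)))"
    using Z by (auto simp: Eul_def)
  interpret cumulative \<mu> using \<mu> by (rule cumulative.intro)
  note u = E2D[OF u]
  have [measurable]: "wderiv u \<in> borel_measurable borel" "\<rho> \<in> borel_measurable borel"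
    using primD(2)[OF u(1)] \<rho> by (auto simp: L2_def)
  obtain y' where y': "prim y y'" "\<And>\<xi>. 0 \<le> y' \<xi>" "\<And>\<xi>. y' \<xi> \<le> 1"
    using lipschitz_mono_prim[of y 1] y_mono y_lipschitz by auto
  have bd: "\<bar>y \<xi> - \<xi>\<bar> \<le> M" for \<xi> using y_bounds[of \<xi>] by auto
  interpret incr y y' using y' bd by unfold_locales auto
  have pH: "prim (\<lambda>\<xi>. \<xi> - y \<xi>) (\<lambda>\<xi>. 1 - y' \<xi>)" by (intro prim_diff prim_id prim)
  have H_int: "integrable lborel (\<lambda>\<xi>. 1 - y' \<xi>)"
    using y' H_bounds by (intro prim_bounded_integrable[OF pH, of M]) auto
  have "(y' \<xi> - 1)\<^sup>2 \<le> 1 - y' \<xi>" for \<xi>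
    using mult_right_mono[of "1 - y' \<xi>" 1 "1 - y' \<xi>"] y'(2,3)[of \<xi>] by (simp add: power2_eq_square algebra_simps)
  then have l2: "(\<lambda>\<xi>. y' \<xi> - 1) \<in> L2" by (intro L2_bound[OF _ H_int]) auto
  note w = prim_wderiv[OF prim]
  have [measurable]: "wderiv y \<in> borel_measurable borel" using primD(2)[OF w(2)] .
  have "lag y y' (\<lambda>\<xi>. u (y \<xi>)) (\<lambda>\<xi>. wderiv u (y \<xi>) * y' \<xi>) (\<lambda>\<xi>. \<xi> - y \<xi>) (\<lambda>\<xi>. 1 - y' \<xi>) (\<lambda>\<xi>. \<rho> (y \<xi>) * wderiv y \<xi>)"
  proof
    show "prim (\<lambda>\<xi>. u (y \<xi>)) (\<lambda>\<xi>. wderiv u (y \<xi>) * y' \<xi>)" by (rule prim_comp[OF u(1)])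
    show "AE \<xi> in lborel. y' \<xi> * (1 - y' \<xi>) = (wderiv u (y \<xi>) * y' \<xi>)\<^sup>2 + (\<rho> (y \<xi>) * wderiv y \<xi>)\<^sup>2"
      using density_relation[OF y' _ _ ac] w(3)
      by (auto elim!: eventually_elim2 simp: power_mult_distrib algebra_simps)
    have "\<bar>\<xi> - y \<xi>\<bar> \<le> M" for \<xi> using H_bounds[of \<xi>] by simp
    then show "\<exists>K. \<forall>\<xi>. \<bar>\<xi> - y \<xi>\<bar> \<le> K" by blast
    show "\<exists>c>0. AE \<xi> in lborel. c \<le> y' \<xi> + (1 - y' \<xi>)" by (intro exI[of _ 1]) auto
    show "\<exists>K. \<forall>\<xi>. 1 - y' \<xi> \<le> K" using y'(2) by (intro exI[of _ 1]) auto
  qed (use pH y' u(3) l2 H_bot in auto)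
  moreover have "mapL (u, \<rho>, \<mu>) = (y, \<lambda>\<xi>. u (y \<xi>), \<lambda>\<xi>. \<xi> - y \<xi>, \<lambda>\<xi>. \<rho> (y \<xi>) * wderiv y \<xi>)"
    by (simp add: Let_def y_def[abs_def] o_def)
  ultimately show ?thesis using that pushforward_H[OF y'(1,3)] by blast
qed

subsection \<open>From Lagrangian to Eulerian coordinates\<close>

lemma is_push_density_unique:
  assumes "is_push_density y r \<rho>" "is_push_density y r \<rho>'"
  shows "AE x in lborel. \<rho> x = \<rho>' x"
  using assms by (intro locint_eq_AE) (auto simp: is_push_density_def)

context incr
begin

lemma push_density:
  assumes [measurable]: "\<rho> \<in> borel_measurable borel" "h \<in> borel_measurable borel"
    and l: "locint \<rho>" and h: "AE \<xi> in lborel. \<rho> (y \<xi>) * y' \<xi> = h \<xi>"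
  shows "is_push_density y h \<rho>"
  unfolding is_push_density_def
proof (intro conjI ballI impI l)
  fix A :: "real set" assume A[measurable]: "A \<in> sets borel"
  have "(LINT x:A|lborel. \<rho> x) = (LINT \<xi>:(y -` A)|lborel. \<rho> (y \<xi>) * y' \<xi>)"
    by (rule set_integral_subst[symmetric]) measurable
  also have "\<dots> = (LINT \<xi>:(y -` A)|lborel. h \<xi>)"
    by (rule set_lint_cong_AE[OF h]) (use measurable_sets_borel[OF meas(1) A] in auto)
  finally show "(LINT x:A|lborel. \<rho> x) = (LINT \<xi>:(y -` A)|lborel. h \<xi>)" .
qed

end

context lag
begin

text \<open>Dividing by \<open>y'\<close> gives
  \<open>(k (y \<xi>))\<^sup>2 * y' \<xi> \<le> H' \<xi>\<close>, and the change of variables then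
  bounds the integral of \<open>k\<^sup>2\<close> by the total energy.\<close>

lemma push_L2:
  assumes [measurable]: "k \<in> borel_measurable borel" 
    and le: "AE \<xi> in lborel. (k (y \<xi>) * y' \<xi>)\<^sup>2 \<le> y' \<xi> * H' \<xi>"
  shows "k \<in> L2"
proof -
  have AE: "AE \<xi> in lborel. (k (y \<xi>))\<^sup>2 * y' \<xi> \<le> H' \<xi>"
    using le
  proof eventually_elim
    case (elim \<xi>)
    show ?case
    proof (cases "y' \<xi> = 0")
      case False
      then have "y' \<xi> > 0" using nonneg[of \<xi>] by simp
      moreover have "y' \<xi> * ((k (y \<xi>))\<^sup>2 * y' \<xi>) \<le> y' \<xi> * H' \<xi>"
        using elim by (simp add: power2_eq_square mult_ac)
      ultimately show ?thesis by simp
    qed (simp add: H_nonneg)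
  qed
  have "integrable lborel (\<lambda>\<xi>. (k (y \<xi>))\<^sup>2 * y' \<xi>)"
    by (rule Bochner_Integration.integrable_bound[OF H_integrable])
      (use AE nonneg H_nonneg in \<open>auto elim!: eventually_mono\<close>)
  then show ?thesis
    using integrable_subst[of "\<lambda>x. (k x)\<^sup>2"] by (simp add: L2_def)
qed

lemma zero_at_critical: "AE \<xi> in lborel. y' \<xi> = 0 \<longrightarrow> U' \<xi> = 0 \<and> r \<xi> = 0"
  using rel
proof eventually_elim
  case (elim \<xi>)
  then show ?case by (auto simp: sum_power2_eq_zero_iff)
qed

text \<open>Almost every point of a level set is critical for \<open>y\<close>, and the energy
  relation forces \<open>U'\<close> to vanish there. This makes the Eulerian velocity independent of
  the chosen preimage.\<close>

lemma U_factors: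
  assumes "y a = y b"
  shows "U a = U b"
proof -
  have *: "U b = U a" if ab: "a \<le> b" "y a = y b" for a b
  proof -
    have "AE \<xi> in lborel. indicator {a..b} \<xi> *\<^sub>R U' \<xi> = 0"
      using AE_subst[OF AE_lborel_singleton[of "y a"]] zero_at_critical
    proof eventually_elim
      case (elim \<xi>)
      have "y \<xi> = y a" if "\<xi> \<in> {a..b}" using that mono[of a \<xi>] mono[of \<xi> b] ab by simp
      then show ?case using elim by (auto simp: indicator_def)
    qed
    then have "(LINT x:{a..b}|lborel. U' x) = 0"
      unfolding set_lebesgue_integral_def by (rule integral_eq_zero_AE)
    then show ?thesis using primD(4)[OF pU ab(1)] by simp
  qed
  show ?thesis
  proof (cases "a \<le> b")
    case True
    then show ?thesis using *[OF _ assms] by metis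
  next
    case False
    then show ?thesis using *[OF _ assms[symmetric]] by simp
  qed
qed

lemma U_linv: "U (linv (y \<xi>)) = U \<xi>"
  by (rule U_factors) (simp add: linv)

text \<open>A converse of the chain rule \<open>prim_comp\<close>. As \<open>linv\<close> picks left
  ends, \<open>[linv a, linv b]\<close> and the preimage of \<open>[a, b]\<close> differ only within
  the level set of \<open>b\<close>.\<close>

lemma U_push:
  obtains k where "prim (\<lambda>x. U (linv x)) k" "k \<in> L2" "AE \<xi> in lborel. k (y \<xi>) * y' \<xi> = U' \<xi>"
proof -
  have "AE \<xi> in lborel. y' \<xi> = 0 \<longrightarrow> U' \<xi> = 0" using zero_at_critical by eventually_elim simp
  from ex_push_density[OF meas2(1) this]
  obtain k where k[measurable]: "k \<in> borel_measurable borel" and AE: "AE \<xi> in lborel. k (y \<xi>) * y' \<xi> = U' \<xi>" .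
  have "AE \<xi> in lborel. (k (y \<xi>) * y' \<xi>)\<^sup>2 \<le> y' \<xi> * H' \<xi>"
    using AE U_le by eventually_elim simp
  then have L2: "k \<in> L2" by (rule push_L2[OF k])
  have "prim (\<lambda>x. U (linv x)) k"
    unfolding prim_def
  proof (intro conjI allI impI locint_L2 L2)
    fix a b :: real assume ab: "a \<le> b"
    have le: "linv a \<le> linv b" using ab by (simp add: linv)
    have "AE \<xi> in lborel. indicator {linv a..linv b} \<xi> *\<^sub>R U' \<xi> = indicator (y -` {a..b}) \<xi> *\<^sub>R (k (y \<xi>) * y' \<xi>)"
      using AE_subst[OF AE_lborel_singleton[of b]] AE
    proof eventually_elim
      case (elim \<xi>)
      show ?case
      proof (cases "y' \<xi> = 0")
        case False
        then have "y \<xi> \<le> b \<longleftrightarrow> \<xi> \<le> linv b"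
          using elim(1) linv_less[of \<xi> b] mono[of \<xi> "linv b"] linv(2)[of b] by fastforce
        then show ?thesis using elim(2) linv(1)[of a \<xi>] by (auto simp: indicator_def)
      qed (use elim in auto)
    qed
    then have "(LINT \<xi>:{linv a..linv b}|lborel. U' \<xi>) = (LINT \<xi>:y -` {a..b}|lborel. k (y \<xi>) * y' \<xi>)"
      unfolding set_lebesgue_integral_def by (intro integral_cong_AE) auto
    then show "U (linv b) - U (linv a) = (LINT x:{a..b}|lborel. k x)"
      using primD(4)[OF pU le] by (subst (asm) set_integral_subst) auto
  qed
  then show ?thesis using that L2 AE by blast
qed

lemma r_push:
  obtains \<rho> where "\<rho> \<in> L2" "AE \<xi> in lborel. \<rho> (y \<xi>) * y' \<xi> = r \<xi>" "is_push_density y r \<rho>"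
proof -
  have "AE \<xi> in lborel. y' \<xi> = 0 \<longrightarrow> r \<xi> = 0" using zero_at_critical by eventually_elim simp
  from ex_push_density[OF r_meas this]
  obtain k where k[measurable]: "k \<in> borel_measurable borel" and AE: "AE \<xi> in lborel. k (y \<xi>) * y' \<xi> = r \<xi>" .
  have "AE \<xi> in lborel. (k (y \<xi>) * y' \<xi>)\<^sup>2 \<le> y' \<xi> * H' \<xi>"
    using AE rel by eventually_elim simp
  then have L2: "k \<in> L2" by (rule push_L2[OF k])
  show ?thesis using that[OF L2 AE push_density[OF k r_meas locint_L2[OF L2] AE]] .
qed

lemma wderiv_H_density: "density lborel (\<lambda>\<xi>. ennreal (wderiv H \<xi>)) = density lborel (\<lambda>\<xi>. ennreal (H' \<xi>))"
proof (rule density_cong)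
  show "AE \<xi> in lborel. ennreal (wderiv H \<xi>) = ennreal (H' \<xi>)"
    using prim_wderiv(3)[OF pH] by eventually_elim simp
qed (use primD(2)[OF prim_wderiv(2)[OF pH]] in auto)

text \<open>The energy density \<open>H'\<close> is split according to whether \<open>y'\<close>
  vanishes. The part with \<open>y' \<noteq> 0\<close> is transported to the density
  \<open>u_x\<^sup>2 + \<rho>\<^sup>2\<close>; the rest lands on the null set of critical values and
  is the singular part of \<open>\<mu>\<close>.\<close>

lemma mapM_Eul:
  obtains u \<rho> \<mu> where "mapM (y, U, H, r) = (u, \<rho>, \<mu>)" "\<And>\<xi>. u (y \<xi>) = U \<xi>" 
    "is_push_density y r \<rho>" "AE \<xi> in lborel. \<rho> (y \<xi>) * y' \<xi> = r \<xi>"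
    "\<mu> = distr (density lborel (\<lambda>\<xi>. ennreal (H' \<xi>))) borel y" "(u, \<rho>, \<mu>) \<in> Eul"
proof -
  define u where "u x = U (SOME \<xi>. y \<xi> = x)" for x
  have u_eq: "u = (\<lambda>x. U (linv x))"
  proof
    fix x
    have "y (SOME \<xi>. y \<xi> = x) = x" by (rule someI[of _ "linv x"]) (rule linv)
    then show "u x = U (linv x)" unfolding u_def by (intro U_factors) (simp add: linv)
  qed
  define \<rho> where "\<rho> = (SOME \<rho>. is_push_density y r \<rho>)"
  define \<mu> where "\<mu> = distr (density lborel (\<lambda>\<xi>. ennreal (H' \<xi>))) borel y"
  obtain \<rho>0 where \<rho>0: "\<rho>0 \<in> L2" "AE \<xi> in lborel. \<rho>0 (y \<xi>) * y' \<xi> = r \<xi>" "is_push_density y r \<rho>0"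
    using r_push by blast
  \<comment> \<open>Nothing is known of the chosen function beyond the defining predicate, but any
    two candidates agree almost everywhere, so it inherits its properties from
    \<open>\<rho>0\<close>.\<close>
  have \<rho>: "is_push_density y r \<rho>" unfolding \<rho>_def by (rule someI[of _ \<rho>0]) (rule \<rho>0)
  then have [measurable]: "\<rho> \<in> borel_measurable borel" by (auto simp: is_push_density_def locint_def)
  have [measurable]: "\<rho>0 \<in> borel_measurable borel" using \<rho>0 by (simp add: L2_def)
  have \<rho>\<rho>0: "AE x in lborel. \<rho>0 x = \<rho> x" using is_push_density_unique[OF \<rho>0(3) \<rho>] .
  have \<rho>L2: "\<rho> \<in> L2" by (rule L2_cong_AE(1)[OF \<rho>0(1) \<rho>\<rho>0]) measurable
  have \<rho>r: "AE \<xi> in lborel. \<rho> (y \<xi>) * y' \<xi> = r \<xi>"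
    using AE_subst[OF \<rho>\<rho>0] \<rho>0(2) by eventually_elim auto
  obtain k where k: "prim u k" "k \<in> L2" "AE \<xi> in lborel. k (y \<xi>) * y' \<xi> = U' \<xi>"
    unfolding u_eq using U_push by blast
  have [measurable]: "k \<in> borel_measurable borel" using k(2) by (simp add: L2_def)
  have uE2: "u \<in> E2"
  proof -
    obtain C where "\<And>\<xi>. \<bar>U \<xi>\<bar> \<le> C" using bdd_U by blast
    then show ?thesis by (intro E2I[OF k(1) _ k(2), of C]) (simp add: u_eq)
  qed
  have [measurable]: "wderiv u \<in> borel_measurable borel" using E2D(2)[OF uE2] by (simp add: L2_def)
  define \<alpha> where "\<alpha> x = (wderiv u x)\<^sup>2 + (\<rho> x)\<^sup>2" for x
  have [measurable]: "\<alpha> \<in> borel_measurable borel" unfolding \<alpha>_def by measurable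
  have \<alpha>0: "0 \<le> \<alpha> x" for x by (simp add: \<alpha>_def)
  have \<alpha>H: "AE \<xi> in lborel. \<alpha> (y \<xi>) * y' \<xi> = (if y' \<xi> = 0 then 0 else H' \<xi>)"
    using AE_subst[OF prim_wderiv(3)[OF k(1)]] k(3) \<rho>r rel
  proof eventually_elim
    case (elim \<xi>)
    show ?case
    proof (cases "y' \<xi> = 0")
      case False
      have "y' \<xi> * (\<alpha> (y \<xi>) * y' \<xi>) = (k (y \<xi>) * y' \<xi>)\<^sup>2 + (\<rho> (y \<xi>) * y' \<xi>)\<^sup>2"
        using elim(1) False by (simp add: \<alpha>_def power2_eq_square algebra_simps)
      also have "\<dots> = y' \<xi> * H' \<xi>" using elim by simp
      finally show ?thesis using False by simp
    qed simp
  qed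
  have fin: "finite_measure \<mu>"
  proof (rule finite_measureI)
    have "emeasure \<mu> UNIV = (\<integral>\<^sup>+\<xi>. ennreal (H' \<xi>) \<partial>lborel)"
      by (simp add: \<mu>_def emeasure_distr emeasure_density)
    also have "\<dots> = ennreal (LINT \<xi>|lborel. H' \<xi>)"
      by (rule nn_integral_eq_integral[OF H_integrable]) (simp add: H_nonneg)
    finally show "emeasure \<mu> (space \<mu>) \<noteq> \<infinity>" by (simp add: \<mu>_def)
  qed
  define \<nu> where "\<nu> = distr (density lborel (\<lambda>\<xi>. ennreal (if y' \<xi> = 0 then H' \<xi> else 0))) borel y"
  have \<nu>: "emeasure \<nu> A = (\<integral>\<^sup>+\<xi>. ennreal (if y' \<xi> = 0 then H' \<xi> else 0) * indicator A (y \<xi>) \<partial>lborel)"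
    if "A \<in> sets borel" for A
    using that measurable_sets_borel[OF meas(1) that]
    by (simp add: \<nu>_def emeasure_distr emeasure_density indicator_vimage)
  have ac: "is_ac_part \<mu> (density lborel (\<lambda>x. ennreal (\<alpha> x)))"
    unfolding is_ac_part_def
  proof (intro conjI exI[of _ \<nu>] ballI)
    show "absolutely_continuous lborel (density lborel (\<lambda>x. ennreal (\<alpha> x)))"
      by (rule absolutely_continuousI_density) simp
    obtain Z where Z: "Z \<in> null_sets lborel" "\<And>\<xi>. y' \<xi> = 0 \<Longrightarrow> y \<xi> \<in> Z" using critical_values_null by blast
    have [measurable]: "Z \<in> sets borel" using null_setsD2[OF Z(1)] by simp
    have "ennreal (if y' \<xi> = 0 then H' \<xi> else 0) * indicator (UNIV - Z) (y \<xi>) = 0" for \<xi>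
      using Z(2)[of \<xi>] by (auto simp: indicator_def)
    then have "emeasure \<nu> (UNIV - Z) = (\<integral>\<^sup>+\<xi>. 0 \<partial>(lborel :: real measure))"
      by (subst \<nu>) (measurable, simp only:)
    then show "\<exists>N\<in>null_sets lborel. emeasure \<nu> (UNIV - N) = 0" using Z(1) by auto
    fix A :: "real set" assume A[measurable]: "A \<in> sets borel"
    have "emeasure (density lborel (\<lambda>x. ennreal (\<alpha> x))) A = (\<integral>\<^sup>+x. ennreal (\<alpha> x) * indicator A x \<partial>lborel)"
      by (simp add: emeasure_density)
    also have "\<dots> = (\<integral>\<^sup>+\<xi>. ennreal (\<alpha> (y \<xi>)) * indicator A (y \<xi>) * ennreal (y' \<xi>) \<partial>lborel)"
      by (rule nn_integral_subst[symmetric]) measurable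
    also have "\<dots> = (\<integral>\<^sup>+\<xi>. ennreal (if y' \<xi> = 0 then 0 else H' \<xi>) * indicator A (y \<xi>) \<partial>lborel)"
    proof (rule nn_integral_cong_AE)
      have *: "ennreal (\<alpha> (y \<xi>)) * indicator A (y \<xi>) * ennreal (y' \<xi>) = ennreal (\<alpha> (y \<xi>) * y' \<xi>) * indicator A (y \<xi>)" for \<xi>
        by (simp add: ennreal_mult \<alpha>0 nonneg mult_ac)
      show "AE \<xi> in lborel. ennreal (\<alpha> (y \<xi>)) * indicator A (y \<xi>) * ennreal (y' \<xi>)
         = ennreal (if y' \<xi> = 0 then 0 else H' \<xi>) * indicator A (y \<xi>)"
        using \<alpha>H by eventually_elim (simp only: *)
    qed
    finally have "emeasure (density lborel (\<lambda>x. ennreal (\<alpha> x))) A + emeasure \<nu> A 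
      = (\<integral>\<^sup>+\<xi>. ennreal (if y' \<xi> = 0 then 0 else H' \<xi>) * indicator A (y \<xi>) +
          ennreal (if y' \<xi> = 0 then H' \<xi> else 0) * indicator A (y \<xi>) \<partial>lborel)"
      by (simp add: \<nu> nn_integral_add)
    also have "\<dots> = (\<integral>\<^sup>+\<xi>. ennreal (H' \<xi>) * indicator (y -` A) \<xi> \<partial>lborel)"
      by (rule nn_integral_cong) (auto simp: indicator_def)
    also have "\<dots> = emeasure \<mu> A"
      using measurable_sets_borel[OF meas(1) A] by (simp add: \<mu>_def emeasure_distr emeasure_density)
    finally show "emeasure \<mu> A = emeasure (density lborel (\<lambda>x. ennreal (\<alpha> x))) A + emeasure \<nu> A" by simp
  qed (simp_all add: \<nu>_def)
  have "(u, \<rho>, \<mu>) \<in> Eul"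
    using uE2 \<rho>L2 fin ac by (simp add: Eul_def \<alpha>_def) (simp add: \<mu>_def)
  moreover have "mapM (y, U, H, r) = (u, \<rho>, \<mu>)"
    by (simp add: u_def[abs_def] \<rho>_def \<mu>_def wderiv_H_density)
  ultimately show ?thesis using that \<rho> \<rho>r \<mu>_def U_linv u_eq by blast
qed

end

section \<open>Back and forth between the coordinates, and invariance under relabelling\<close>

context lag
begin

lemma H_nn: "0 \<le> H \<xi>"
proof (rule tendsto_upperbound[OF H_bot])
  show "\<forall>\<^sub>F \<eta> in at_bot. H \<eta> \<le> H \<xi>"
    unfolding eventually_at_bot_linorder using H_mono by blast
qed simp

text \<open>As \<^term>\<open>linv x\<close> is the left end of the level set of \<^term>\<open>x\<close>, the distribution function of the
  Eulerian energy satisfies \<open>\<mu>((-\<infinity>, x)) + x = (y + H) (linv x)\<close>. Hence going to Eulerian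
  coordinates and back amounts to relabelling by the inverse of \<open>y + H\<close>.\<close>

lemma mapL_mapM:
  assumes q: "relab (\<lambda>\<xi>. y \<xi> + H \<xi>) q'" and h: "h = incr.linv (\<lambda>\<xi>. y \<xi> + H \<xi>)"
  obtains rL where "mapL (mapM (y, U, H, r)) = (\<lambda>\<xi>. y (h \<xi>), \<lambda>\<xi>. U (h \<xi>), \<lambda>\<xi>. H (h \<xi>), rL)"
    "AE \<xi> in lborel. rL \<xi> = r (h \<xi>) * (1 / q' (h \<xi>))" "rL \<in> borel_measurable borel"
proof -
  interpret q: relab "\<lambda>\<xi>. y \<xi> + H \<xi>" q' by (rule q)
  have h: "h = q.linv" by (rule h)
  interpret h: relab h "\<lambda>x. 1 / q' (h x)" unfolding h by (rule q.relab_linv)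
  obtain u \<rho> \<mu> where M: "mapM (y, U, H, r) = (u, \<rho>, \<mu>)" "\<And>\<xi>. u (y \<xi>) = U \<xi>" 
    "is_push_density y r \<rho>" "AE \<xi> in lborel. \<rho> (y \<xi>) * y' \<xi> = r \<xi>"
    "\<mu> = distr (density lborel (\<lambda>\<xi>. ennreal (H' \<xi>))) borel y" "(u, \<rho>, \<mu>) \<in> Eul"
    by (rule mapM_Eul) (rule that)
  obtain yL yL' UL' where L: "mapL (u, \<rho>, \<mu>) = (yL, \<lambda>\<xi>. u (yL \<xi>), \<lambda>\<xi>. \<xi> - yL \<xi>, \<lambda>\<xi>. \<rho> (yL \<xi>) * wderiv yL \<xi>)"
    "lag yL yL' (\<lambda>\<xi>. u (yL \<xi>)) UL' (\<lambda>\<xi>. \<xi> - yL \<xi>) (\<lambda>\<xi>. 1 - yL' \<xi>) (\<lambda>\<xi>. \<rho> (yL \<xi>) * wderiv yL \<xi>)"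
    "distr (density lborel (\<lambda>\<xi>. ennreal (1 - yL' \<xi>))) borel yL = \<mu>"
    "yL = cumulative.y \<mu>"
    by (rule mapL_lag[OF M(6)]) (rule that)
  interpret c: cumulative \<mu>
    by (rule cumulative.intro) (use M(6) in \<open>auto simp: Eul_def\<close>)
  have F: "c.F x = y (linv x) + H (linv x)" for x
  proof -
    have "y -` {..<x} = {..<linv x}" using linv_less by auto
    then have "emeasure \<mu> {..<x} = emeasure (density lborel (\<lambda>\<xi>. ennreal (H' \<xi>))) {..<linv x}"
      unfolding M(5) by (simp add: emeasure_distr)
    also have "\<dots> = ennreal (H (linv x))" by (rule prim_emeasure_lessThan[OF pH H_nonneg H_bot])
    finally have "measure \<mu> {..<x} = H (linv x)" by (simp add: measure_def H_nn)
    then show ?thesis by (simp add: c.F_def linv)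
  qed
  have yL: "yL \<xi> = y (h \<xi>)" for \<xi>
  proof -
    \<comment> \<open>Two reals with the same strict upper bounds are equal; those of
      \<open>yL \<xi>\<close> are read off from \<open>F\<close>, those of
      \<open>y (h \<xi>)\<close> from the Galois connections of \<open>q\<close> and
      \<open>y\<close>.\<close>
    have "yL \<xi> < x \<longleftrightarrow> y (h \<xi>) < x" for x
    proof -
      have "yL \<xi> < x \<longleftrightarrow> \<xi> < y (linv x) + H (linv x)" unfolding L(4) c.y_less_iff F ..
      also have "\<dots> \<longleftrightarrow> h \<xi> < linv x"
        using q.linv(1)[of "\<xi>" "h \<xi>"] q.le_iff[of "linv x" "h \<xi>"] q.y_linv[of \<xi>] unfolding h by linarith
      also have "\<dots> \<longleftrightarrow> y (h \<xi>) < x" by (rule linv_less)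
      finally show ?thesis .
    qed
    then show ?thesis by (metis less_irrefl linorder_neqE_linordered_idom)
  qed
  have "\<xi> - yL \<xi> = H (h \<xi>)" for \<xi>
    using q.y_linv[of \<xi>] unfolding yL h by linarith
  moreover have "u (yL \<xi>) = U (h \<xi>)" for \<xi> unfolding yL M(2) ..
  ultimately have eq: "mapL (mapM (y, U, H, r)) = (\<lambda>\<xi>. y (h \<xi>), \<lambda>\<xi>. U (h \<xi>), \<lambda>\<xi>. H (h \<xi>), \<lambda>\<xi>. \<rho> (yL \<xi>) * wderiv yL \<xi>)"
    unfolding M(1) L(1) by (simp add: yL fun_eq_iff)
  have "prim yL (\<lambda>\<xi>. y' (h \<xi>) * (1 / q' (h \<xi>)))"
    unfolding yL[abs_def] by (rule h.prim_comp[OF prim])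
  from prim_wderiv(3)[OF this] h.AE_subst[OF M(4)]
  have "AE \<xi> in lborel. \<rho> (yL \<xi>) * wderiv yL \<xi> = r (h \<xi>) * (1 / q' (h \<xi>))"
  proof eventually_elim
    case (elim \<xi>)
    have "1 / q' (h \<xi>) \<noteq> 0" using h.pos[of \<xi>] by simp
    then have "\<rho> (y (h \<xi>)) * y' (h \<xi>) = r (h \<xi>)" using elim(2) by blast
    then show ?case unfolding elim(1) yL by simp
  qed
  moreover have "(\<lambda>\<xi>. \<rho> (yL \<xi>) * wderiv yL \<xi>) \<in> borel_measurable borel"
    using L(2) by (auto simp: lag_def lag_axioms_def)
  ultimately show ?thesis using that eq by blast
qed

text \<open>The equality is literal although \<open>r2\<close> is known only almost everywhere: the
  predicates from which \<open>\<rho>\<close> is chosen coincide, hence so do the chosen functions.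
  For \<open>U\<close> the two choices may be different points, but they lie in the same level
  set.\<close>

lemma mapM_relabel:
  assumes h: "relab h h'" and r2[measurable]: "r2 \<in> borel_measurable borel" 
    and r2_eq: "AE \<xi> in lborel. r2 \<xi> = r (h \<xi>) * h' \<xi>"
  shows "mapM (\<lambda>\<xi>. y (h \<xi>), \<lambda>\<xi>. U (h \<xi>), \<lambda>\<xi>. H (h \<xi>), r2) = mapM (y, U, H, r)"
proof -
  interpret h: relab h h' by (rule h)
  have 1: "(\<lambda>x. U (h (SOME \<xi>. y (h \<xi>) = x))) = (\<lambda>x. U (SOME \<xi>. y \<xi> = x))"
  proof
    fix x
    have "y (SOME \<xi>. y \<xi> = x) = x" by (rule someI[of _ "linv x"]) (rule linv)
    moreover have "y (h (SOME \<xi>. y (h \<xi>) = x)) = x" 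
      by (rule someI[of _ "h.linv (linv x)"]) (simp add: linv)
    ultimately show "U (h (SOME \<xi>. y (h \<xi>) = x)) = U (SOME \<xi>. y \<xi> = x)"
      by (intro U_factors) simp
  qed
  have int: "(LINT \<xi>:(\<lambda>\<xi>. y (h \<xi>)) -` A|lborel. r2 \<xi>) = (LINT \<xi>:y -` A|lborel. r \<xi>)" if A: "A \<in> sets borel" for A
  proof -
    have m: "y -` A \<in> sets borel" using measurable_sets_borel[OF meas(1) A] .
    have m2: "h -` (y -` A) \<in> sets borel" using measurable_sets_borel[OF h.meas(1) m] .
    have "(LINT \<xi>:h -` (y -` A)|lborel. r2 \<xi>) = (LINT \<xi>:h -` (y -` A)|lborel. r (h \<xi>) * h' \<xi>)"
      by (rule set_lint_cong_AE[OF r2_eq _ _ m2]) auto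
    also have "\<dots> = (LINT \<xi>:y -` A|lborel. r \<xi>)" by (rule h.set_integral_subst[OF r_meas m])
    finally show ?thesis by (simp add: vimage_def)
  qed
  have 2: "is_push_density (\<lambda>\<xi>. y (h \<xi>)) r2 = is_push_density y r"
    unfolding is_push_density_def fun_eq_iff by (simp add: int cong: conj_cong)
  have pHh: "prim (\<lambda>\<xi>. H (h \<xi>)) (\<lambda>\<xi>. H' (h \<xi>) * h' \<xi>)" by (rule h.prim_comp[OF pH])
  have [measurable]: "wderiv (\<lambda>\<xi>. H (h \<xi>)) \<in> borel_measurable borel"
    using primD(2)[OF prim_wderiv(2)[OF pHh]] .
  have 3: "distr (density lborel (\<lambda>\<xi>. ennreal (wderiv (\<lambda>\<xi>. H (h \<xi>)) \<xi>))) borel (\<lambda>\<xi>. y (h \<xi>))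
     = distr (density lborel (\<lambda>\<xi>. ennreal (wderiv H \<xi>))) borel y"
    unfolding wderiv_H_density
  proof (rule measure_eqI)
    fix A assume "A \<in> sets (distr (density lborel (\<lambda>\<xi>. ennreal (wderiv (\<lambda>\<xi>. H (h \<xi>)) \<xi>))) borel (\<lambda>\<xi>. y (h \<xi>)))"
    then have A[measurable]: "A \<in> sets borel" by simp
    have m: "y -` A \<in> sets borel" "(\<lambda>\<xi>. y (h \<xi>)) -` A \<in> sets borel" 
      using A by (auto intro!: measurable_sets_borel[of _ borel])
    have "emeasure (distr (density lborel (\<lambda>\<xi>. ennreal (wderiv (\<lambda>\<xi>. H (h \<xi>)) \<xi>))) borel (\<lambda>\<xi>. y (h \<xi>))) A
       = (\<integral>\<^sup>+\<xi>. ennreal (wderiv (\<lambda>\<xi>. H (h \<xi>)) \<xi>) * indicator A (y (h \<xi>)) \<partial>lborel)"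
      using m by (simp add: emeasure_distr emeasure_density indicator_vimage)
    also have "\<dots> = (\<integral>\<^sup>+\<xi>. (ennreal (H' (h \<xi>)) * indicator A (y (h \<xi>))) * ennreal (h' \<xi>) \<partial>lborel)"
    proof (rule nn_integral_cong_AE)
      show "AE \<xi> in lborel. ennreal (wderiv (\<lambda>\<xi>. H (h \<xi>)) \<xi>) * indicator A (y (h \<xi>))
        = (ennreal (H' (h \<xi>)) * indicator A (y (h \<xi>))) * ennreal (h' \<xi>)"
        using prim_wderiv(3)[OF pHh]
        by eventually_elim (simp add: ennreal_mult H_nonneg h.nonneg mult_ac)
    qed
    also have "\<dots> = (\<integral>\<^sup>+\<xi>. ennreal (H' \<xi>) * indicator A (y \<xi>) \<partial>lborel)"
      by (rule h.nn_integral_subst) measurable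
    also have "\<dots> = emeasure (distr (density lborel (\<lambda>\<xi>. ennreal (H' \<xi>))) borel y) A"
      using m by (simp add: emeasure_distr emeasure_density indicator_vimage)
    finally show "emeasure (distr (density lborel (\<lambda>\<xi>. ennreal (wderiv (\<lambda>\<xi>. H (h \<xi>)) \<xi>))) borel (\<lambda>\<xi>. y (h \<xi>))) A
      = emeasure (distr (density lborel (\<lambda>\<xi>. ennreal (H' \<xi>))) borel y) A" .
  qed simp
  show ?thesis by (simp add: 1 2 3)
qed

end

subsection \<open>The semigroup property\<close>

text \<open>\<open>h\<close> tends to infinity, so the asymptotic energy is unchanged. The fourth
  component is arbitrary because the flow leaves it alone and \<open>L \<circ> M\<close> determines
  it only almost everywhere.\<close>

lemma flowS_relabel:
  assumes X: "lag y y' U U' H H' r" and h: "relab h h'" 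
    and fl: "flowS t (y, U, H, r) = (yt, Ut, H, r)"
  shows "flowS t (\<lambda>\<xi>. y (h \<xi>), \<lambda>\<xi>. U (h \<xi>), \<lambda>\<xi>. H (h \<xi>), r2) = (\<lambda>\<xi>. yt (h \<xi>), \<lambda>\<xi>. Ut (h \<xi>), \<lambda>\<xi>. H (h \<xi>), r2)"
proof -
  interpret lag y y' U U' H H' r by fact
  interpret h: relab h h' by fact
  have "((\<lambda>\<xi>. H (h \<xi>)) \<longlongrightarrow> Lim at_top H) at_top"
    by (rule filterlim_compose[OF H_lim h.at_top])
  then have L: "Lim at_top (\<lambda>\<xi>. H (h \<xi>)) = Lim at_top H" by (intro tendsto_Lim) auto
  show ?thesis using fl by (auto simp: Let_def L)
qed

lemma flowS_lag:
  assumes X: "lag y y' U U' H H' r" and t: "0 \<le> t"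
  obtains yt yt' Ut Ut' Ht' where "flowS t (y, U, H, r) = (yt, Ut, H, r)" "lag yt yt' Ut Ut' H Ht' r"
    "AE \<xi> in lborel. exp (-t) * (y' \<xi> + H' \<xi>) \<le> yt' \<xi> + Ht' \<xi>"
  by (rule lag.flow_lag[OF X t]) (rule that[OF lag.flowS_eq[OF X]])

lemma flowS_flowS:
  assumes "flowS s (y, U, H, r) = (ys, Us, H, r)"
  shows "flowS t (ys, Us, H, r) = flowS (t + s) (y, U, H, r)"
proof -
  have ys: "ys = (\<lambda>\<xi>. 1/4 * (H \<xi> - 1/2 * Lim at_top H) * s\<^sup>2 + U \<xi> * s + y \<xi>)"
    and Us: "Us = (\<lambda>\<xi>. 1/2 * (H \<xi> - 1/2 * Lim at_top H) * s + U \<xi>)"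
    using assms by (auto simp: Let_def)
  show ?thesis unfolding ys Us by (simp add: Let_def fun_eq_iff power2_eq_square field_simps)
qed

lemma flowS_0: "flowS 0 X = X"
  by (cases X) (simp add: Let_def)

lemma mapL_lag0:
  assumes "Z \<in> Eul"
  obtains y y' U U' H H' r where "mapL Z = (y, U, H, r)" "lag y y' U U' H H' r" "\<And>\<xi>. y \<xi> + H \<xi> = \<xi>"
proof -
  obtain u \<rho> \<mu> where Z: "Z = (u, \<rho>, \<mu>)" by (cases Z)
  show ?thesis unfolding Z by (rule mapL_lag[OF assms[unfolded Z]], rule that[unfolded Z]) auto
qed

lemma opT_Eul:
  assumes Z: "Z \<in> Eul" and t: "0 \<le> t"
  shows "opT t Z \<in> Eul"
proof -
  obtain y y' U U' H H' r where L: "mapL Z = (y, U, H, r)" "lag y y' U U' H H' r" "\<And>\<xi>. y \<xi> + H \<xi> = \<xi>"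
    by (rule mapL_lag0[OF Z]) (rule that)
  obtain yt yt' Ut Ut' Ht' where f: "flowS t (y, U, H, r) = (yt, Ut, H, r)" "lag yt yt' Ut Ut' H Ht' r"
    "AE \<xi> in lborel. exp (-t) * (y' \<xi> + H' \<xi>) \<le> yt' \<xi> + Ht' \<xi>"
    by (rule flowS_lag[OF L(2) t]) (rule that)
  show ?thesis
    unfolding opT_def L(1) f(1) by (rule lag.mapM_Eul[OF f(2)]) simp
qed

text \<open>The class of \<open>\<rho>\<close> enters only through \<open>r\<close>, and
  \<open>mapM_relabel\<close> with the identity relabelling absorbs a change of \<open>r\<close> on
  a null set.\<close>

lemma opT_cong:
  assumes Z: "Z \<in> Eul" "Z' \<in> Eul" "Z \<approx>\<^sub>D Z'" and t: "0 \<le> t"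
  shows "opT t Z = opT t Z'"
proof -
  obtain u \<rho> \<mu> where Z': "Z = (u, \<rho>, \<mu>)" by (cases Z)
  obtain \<rho>' where Z2: "Z' = (u, \<rho>', \<mu>)" and AE: "AE x in lborel. \<rho> x = \<rho>' x" using Z(3) Z' by (cases Z') auto
  obtain y y' U' where L: "mapL Z = (y, \<lambda>\<xi>. u (y \<xi>), \<lambda>\<xi>. \<xi> - y \<xi>, \<lambda>\<xi>. \<rho> (y \<xi>) * wderiv y \<xi>)"
    "lag y y' (\<lambda>\<xi>. u (y \<xi>)) U' (\<lambda>\<xi>. \<xi> - y \<xi>) (\<lambda>\<xi>. 1 - y' \<xi>) (\<lambda>\<xi>. \<rho> (y \<xi>) * wderiv y \<xi>)"
    "distr (density lborel (\<lambda>\<xi>. ennreal (1 - y' \<xi>))) borel y = \<mu>" "y = cumulative.y \<mu>"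
    unfolding Z' by (rule mapL_lag[OF Z(1)[unfolded Z']]) (rule that[unfolded Z'])
  obtain y2 y2' U2' where L2: "mapL Z' = (y2, \<lambda>\<xi>. u (y2 \<xi>), \<lambda>\<xi>. \<xi> - y2 \<xi>, \<lambda>\<xi>. \<rho>' (y2 \<xi>) * wderiv y2 \<xi>)"
    "lag y2 y2' (\<lambda>\<xi>. u (y2 \<xi>)) U2' (\<lambda>\<xi>. \<xi> - y2 \<xi>) (\<lambda>\<xi>. 1 - y2' \<xi>) (\<lambda>\<xi>. \<rho>' (y2 \<xi>) * wderiv y2 \<xi>)"
    "distr (density lborel (\<lambda>\<xi>. ennreal (1 - y2' \<xi>))) borel y2 = \<mu>" "y2 = cumulative.y \<mu>"
    unfolding Z2 by (rule mapL_lag[OF Z(2)[unfolded Z2]]) (rule that[unfolded Z2])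
  have yy: "y2 = y" unfolding L(4) L2(4) ..
  let ?r = "\<lambda>\<xi>. \<rho> (y \<xi>) * wderiv y \<xi>" and ?r2 = "\<lambda>\<xi>. \<rho>' (y \<xi>) * wderiv y \<xi>"
  interpret lag y y' "\<lambda>\<xi>. u (y \<xi>)" U' "\<lambda>\<xi>. \<xi> - y \<xi>" "\<lambda>\<xi>. 1 - y' \<xi>" ?r by fact
  have r2: "?r2 \<in> borel_measurable borel" using L2(2) unfolding yy by (auto simp: lag_def lag_axioms_def)
  have AEr: "AE \<xi> in lborel. ?r2 \<xi> = ?r \<xi> * 1"
    using AE_subst[OF AE] prim_wderiv(3)[OF prim] by eventually_elim auto
  obtain yt yt' Ut Ut' Ht' where f: "flowS t (y, \<lambda>\<xi>. u (y \<xi>), \<lambda>\<xi>. \<xi> - y \<xi>, ?r) = (yt, Ut, \<lambda>\<xi>. \<xi> - y \<xi>, ?r)" 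
     "lag yt yt' Ut Ut' (\<lambda>\<xi>. \<xi> - y \<xi>) Ht' ?r"
     "AE \<xi> in lborel. exp (-t) * (y' \<xi> + (1 - y' \<xi>)) \<le> yt' \<xi> + Ht' \<xi>"
    by (rule flowS_lag[OF L(2) t]) (rule that)
  have f2: "flowS t (y, \<lambda>\<xi>. u (y \<xi>), \<lambda>\<xi>. \<xi> - y \<xi>, ?r2) = (yt, Ut, \<lambda>\<xi>. \<xi> - y \<xi>, ?r2)"
    by (rule flowS_relabel[OF L(2) relab_id f(1)])
  show ?thesis
    unfolding opT_def L(1) L2(1) yy f(1) f2
    by (rule lag.mapM_relabel[OF f(2) relab_id r2 AEr, symmetric])
qed

text \<open>\<open>M\<close> is a left inverse of \<open>L\<close>: \<open>\<rho>\<close> itself is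
  a push-forward density of \<open>(\<rho> \<circ> y) y'\<close>, and such densities are unique
  almost everywhere. The choice made by \<open>M\<close> is the reason for
  \<open>\<approx>\<^sub>D\<close> in place of equality.\<close>

lemma opT_0:
  assumes Z: "Z \<in> Eul"
  shows "opT 0 Z \<approx>\<^sub>D Z"
proof -
  obtain u \<rho> \<mu> where Z': "Z = (u, \<rho>, \<mu>)" by (cases Z)
  obtain y y' U' where L: "mapL Z = (y, \<lambda>\<xi>. u (y \<xi>), \<lambda>\<xi>. \<xi> - y \<xi>, \<lambda>\<xi>. \<rho> (y \<xi>) * wderiv y \<xi>)"
    "lag y y' (\<lambda>\<xi>. u (y \<xi>)) U' (\<lambda>\<xi>. \<xi> - y \<xi>) (\<lambda>\<xi>. 1 - y' \<xi>) (\<lambda>\<xi>. \<rho> (y \<xi>) * wderiv y \<xi>)"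
    "distr (density lborel (\<lambda>\<xi>. ennreal (1 - y' \<xi>))) borel y = \<mu>" "y = cumulative.y \<mu>"
    unfolding Z' by (rule mapL_lag[OF Z[unfolded Z']]) (rule that[unfolded Z'])
  let ?r = "\<lambda>\<xi>. \<rho> (y \<xi>) * wderiv y \<xi>"
  interpret lag y y' "\<lambda>\<xi>. u (y \<xi>)" U' "\<lambda>\<xi>. \<xi> - y \<xi>" "\<lambda>\<xi>. 1 - y' \<xi>" ?r by fact
  obtain u2 \<rho>2 \<mu>2 where M: "mapM (y, \<lambda>\<xi>. u (y \<xi>), \<lambda>\<xi>. \<xi> - y \<xi>, ?r) = (u2, \<rho>2, \<mu>2)" "\<And>\<xi>. u2 (y \<xi>) = u (y \<xi>)" 
    "is_push_density y ?r \<rho>2" "AE \<xi> in lborel. \<rho>2 (y \<xi>) * y' \<xi> = ?r \<xi>"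
    "\<mu>2 = distr (density lborel (\<lambda>\<xi>. ennreal (1 - y' \<xi>))) borel y" "(u2, \<rho>2, \<mu>2) \<in> Eul"
    by (rule mapM_Eul) (rule that)
  have \<rho>: "\<rho> \<in> L2" using Z Z' by (auto simp: Eul_def)
  then have [measurable]: "\<rho> \<in> borel_measurable borel" by (simp add: L2_def)
  have "is_push_density y ?r \<rho>"
  proof (rule push_density)
    show "AE \<xi> in lborel. \<rho> (y \<xi>) * y' \<xi> = \<rho> (y \<xi>) * wderiv y \<xi>"
      using prim_wderiv(3)[OF prim] by eventually_elim simp
  qed (use \<rho> locint_L2 r_meas in auto)
  then have "AE x in lborel. \<rho>2 x = \<rho> x" using is_push_density_unique M(3) by blast
  moreover have "u2 = u" using M(2) by (metis ext linv(2))
  moreover have "opT 0 Z = (u2, \<rho>2, \<mu>2)" unfolding opT_def L(1) flowS_0 M(1) ..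
  ultimately show ?thesis unfolding Z' using L(3) M(5) by simp
qed

lemma opT_opT:
  assumes Z: "Z \<in> Eul" and t: "0 \<le> t" "0 \<le> s"
  shows "opT t (opT s Z) = opT (t + s) Z"
proof -
  obtain y y' U U' H H' r where L: "mapL Z = (y, U, H, r)" "lag y y' U U' H H' r" "\<And>\<xi>. y \<xi> + H \<xi> = \<xi>"
    by (rule mapL_lag0[OF Z]) (rule that)
  obtain ys ys' Us Us' Hs' where s: "flowS s (y, U, H, r) = (ys, Us, H, r)" "lag ys ys' Us Us' H Hs' r"
    "AE \<xi> in lborel. exp (-s) * (y' \<xi> + H' \<xi>) \<le> ys' \<xi> + Hs' \<xi>"
    by (rule flowS_lag[OF L(2) t(2)]) (rule that)
  interpret s: lag ys ys' Us Us' H Hs' r by (rule s(2))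
  obtain c where "c > 0" "AE \<xi> in lborel. c \<le> ys' \<xi> + Hs' \<xi>" using s.lower by blast
  from s.relab_sum[OF this] obtain q' where q: "relab (\<lambda>\<xi>. ys \<xi> + H \<xi>) q'" by blast
  interpret q: relab "\<lambda>\<xi>. ys \<xi> + H \<xi>" q' by (rule q)
  define h where "h = q.linv"
  obtain rL where rL: "mapL (mapM (ys, Us, H, r)) = (\<lambda>\<xi>. ys (h \<xi>), \<lambda>\<xi>. Us (h \<xi>), \<lambda>\<xi>. H (h \<xi>), rL)"
    "AE \<xi> in lborel. rL \<xi> = r (h \<xi>) * (1 / q' (h \<xi>))" "rL \<in> borel_measurable borel"
    by (rule s.mapL_mapM[OF q h_def]) (rule that)
  have h: "relab h (\<lambda>x. 1 / q' (h x))" unfolding h_def by (rule q.relab_linv)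
  obtain yt yt' Ut Ut' Ht' where f: "flowS t (ys, Us, H, r) = (yt, Ut, H, r)" "lag yt yt' Ut Ut' H Ht' r"
    "AE \<xi> in lborel. exp (-t) * (ys' \<xi> + Hs' \<xi>) \<le> yt' \<xi> + Ht' \<xi>"
    by (rule flowS_lag[OF s(2) t(1)]) (rule that)
  have "opT t (opT s Z) = mapM (flowS t (\<lambda>\<xi>. ys (h \<xi>), \<lambda>\<xi>. Us (h \<xi>), \<lambda>\<xi>. H (h \<xi>), rL))"
    unfolding opT_def[of t] opT_def[of s] L(1) s(1) rL(1) ..
  also have "\<dots> = mapM (yt, Ut, H, r)"
    unfolding flowS_relabel[OF s(2) h f(1)] by (rule lag.mapM_relabel[OF f(2) h rL(3,2)])
  also have "\<dots> = opT (t + s) Z"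
    unfolding opT_def[of "t + s"] L(1) flowS_flowS[OF s(1), symmetric] f(1) ..
  finally show ?thesis .
qed

subsection \<open>The Lipschitz estimate\<close>

lemma normE_nonneg: "0 \<le> normE f"
  by (simp add: normE_def norminf_nonneg norm2_nonneg)

lemma normB_nonneg: "0 \<le> normB X"
  by (cases X) (simp add: normE_nonneg norm2_nonneg)

lemma E2_meas: "f \<in> E2 \<Longrightarrow> f \<in> borel_measurable borel"
  by (auto simp: E2_def intro: borel_measurable_continuous_onI)

lemma E2_add:
  assumes f: "f \<in> E2" and g: "g \<in> E2"
  shows "(\<lambda>x. f x + g x) \<in> E2" "normE (\<lambda>x. f x + g x) \<le> normE f + normE g"
proof -
  note [measurable] = E2_meas[OF f] E2_meas[OF g]
  note p = prim_add[OF E2D(1)[OF f] E2D(1)[OF g]]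
  have b: "\<bar>f x + g x\<bar> \<le> norminf f + norminf g" for x
    using E2D(3)[OF f, of x] E2D(3)[OF g, of x] by linarith
  show "(\<lambda>x. f x + g x) \<in> E2"
    using E2I[OF p b L2_add[OF E2D(2)[OF f] E2D(2)[OF g]]] .
  have "norminf (\<lambda>x. f x + g x) \<le> norminf f + norminf g"
    using b by (intro LinfI(2)) auto
  then show "normE (\<lambda>x. f x + g x) \<le> normE f + normE g"
    using norm2_triangle[OF E2D(2)[OF f] E2D(2)[OF g]] unfolding normE_prim[OF p] by (simp add: normE_def)
qed

lemma E2_cmult:
  assumes f: "f \<in> E2"
  shows "(\<lambda>x. c * f x) \<in> E2" "normE (\<lambda>x. c * f x) \<le> \<bar>c\<bar> * normE f"
proof -
  note [measurable] = E2_meas[OF f]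
  note p = prim_cmult[OF E2D(1)[OF f], of c]
  have b: "\<bar>c * f x\<bar> \<le> \<bar>c\<bar> * norminf f" for x
    using E2D(3)[OF f, of x] by (simp add: abs_mult mult_left_mono)
  show "(\<lambda>x. c * f x) \<in> E2"
    using E2I[OF p b L2_cmult[OF E2D(2)[OF f]]] .
  have "norminf (\<lambda>x. c * f x) \<le> \<bar>c\<bar> * norminf f"
    using b by (intro LinfI(2)) auto
  then show "normE (\<lambda>x. c * f x) \<le> \<bar>c\<bar> * normE f"
    unfolding normE_prim[OF p] norm2_cmult by (simp add: normE_def distrib_left)
qed

lemma E2_diff: "f \<in> E2 \<Longrightarrow> g \<in> E2 \<Longrightarrow> (\<lambda>x. f x - g x) \<in> E2"
  using E2_add(1)[of f "\<lambda>x. (-1) * g x"] E2_cmult(1)[of g "-1"] by simp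

lemma normE_minus_commute:
  assumes "(\<lambda>x. f x - g x) \<in> E2"
  shows "normE (\<lambda>x. g x - f x) = normE (\<lambda>x. f x - g x)"
proof (rule antisym)
  have eq: "(\<lambda>x. g x - f x) = (\<lambda>x. (-1) * (f x - g x))" "(\<lambda>x. f x - g x) = (\<lambda>x. (-1) * (g x - f x))" by auto
  have "(\<lambda>x. g x - f x) \<in> E2" unfolding eq(1) by (rule E2_cmult(1)[OF assms])
  from E2_cmult(2)[OF this, of "-1"] show "normE (\<lambda>x. f x - g x) \<le> normE (\<lambda>x. g x - f x)" by simp
  from E2_cmult(2)[OF assms, of "-1"] show "normE (\<lambda>x. g x - f x) \<le> normE (\<lambda>x. f x - g x)" by simp
qed

lemma E2_const: "(\<lambda>x. c) \<in> E2" "normE (\<lambda>x. c) \<le> \<bar>c\<bar>"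
proof -
  show "(\<lambda>x. c) \<in> E2" by (rule E2I[OF prim_const, of _ "\<bar>c\<bar>"]) (auto simp: L2_def)
  have "norm2 (\<lambda>x. 0) = 0" by (simp add: norm2_def)
  moreover have "norminf (\<lambda>x. c) \<le> \<bar>c\<bar>" by (rule LinfI(2)) auto
  ultimately show "normE (\<lambda>x. c) \<le> \<bar>c\<bar>" unfolding normE_prim[OF prim_const] by simp
qed

context relab
begin

text \<open>The supremum does not grow; \<open>1 \<le> K\<close> lets both parts of the norm share
  the factor \<open>sqrt K\<close>.\<close>

lemma E2_comp:
  assumes f: "f \<in> E2" 
  shows "(\<lambda>\<xi>. f (y \<xi>)) \<in> E2"
    "(\<And>\<xi>. y' \<xi> \<le> K) \<Longrightarrow> 1 \<le> K \<Longrightarrow> normE (\<lambda>\<xi>. f (y \<xi>)) \<le> sqrt K * normE f"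
proof -
  note p = prim_comp[OF E2D(1)[OF f]]
  note [measurable] = E2_meas[OF f]
  obtain K0 where K0: "\<And>\<xi>. y' \<xi> \<le> K0" using upper by blast
  show "(\<lambda>\<xi>. f (y \<xi>)) \<in> E2"
    by (rule E2I[OF p _ L2_comp(1)[OF E2D(2)[OF f] K0]]) (rule E2D(3)[OF f])
  assume K: "\<And>\<xi>. y' \<xi> \<le> K" "1 \<le> K"
  have "norminf (\<lambda>\<xi>. f (y \<xi>)) \<le> norminf f"
    by (rule LinfI(2)) (auto simp: E2D(3)[OF f])
  also have "\<dots> \<le> sqrt K * norminf f"
    using K(2) norminf_nonneg[of f] mult_right_mono[of 1 "sqrt K" "norminf f"] by simp
  finally show "normE (\<lambda>\<xi>. f (y \<xi>)) \<le> sqrt K * normE f"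
    using L2_comp(2)[OF E2D(2)[OF f] K(1)] unfolding normE_prim[OF p] by (simp add: normE_def distrib_left)
qed

lemma minus_id_E2: "(\<lambda>\<xi>. y \<xi> - \<xi>) \<in> E2"
  using bdd E2I[OF prim_diff[OF prim prim_id] _ L2] by blast

end

text \<open>\<open>y\<close> and \<open>z\<close> themselves are unbounded; their difference is
  assembled from \<open>(y - id) \<circ> f\<close>, \<open>f - id\<close> and
  \<open>z - id\<close>.\<close>

lemma relabel_diff_in_spaceB:
  assumes X: "lag y y' U U' H H' r" and Y: "lag z z' V V' G G' s" and f: "f \<in> relabG"
  shows "(\<lambda>\<xi>. y (f \<xi>) - z \<xi>) \<in> E2" "(\<lambda>\<xi>. U (f \<xi>) - V \<xi>) \<in> E2" "(\<lambda>\<xi>. H (f \<xi>) - G \<xi>) \<in> E2"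
    "(\<lambda>\<xi>. r (f \<xi>) * wderiv f \<xi> - s \<xi>) \<in> L2"
proof -
  interpret X: lag y y' U U' H H' r by fact
  interpret Y: lag z z' V V' G G' s by fact
  obtain f' where "relab f f'" using relabG_D[OF f] .
  then interpret f: relab f f' .
  have HE: "H \<in> E2" "G \<in> E2" using X.in_spaceB Y.in_spaceB by (auto simp: E1_def)
  have "(\<lambda>\<xi>. ((y (f \<xi>) - f \<xi>) + (f \<xi> - \<xi>)) - (z \<xi> - \<xi>)) \<in> E2"
    by (intro E2_diff E2_add f.E2_comp(1)[OF X.in_spaceB(1)] f.minus_id_E2 Y.in_spaceB(1))
  then show "(\<lambda>\<xi>. y (f \<xi>) - z \<xi>) \<in> E2" by simp
  show "(\<lambda>\<xi>. U (f \<xi>) - V \<xi>) \<in> E2" "(\<lambda>\<xi>. H (f \<xi>) - G \<xi>) \<in> E2"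
    by (intro E2_diff f.E2_comp(1) X.in_spaceB(2) Y.in_spaceB(2) HE)+
  obtain K where K: "\<And>\<xi>. f' \<xi> \<le> K" using f.upper by blast
  have [measurable]: "wderiv f \<in> borel_measurable borel" using primD(2)[OF prim_wderiv(2)[OF f.prim]] .
  have "(\<lambda>\<xi>. r (f \<xi>) * wderiv f \<xi>) \<in> L2"
    by (rule L2_cong_AE(1)[OF f.L2_comp(1)[OF X.L2_r K]])
      (use prim_wderiv(3)[OF f.prim] in \<open>auto elim!: eventually_mono\<close>)
  then show "(\<lambda>\<xi>. r (f \<xi>) * wderiv f \<xi> - s \<xi>) \<in> L2" using Y.L2_r by (rule L2_diff)
qed

lemma prim_sum_id:
  assumes X: "lag y y' U U' H H' r" and s: "\<And>\<xi>. y \<xi> + H \<xi> = \<xi>"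
  shows "AE \<xi> in lborel. y' \<xi> + H' \<xi> = 1"
proof -
  interpret lag y y' U U' H H' r by fact
  have "prim (\<lambda>\<xi>. \<xi>) (\<lambda>\<xi>. y' \<xi> + H' \<xi>)" using prim_add[OF prim pH] by (simp add: s)
  then show ?thesis using prim_unique[OF _ prim_id] by blast
qed

text \<open>The evolved solutions are projected onto \<^const>\<open>Lag0\<close> by relabelling with inverses of
  functions of slope at least \<open>exp (-t)\<close>, which costs a factor \<open>exp (t/2)\<close> in the \<open>L\<^sup>2\<close> norms.\<close>

definition evolve :: "real \<Rightarrow> quad \<Rightarrow> quad" where
  "evolve t X = mapL (mapM (flowS t X))"

text \<open>On \<open>Lag0\<close> the sum \<open>y' + H'\<close> is 1, which turns the lower bound
  of the flow into a slope that is the same for all states. \<open>p\<close> is the sum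
  \<open>y + H\<close> of the evolved state, and its inverse performs the projection.\<close>

lemma evolve_props:
  assumes X: "lag y y' U U' H H' r" and s: "\<And>\<xi>. y \<xi> + H \<xi> = \<xi>" and t: "0 \<le> t"
  obtains yt Ut p p' rL where "flowS t (y, U, H, r) = (yt, Ut, H, r)"
    "relab p p'" "\<And>\<xi>. exp (-t) \<le> p' \<xi>"
    "evolve t (y, U, H, r) = (\<lambda>\<xi>. yt (incr.linv p \<xi>), \<lambda>\<xi>. Ut (incr.linv p \<xi>), \<lambda>\<xi>. H (incr.linv p \<xi>), rL)"
    "AE \<xi> in lborel. rL \<xi> = r (incr.linv p \<xi>) * (1 / p' (incr.linv p \<xi>))" "rL \<in> borel_measurable borel"
    "evolve t (y, U, H, r) \<in> Lag0"
proof -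
  obtain yt yt' Ut Ut' Ht' where f: "flowS t (y, U, H, r) = (yt, Ut, H, r)" "lag yt yt' Ut Ut' H Ht' r"
    "AE \<xi> in lborel. exp (-t) * (y' \<xi> + H' \<xi>) \<le> yt' \<xi> + Ht' \<xi>"
    by (rule flowS_lag[OF X t]) (rule that)
  have e: "0 < exp (-t)" "AE \<xi> in lborel. exp (-t) \<le> yt' \<xi> + Ht' \<xi>"
    using f(3) prim_sum_id[OF X s] by (simp, eventually_elim) simp
  obtain p' where p: "relab (\<lambda>\<xi>. yt \<xi> + H \<xi>) p'" "AE \<xi> in lborel. p' \<xi> = yt' \<xi> + Ht' \<xi>" "\<And>\<xi>. exp (-t) \<le> p' \<xi>"
    by (rule lag.relab_sum[OF f(2) e]) (rule that)
  define h where "h = incr.linv (\<lambda>\<xi>. yt \<xi> + H \<xi>)"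
  obtain rL where rL: "mapL (mapM (yt, Ut, H, r)) = (\<lambda>\<xi>. yt (h \<xi>), \<lambda>\<xi>. Ut (h \<xi>), \<lambda>\<xi>. H (h \<xi>), rL)"
    "AE \<xi> in lborel. rL \<xi> = r (h \<xi>) * (1 / p' (h \<xi>))" "rL \<in> borel_measurable borel"
    by (rule lag.mapL_mapM[OF f(2) p(1) h_def]) (rule that)
  have "mapM (yt, Ut, H, r) \<in> Eul" by (rule lag.mapM_Eul[OF f(2)]) simp
  then have L0: "mapL (mapM (yt, Ut, H, r)) \<in> Lag0"
    by (rule mapL_lag0) (use lag.in_Lag in \<open>auto simp: Lag0_def\<close>)
  have ev: "evolve t (y, U, H, r) = mapL (mapM (yt, Ut, H, r))" unfolding evolve_def f(1) ..
  show ?thesis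
    by (rule that[OF f(1) p(1,3) rL(1)[folded ev, unfolded h_def] rL(2)[unfolded h_def] rL(3) L0[folded ev]])
qed

lemma Lag0_D:
  assumes "X \<in> Lag0"
  obtains y y' U U' H H' r where "X = (y, U, H, r)" "lag y y' U U' H H' r" "\<And>\<xi>. y \<xi> + H \<xi> = \<xi>"
proof -
  obtain y U H r where X: "X = (y, U, H, r)" by (cases X)
  have "(y, U, H, r) \<in> Lag" "\<And>\<xi>. y \<xi> + H \<xi> = \<xi>" using assms by (auto simp: Lag0_def X)
  then show ?thesis using Lag_D that X by metis
qed

text \<open>\<open>d1\<close>, \<open>d2\<close>, \<open>d3\<close> stand for the differences of two
  states and \<open>l\<close> for that of their asymptotic energies, so adding \<open>l / 2\<close>
  to \<open>d3\<close> costs at most a factor 3/2. The resulting coefficients of the three norms are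
  1, \<open>1 + t\<close> and \<open>1 + 3/4 * t + 3/8 * t\<^sup>2\<close>, all at most
  \<open>1 + t + t\<^sup>2/2\<close>.\<close>

lemma flow_norm_bound:
  assumes d: "d1 \<in> E2" "d2 \<in> E2" "d3 \<in> E2" and l: "\<bar>l\<bar> \<le> norminf d3" and t: "0 \<le> t"
  shows "(\<lambda>x. t\<^sup>2/4 * (d3 x + l/2) + (t * d2 x + d1 x)) \<in> E2" 
    "(\<lambda>x. t/2 * (d3 x + l/2) + d2 x) \<in> E2"
    "normE (\<lambda>x. t\<^sup>2/4 * (d3 x + l/2) + (t * d2 x + d1 x)) + normE (\<lambda>x. t/2 * (d3 x + l/2) + d2 x) + normE d3
       \<le> (1/2 * t\<^sup>2 + t + 1) * (normE d1 + normE d2 + normE d3)"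
proof -
  note d3 = E2_add[OF d(3) E2_const(1)[of "l/2"]]
  have n3: "normE (\<lambda>x. d3 x + l/2) \<le> 3/2 * normE d3"
    using d3(2) E2_const(2)[of "l/2"] l norm2_nonneg[of "wderiv d3"] unfolding normE_def[of d3] by (simp add: field_simps)
  note a = E2_cmult[OF d3(1), of "t\<^sup>2/4"] E2_cmult[OF d3(1), of "t/2"] E2_cmult[OF d(2), of t]
  note b = E2_add[OF a(5) d(1)]
  note c = E2_add[OF a(1) b(1)]
  note e = E2_add[OF a(3) d(2)]
  show "(\<lambda>x. t\<^sup>2/4 * (d3 x + l/2) + (t * d2 x + d1 x)) \<in> E2" "(\<lambda>x. t/2 * (d3 x + l/2) + d2 x) \<in> E2"
    using c(1) e(1) .
  have 1: "normE (\<lambda>x. t\<^sup>2/4 * (d3 x + l/2) + (t * d2 x + d1 x)) \<le> t\<^sup>2/4 * (3/2 * normE d3) + (t * normE d2 + normE d1)"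
    using c(2) b(2) a(2) a(6) mult_left_mono[OF n3, of "t\<^sup>2/4"] t by simp
  have 2: "normE (\<lambda>x. t/2 * (d3 x + l/2) + d2 x) \<le> t/2 * (3/2 * normE d3) + normE d2"
    using e(2) a(4) mult_left_mono[OF n3, of "t/2"] t by simp
  have pos: "0 \<le> t * normE d1" "0 \<le> t\<^sup>2 * normE d1" "0 \<le> t\<^sup>2 * normE d2" "0 \<le> t\<^sup>2 * normE d3" "0 \<le> t * normE d3"
    using t normE_nonneg by simp_all
  have expand: "(1/2 * t\<^sup>2 + t + 1) * (a + b + c)
      = 1/2 * (t\<^sup>2 * a) + 1/2 * (t\<^sup>2 * b) + 1/2 * (t\<^sup>2 * c) + t * a + t * b + t * c + a + b + c" for a b c :: real
    by (simp add: algebra_simps)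
  have coeff: "t\<^sup>2/4 * (3/2 * c) = 3/8 * (t\<^sup>2 * c)" "t/2 * (3/2 * c) = 3/4 * (t * c)" for c :: real
    by simp_all
  show "normE (\<lambda>x. t\<^sup>2/4 * (d3 x + l/2) + (t * d2 x + d1 x)) + normE (\<lambda>x. t/2 * (d3 x + l/2) + d2 x) + normE d3
       \<le> (1/2 * t\<^sup>2 + t + 1) * (normE d1 + normE d2 + normE d3)"
    using 1 2 pos unfolding expand coeff by linarith
qed

lemma evolve_contraction:
  assumes X: "X \<in> Lag0" and Y: "Y \<in> Lag0" and t: "0 \<le> t" and f: "f \<in> relabG"
  obtains g where "g \<in> relabG" "normB (quad_diff (evolve t X \<bullet>\<^sub>G g) (evolve t Y)) 
     \<le> exp (1/2 * t) * (1/2 * t\<^sup>2 + t + 1) * normB (quad_diff (X \<bullet>\<^sub>G f) Y)"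
proof -
  obtain y y' U U' H H' r where X: "X = (y, U, H, r)" "lag y y' U U' H H' r" "\<And>\<xi>. y \<xi> + H \<xi> = \<xi>"
    by (rule Lag0_D[OF X]) (rule that)
  obtain z z' V V' G G' s where Y: "Y = (z, V, G, s)" "lag z z' V V' G G' s" "\<And>\<xi>. z \<xi> + G \<xi> = \<xi>"
    by (rule Lag0_D[OF Y]) (rule that)
  obtain yt Ut p p' rX where eX: "flowS t (y, U, H, r) = (yt, Ut, H, r)"
    "relab p p'" "\<And>\<xi>. exp (-t) \<le> p' \<xi>"
    "evolve t (y, U, H, r) = (\<lambda>\<xi>. yt (incr.linv p \<xi>), \<lambda>\<xi>. Ut (incr.linv p \<xi>), \<lambda>\<xi>. H (incr.linv p \<xi>), rX)"
    "AE \<xi> in lborel. rX \<xi> = r (incr.linv p \<xi>) * (1 / p' (incr.linv p \<xi>))" "rX \<in> borel_measurable borel"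
    "evolve t (y, U, H, r) \<in> Lag0"
    by (rule evolve_props[OF X(2,3) t]) (rule that)
  obtain zt Vt q q' rY where eY: "flowS t (z, V, G, s) = (zt, Vt, G, s)"
    "relab q q'" "\<And>\<xi>. exp (-t) \<le> q' \<xi>"
    "evolve t (z, V, G, s) = (\<lambda>\<xi>. zt (incr.linv q \<xi>), \<lambda>\<xi>. Vt (incr.linv q \<xi>), \<lambda>\<xi>. G (incr.linv q \<xi>), rY)"
    "AE \<xi> in lborel. rY \<xi> = s (incr.linv q \<xi>) * (1 / q' (incr.linv q \<xi>))" "rY \<in> borel_measurable borel"
    "evolve t (z, V, G, s) \<in> Lag0"
    by (rule evolve_props[OF Y(2,3) t]) (rule that)
  interpret X: lag y y' U U' H H' r by (rule X(2))
  interpret Y: lag z z' V V' G G' s by (rule Y(2))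
  interpret p: relab p p' by (rule eX(2))
  interpret q: relab q q' by (rule eY(2))
  obtain f' where "relab f f'" using relabG_D[OF f] .
  then interpret f: relab f f' .
  define k where "k = q.linv"
  define k' where "k' \<xi> = 1 / q' (k \<xi>)" for \<xi>
  interpret k: relab k k' unfolding k_def k'_def[abs_def] by (rule q.relab_linv)
  \<comment> \<open>\<open>p\<close> cancels against its inverse in the projected \<open>X\<close>,
    so that the unprojected states are compared at \<open>f (k \<xi>)\<close> and at
    \<open>k \<xi>\<close>; composition with \<open>k\<close> is all that remains.\<close>
  define g where "g \<xi> = p (f (k \<xi>))" for \<xi>
  define g' where "g' \<xi> = p' (f (k \<xi>)) * (f' (k \<xi>) * k' \<xi>)" for \<xi>
  have "relab (\<lambda>\<xi>. f (k \<xi>)) (\<lambda>\<xi>. f' (k \<xi>) * k' \<xi>)" by (rule k.relab_comp) unfold_locales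
  then have "relab g g'" unfolding g_def[abs_def] g'_def[abs_def]
    by (rule relab.relab_comp) unfold_locales
  then interpret g: relab g g' .
  have pg: "p.linv (g \<xi>) = f (k \<xi>)" for \<xi> by (simp add: g_def)
  have kK: "k' \<xi> \<le> exp t" for \<xi>
    using eY(3)[of "k \<xi>"] q.pos[of "k \<xi>"] by (simp add: k'_def exp_minus field_simps)
  have eK: "1 \<le> exp t" "sqrt (exp t) = exp (1/2 * t)"
    using t by (auto simp: real_sqrt_unique power2_eq_square mult_exp_exp)
  define d1 where "d1 \<xi> = y (f \<xi>) - z \<xi>" for \<xi>
  define d2 where "d2 \<xi> = U (f \<xi>) - V \<xi>" for \<xi>
  define d3 where "d3 \<xi> = H (f \<xi>) - G \<xi>" for \<xi>
  define d4 where "d4 \<xi> = r (f \<xi>) * wderiv f \<xi> - s \<xi>" for \<xi>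
  note d = relabel_diff_in_spaceB[OF X(2) Y(2) f, folded d1_def[abs_def] d2_def[abs_def] d3_def[abs_def] d4_def[abs_def]]
  define l where "l = Lim at_top G - Lim at_top H"
  \<comment> \<open>Relabelling does not move infinity, so the difference of the asymptotic energies
    is a limit of \<open>d3\<close> up to sign and is controlled by its supremum.\<close>
  have l: "\<bar>l\<bar> \<le> norminf d3"
  proof (rule tendsto_upperbound)
    have "((\<lambda>\<xi>. H (f \<xi>)) \<longlongrightarrow> Lim at_top H) at_top"
      by (rule filterlim_compose[OF X.H_lim f.at_top])
    then have "((\<lambda>\<xi>. \<bar>d3 \<xi>\<bar>) \<longlongrightarrow> \<bar>Lim at_top H - Lim at_top G\<bar>) at_top"
      unfolding d3_def by (intro tendsto_intros Y.H_lim)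
    then show "((\<lambda>\<xi>. \<bar>d3 \<xi>\<bar>) \<longlongrightarrow> \<bar>l\<bar>) at_top" by (simp add: l_def abs_minus_commute)
    show "\<forall>\<^sub>F \<xi> in at_top. \<bar>d3 \<xi>\<bar> \<le> norminf d3" using E2D(3)[OF d(3)] by simp
  qed simp
  define e1 where "e1 x = t\<^sup>2/4 * (d3 x + l/2) + (t * d2 x + d1 x)" for x
  define e2 where "e2 x = t/2 * (d3 x + l/2) + d2 x" for x
  note e = flow_norm_bound[OF d(1-3) l t, folded e1_def[abs_def] e2_def[abs_def]]
  have yt: "yt = (\<lambda>\<xi>. 1/4 * (H \<xi> - 1/2 * Lim at_top H) * t\<^sup>2 + U \<xi> * t + y \<xi>)"
    and Ut: "Ut = (\<lambda>\<xi>. 1/2 * (H \<xi> - 1/2 * Lim at_top H) * t + U \<xi>)"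
    using eX(1) by (auto simp: Let_def)
  have zt: "zt = (\<lambda>\<xi>. 1/4 * (G \<xi> - 1/2 * Lim at_top G) * t\<^sup>2 + V \<xi> * t + z \<xi>)"
    and Vt: "Vt = (\<lambda>\<xi>. 1/2 * (G \<xi> - 1/2 * Lim at_top G) * t + V \<xi>)"
    using eY(1) by (auto simp: Let_def)
  have c1: "yt (f x) - zt x = e1 x" for x
    unfolding yt zt e1_def d1_def d2_def d3_def l_def by (simp add: field_simps)
  have c2: "Ut (f x) - Vt x = e2 x" for x
    unfolding Ut Vt e2_def d2_def d3_def l_def by (simp add: field_simps)
  define e4 where "e4 \<xi> = rX (g \<xi>) * wderiv g \<xi> - rY \<xi>" for \<xi>
  have diff: "quad_diff (evolve t X \<bullet>\<^sub>G g) (evolve t Y) = (\<lambda>\<xi>. e1 (k \<xi>), \<lambda>\<xi>. e2 (k \<xi>), \<lambda>\<xi>. d3 (k \<xi>), e4)"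
    unfolding X(1) Y(1) eX(4) eY(4)
    by (simp add: pg o_def c1 c2 d3_def k_def[symmetric] e4_def[abs_def])
  \<comment> \<open>The flow does not act on the fourth component; the factor \<open>p'\<close>
    coming from \<open>wderiv g\<close> cancels the one from the projection.\<close>
  have AE4: "AE \<xi> in lborel. d4 (k \<xi>) * k' \<xi> = e4 \<xi>"
    using g.AE_subst[OF eX(5)] k.AE_subst[OF prim_wderiv(3)[OF f.prim]] prim_wderiv(3)[OF g.prim] eY(5)
  proof eventually_elim
    case (elim \<xi>)
    have nz: "g' \<xi> \<noteq> 0" "k' \<xi> \<noteq> 0" "p' (f (k \<xi>)) \<noteq> 0" using g.pos[of \<xi>] k.pos[of \<xi>] p.pos[of "f (k \<xi>)"] by auto
    have "rX (g \<xi>) = r (f (k \<xi>)) * (1 / p' (f (k \<xi>)))" using elim(1) nz(1) by (simp add: pg)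
    then have "rX (g \<xi>) * wderiv g \<xi> = r (f (k \<xi>)) * (f' (k \<xi>) * k' \<xi>)"
      unfolding elim(3) g'_def using nz(3) by simp
    moreover have "wderiv f (k \<xi>) = f' (k \<xi>)" using elim(2) nz(2) by blast
    moreover have "rY \<xi> = s (k \<xi>) * k' \<xi>" using elim(4) by (simp add: k_def[symmetric] k'_def)
    ultimately show ?case by (simp add: d4_def e4_def algebra_simps)
  qed
  have [measurable]: "wderiv g \<in> borel_measurable borel" "rX \<in> borel_measurable borel" "rY \<in> borel_measurable borel"
    using primD(2)[OF prim_wderiv(2)[OF g.prim]] eX(6) eY(6) by auto
  have "e4 \<in> borel_measurable borel" unfolding e4_def[abs_def] by measurable
  from L2_cong_AE(2)[OF k.L2_comp(1)[OF d(4) kK] AE4 this]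
  have n4: "norm2 e4 \<le> exp (1/2 * t) * norm2 d4"
    using k.L2_comp(2)[OF d(4) kK] by (simp add: eK)
  have "normB (quad_diff (evolve t X \<bullet>\<^sub>G g) (evolve t Y)) 
     = normE (\<lambda>\<xi>. e1 (k \<xi>)) + normE (\<lambda>\<xi>. e2 (k \<xi>)) + normE (\<lambda>\<xi>. d3 (k \<xi>)) + norm2 e4"
    by (simp add: diff)
  also have "\<dots> \<le> exp (1/2 * t) * normE e1 + exp (1/2 * t) * normE e2 + exp (1/2 * t) * normE d3 + exp (1/2 * t) * norm2 d4"
    using k.E2_comp(2)[OF e(1) kK eK(1)] k.E2_comp(2)[OF e(2) kK eK(1)] k.E2_comp(2)[OF d(3) kK eK(1)] n4
    unfolding eK(2) by linarith
  also have "\<dots> = exp (1/2 * t) * (normE e1 + normE e2 + normE d3 + norm2 d4)" by (simp add: algebra_simps)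
  also have "\<dots> \<le> exp (1/2 * t) * ((1/2 * t\<^sup>2 + t + 1) * (normE d1 + normE d2 + normE d3) + (1/2 * t\<^sup>2 + t + 1) * norm2 d4)"
  proof (rule mult_left_mono)
    have "norm2 d4 \<le> (1/2 * t\<^sup>2 + t + 1) * norm2 d4"
      using t norm2_nonneg[of d4] mult_right_mono[of 1 "1/2 * t\<^sup>2 + t + 1" "norm2 d4"] by simp
    then show "normE e1 + normE e2 + normE d3 + norm2 d4 \<le> (1/2 * t\<^sup>2 + t + 1) * (normE d1 + normE d2 + normE d3) + (1/2 * t\<^sup>2 + t + 1) * norm2 d4"
      using e(3) by linarith
  qed simp
  also have "\<dots> = exp (1/2 * t) * (1/2 * t\<^sup>2 + t + 1) * normB (quad_diff (X \<bullet>\<^sub>G f) Y)"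
    unfolding X(1) Y(1)
    by (simp add: o_def d1_def[abs_def] d2_def[abs_def] d3_def[abs_def] d4_def[abs_def] algebra_simps)
  finally show ?thesis using that g.in_relabG by blast
qed

text \<open>Lets the second summand of \<open>J\<close>, which relabels \<open>Y\<close>, be treated
  by \<open>evolve_contraction\<close> with the two states exchanged.\<close>

lemma normB_minus_commute:
  assumes X: "X \<in> Lag0" and Y: "Y \<in> Lag0" and f: "f \<in> relabG"
  shows "normB (quad_diff Y (X \<bullet>\<^sub>G f)) = normB (quad_diff (X \<bullet>\<^sub>G f) Y)"
proof -
  obtain y y' U U' H H' r where X: "X = (y, U, H, r)" "lag y y' U U' H H' r" "\<And>\<xi>. y \<xi> + H \<xi> = \<xi>"
    by (rule Lag0_D[OF X]) (rule that)
  obtain z z' V V' G G' s where Y: "Y = (z, V, G, s)" "lag z z' V V' G G' s" "\<And>\<xi>. z \<xi> + G \<xi> = \<xi>"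
    by (rule Lag0_D[OF Y]) (rule that)
  have n: "norm2 (\<lambda>\<xi>. a \<xi> - b \<xi>) = norm2 (\<lambda>\<xi>. b \<xi> - a \<xi>)" for a b
    by (simp add: norm2_def power2_commute)
  note d = relabel_diff_in_spaceB[OF X(2) Y(2) f]
  show ?thesis unfolding X(1) Y(1)
    using normE_minus_commute[OF d(1)] normE_minus_commute[OF d(2)] normE_minus_commute[OF d(3)]
    by (simp add: n[of s])
qed

lemma id_in_relabG: "(\<lambda>x. x) \<in> relabG"
  using relab.in_relabG[OF relab_id] .

section \<open>From norms of differences to \<open>J\<close>, and from \<open>J\<close> to the
  metric\<close>

lemma distJ_lower: 
  assumes "f \<in> relabG" "g \<in> relabG"
  shows "distJ X Y \<le> normB (quad_diff (X \<bullet>\<^sub>G f) Y) + normB (quad_diff X (Y \<bullet>\<^sub>G g))"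
  unfolding distJ_def
  by (rule cINF_lower2[of _ _ "(f, g)"]) 
    (use assms in \<open>auto intro!: bdd_belowI[of _ 0] add_nonneg_nonneg normB_nonneg\<close>)

lemma distJ_greatest:
  assumes "\<And>f g. f \<in> relabG \<Longrightarrow> g \<in> relabG \<Longrightarrow> c \<le> normB (quad_diff (X \<bullet>\<^sub>G f) Y) + normB (quad_diff X (Y \<bullet>\<^sub>G g))"
  shows "c \<le> distJ X Y"
  unfolding distJ_def
  by (rule cINF_greatest) (use assms id_in_relabG in auto)

lemma distJ_nonneg: "0 \<le> distJ X Y"
  by (rule distJ_greatest) (intro add_nonneg_nonneg normB_nonneg)

lemma evolve_Lag0:
  assumes X: "X \<in> Lag0" and t: "0 \<le> t"
  shows "evolve t X \<in> Lag0"
proof -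
  obtain y y' U U' H H' r where X: "X = (y, U, H, r)" "lag y y' U U' H H' r" "\<And>\<xi>. y \<xi> + H \<xi> = \<xi>"
    by (rule Lag0_D[OF X]) (rule that)
  show ?thesis unfolding X(1) by (rule evolve_props[OF X(2,3) t])
qed

text \<open>Each pair of relabellings of the initial states yields a pair for the evolved ones.
  Dividing by the positive constant \<open>C\<close> makes the claim a lower bound for an
  infimum.\<close>

lemma distJ_evolve:
  assumes X: "X \<in> Lag0" and Y: "Y \<in> Lag0" and t: "0 \<le> t"
  shows "distJ (evolve t X) (evolve t Y) \<le> exp (1/2 * t) * (1/2 * t\<^sup>2 + t + 1) * distJ X Y"
proof -
  define C where "C = exp (1/2 * t) * (1/2 * t\<^sup>2 + t + 1)"
  have C: "C > 0" unfolding C_def using t by (intro mult_pos_pos) (auto intro!: add_nonneg_pos)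
  have "distJ (evolve t X) (evolve t Y) / C \<le> distJ X Y"
  proof (rule distJ_greatest)
    fix f g assume f: "f \<in> relabG" and g: "g \<in> relabG"
    obtain f2 where f2: "f2 \<in> relabG" "normB (quad_diff (evolve t X \<bullet>\<^sub>G f2) (evolve t Y)) \<le> C * normB (quad_diff (X \<bullet>\<^sub>G f) Y)"
      unfolding C_def by (rule evolve_contraction[OF X Y t f]) (rule that[unfolded C_def])
    obtain g2 where g2: "g2 \<in> relabG" "normB (quad_diff (evolve t Y \<bullet>\<^sub>G g2) (evolve t X)) \<le> C * normB (quad_diff (Y \<bullet>\<^sub>G g) X)"
      unfolding C_def by (rule evolve_contraction[OF Y X t g]) (rule that[unfolded C_def])
    have "distJ (evolve t X) (evolve t Y) \<le> normB (quad_diff (evolve t X \<bullet>\<^sub>G f2) (evolve t Y)) + normB (quad_diff (evolve t X) (evolve t Y \<bullet>\<^sub>G g2))"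
      by (rule distJ_lower[OF f2(1) g2(1)])
    also have "\<dots> \<le> C * (normB (quad_diff (X \<bullet>\<^sub>G f) Y) + normB (quad_diff X (Y \<bullet>\<^sub>G g)))"
      using f2(2) g2(2) normB_minus_commute[OF Y X g] 
        normB_minus_commute[OF evolve_Lag0[OF Y t] evolve_Lag0[OF X t] g2(1)]
      by (simp add: distrib_left)
    finally show "distJ (evolve t X) (evolve t Y) / C \<le> normB (quad_diff (X \<bullet>\<^sub>G f) Y) + normB (quad_diff X (Y \<bullet>\<^sub>G g))"
      using C by (simp add: divide_le_eq mult.commute)
  qed
  then show ?thesis using C unfolding C_def[symmetric] by (simp add: divide_le_eq mult.commute)
qed

text \<open>Evolving every member of a chain gives a chain in \<open>Lag0\<close> between the
  evolved endpoints, so the bound for \<open>J\<close> applies link by link.\<close>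

lemma distLag_evolve:
  assumes X: "X \<in> Lag0" and Y: "Y \<in> Lag0" and t: "0 \<le> t"
  shows "distLag (evolve t X) (evolve t Y) \<le> exp (1/2 * t) * (1/2 * t\<^sup>2 + t + 1) * distLag X Y"
proof -
  define C where "C = exp (1/2 * t) * (1/2 * t\<^sup>2 + t + 1)"
  have C: "C > 0" unfolding C_def using t by (intro mult_pos_pos) (auto intro!: add_nonneg_pos)
  define S where "S X Y = {(\<Sum>n=1..N. distJ (Z (n - 1)) (Z n)) | (N::nat) Z.
     Z 0 = X \<and> Z N = Y \<and> (\<forall>n\<le>N. Z n \<in> Lag0)}" for X Y
  have dS: "distLag X Y = Inf (S X Y)" for X Y by (simp add: distLag_def S_def)
  \<comment> \<open>A real infimum is meaningful for a nonempty set that is bounded below: the chain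
    with one link gives the former, nonnegativity of \<open>J\<close> the latter.\<close>
  have "distJ X Y \<in> S X Y"
    unfolding S_def using X Y by (intro CollectI exI[of _ "1::nat"] exI[of _ "\<lambda>n. if n = 0 then X else Y"]) auto
  then have ne: "S X Y \<noteq> {}" by blast
  have bd: "bdd_below (S X Y)" for X Y
    by (rule bdd_belowI[of _ 0]) (auto simp: S_def intro!: sum_nonneg distJ_nonneg)
  have "distLag (evolve t X) (evolve t Y) / C \<le> distLag X Y"
    unfolding dS[of X Y]
  proof (rule cInf_greatest[OF ne])
    fix a assume "a \<in> S X Y"
    define P where "P N Z \<longleftrightarrow> a = (\<Sum>n=1..N. distJ (Z (n - 1)) (Z n)) \<and>
       Z 0 = X \<and> Z N = Y \<and> (\<forall>n\<le>N. Z n \<in> Lag0)" for N :: nat and Z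
    have "\<exists>N Z. P N Z" using \<open>a \<in> S X Y\<close> unfolding S_def mem_Collect_eq P_def .
    then obtain N Z where "P N Z" by blast
    then have a: "a = (\<Sum>n=1..N. distJ (Z (n - 1)) (Z n))"
      and Z: "Z 0 = X" "Z N = Y" "\<And>n. n \<le> N \<Longrightarrow> Z n \<in> Lag0" unfolding P_def by auto
    have "(\<Sum>n=1..N. distJ (evolve t (Z (n - 1))) (evolve t (Z n))) \<in> S (evolve t X) (evolve t Y)"
      unfolding S_def
      by (intro CollectI exI[of _ N] exI[of _ "\<lambda>n. evolve t (Z n)"] conjI refl allI impI evolve_Lag0 t Z(3))
        (simp_all add: Z(1,2))
    then have "distLag (evolve t X) (evolve t Y) \<le> (\<Sum>n=1..N. distJ (evolve t (Z (n - 1))) (evolve t (Z n)))"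
      unfolding dS by (rule cInf_lower[OF _ bd])
    also have "\<dots> \<le> (\<Sum>n=1..N. C * distJ (Z (n - 1)) (Z n))"
      unfolding C_def by (rule sum_mono, rule distJ_evolve[OF Z(3) Z(3) t]) auto
    also have "\<dots> = C * a" by (simp add: a sum_distrib_left)
    finally show "distLag (evolve t X) (evolve t Y) / C \<le> a"
      using C by (simp add: divide_le_eq mult.commute)
  qed
  then show ?thesis using C unfolding C_def[symmetric] by (simp add: divide_le_eq mult.commute)
qed

lemma mapL_Lag0:
  assumes "Z \<in> Eul"
  shows "mapL Z \<in> Lag0"
  by (rule mapL_lag0[OF assms]) (use lag.in_Lag in \<open>auto simp: Lag0_def\<close>)

theorem theorem4p11:
  shows "(\<forall>t\<ge>0. \<forall>Z\<in>Eul. opT t Z \<in> Eul) \<and>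
    (\<forall>t\<ge>0. \<forall>Z\<in>Eul. \<forall>Z'\<in>Eul. Z \<approx>\<^sub>D Z' \<longrightarrow> opT t Z \<approx>\<^sub>D opT t Z') \<and>
    (\<forall>Z\<in>Eul. opT 0 Z \<approx>\<^sub>D Z) \<and>
    (\<forall>t\<ge>0. \<forall>s\<ge>0. \<forall>Z\<in>Eul. opT t (opT s Z) \<approx>\<^sub>D opT (t + s) Z) \<and>
    (\<forall>t\<ge>0. \<forall>Z\<in>Eul. \<forall>Z'\<in>Eul.
       distEul (opT t Z) (opT t Z') \<le> exp (1/2 * t) * (1/2 * t\<^sup>2 + t + 1) * distEul Z Z')"
proof -
  have refl: "Z \<approx>\<^sub>D Z" for Z by (cases Z) simp
  have lipschitz: "distEul (opT t Z) (opT t Z') \<le> exp (1/2 * t) * (1/2 * t\<^sup>2 + t + 1) * distEul Z Z'"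
    if "0 \<le> t" "Z \<in> Eul" "Z' \<in> Eul" for t Z Z'
    using distLag_evolve[OF mapL_Lag0[OF that(2)] mapL_Lag0[OF that(3)] that(1)]
    by (simp add: distEul_def opT_def evolve_def)
  have cong: "opT t Z \<approx>\<^sub>D opT t Z'" if "0 \<le> t" "Z \<in> Eul" "Z' \<in> Eul" "Z \<approx>\<^sub>D Z'" for t Z Z'
    using opT_cong[OF that(2-4,1)] refl by simp
  have semigroup: "opT t (opT s Z) \<approx>\<^sub>D opT (t + s) Z" if "0 \<le> t" "0 \<le> s" "Z \<in> Eul" for t s Z
    using opT_opT[OF that(3,1,2)] refl by simp
  show ?thesis
    by (intro conjI ballI allI impI; (rule opT_Eul cong opT_0 semigroup lipschitz; assumption))
qed

end
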